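(* For any integer $n\ge 3$, let $1<\beta<2$ be the largest positive real number satisfying $\beta^n=\beta^{n-2}+\beta^{n-3}+\cdots+\beta+1$. Then the shrinking random $\beta$-transformation $K:\Omega\times E\to\Omega\times E$ and the induced transformation $I=K_{\Omega\times[a,b]}:\Omega\times[a,b]\to\Omega\times[a,b]$ each have a unique measure of maximal entropy. Moreover, if $\mu$ denotes the unique measure of maximal entropy of $K$, then the measure induced by $\mu$ on $\Omega\times[a,b]$, namely $\nu(A)=\mu(A)/\mu(\Omega\times[a,b])$ for measurable $A\subset\Omega\times[a,b]$, is not the unique measure of maximal entropy of $I$.
   Context: Let $\Omega=\{0,1\}^{\mathbb N}$ with the product $\sigma$-algebra and left shift $\sigma$, $E=[0,(\beta-1)^{-1}]$ with the Borel $\sigma$-algebra, $a=(\beta^2-1)^{-1}$ and $b=\beta(\beta^2-1)^{-1}$. (For the $\beta$ considered, $1<\beta<\frac{1+\sqrt5}{2}$.) The shrinking random $\beta$-transformation is $$K(\omega,x)=\begin{cases}(\omega,\beta x)& x\in[0,a),\\ (\sigma(\omega),\beta x-\omega_1)& x\in[a,b],\\ (\omega,\beta x-1)& x\in(b,(\beta-1)^{-1}].\end{cases}$$ For $(\omega,x)\in\Omega\times[a,b]$ the first return time is $\tau(\omega,x)=\min\{k\ge 1: K^k(\omega,x)\in\Omega\times[a,b]\}$, and $I(\omega,x)=K^{\tau(\omega,x)}(\omega,x)$. A measure of maximal entropy (for $K$, respectively $I$) is an invariant probability measure whose Kolmogorov–Sinai entropy equals the supremum of the entropies of all invariant probability measures.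 A system is called intrinsically ergodic if it has a unique measure of maximal entropy, which is then called its intrinsically ergodic measure. *)

theory Defs
  imports "HOL-Probability.Probability"
begin

text \<open>In \<open>invariant_probs N T\<close> only the underlying measurable space of \<open>N\<close> matters.\<close>

definition invariant_probs :: "'a measure \<Rightarrow> ('a \<Rightarrow> 'a) \<Rightarrow> 'a measure set" where
  "invariant_probs N T =
     {M. sets M = sets N \<and> prob_space M \<and> T \<in> measurable M M \<and> distr M M T = M}"

definition finite_measurable_partition :: "'a measure \<Rightarrow> 'a set set \<Rightarrow> bool" where
  "finite_measurable_partition M P \<longleftrightarrow>
     finite P \<and> P \<subseteq> sets M \<and> partition_on (space M) P"

text \<open>Since \<open>0 * ln 0 = 0\<close>, null cells contribute nothing.\<close>

definition partition_entropy :: "'a measure \<Rightarrow> 'a set set \<Rightarrow> real" where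
  "partition_entropy M P = - (\<Sum>A\<in>P. measure M A * ln (measure M A))"

text \<open>The join of \<open>P\<close> and its preimages under \<open>T\<close>, \<dots>, \<open>T ^^ (n - 1)\<close>.\<close>

definition iterated_join :: "'a measure \<Rightarrow> ('a \<Rightarrow> 'a) \<Rightarrow> 'a set set \<Rightarrow> nat \<Rightarrow> 'a set set" where
  "iterated_join M T P n =
     {space M \<inter> (\<Inter>i<n. (T ^^ i) -` A i) | A. \<forall>i<n. A i \<in> P} - {{}}"

text \<open>For an invariant probability measure the limit exists, by subadditivity.\<close>

definition entropy_wrt_partition :: "'a measure \<Rightarrow> ('a \<Rightarrow> 'a) \<Rightarrow> 'a set set \<Rightarrow> real" where
  "entropy_wrt_partition M T P =
     lim (\<lambda>n. partition_entropy M (iterated_join M T P n) / real n)"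

definition ks_entropy :: "'a measure \<Rightarrow> ('a \<Rightarrow> 'a) \<Rightarrow> ereal" where
  "ks_entropy M T =
     (SUP P\<in>{P. finite_measurable_partition M P}. ereal (entropy_wrt_partition M T P))"

definition max_entropy_measure :: "'a measure \<Rightarrow> ('a \<Rightarrow> 'a) \<Rightarrow> 'a measure \<Rightarrow> bool" where
  "max_entropy_measure N T M \<longleftrightarrow>
     M \<in> invariant_probs N T \<and>
     ks_entropy M T = (SUP M'\<in>invariant_probs N T. ks_entropy M' T)"

definition first_return_time :: "('a \<Rightarrow> 'a) \<Rightarrow> 'a set \<Rightarrow> 'a \<Rightarrow> nat" where
  "first_return_time T S z = (LEAST k. 1 \<le> k \<and> (T ^^ k) z \<in> S)"

definition induced_map :: "('a \<Rightarrow> 'a) \<Rightarrow> 'a set \<Rightarrow> 'a \<Rightarrow> 'a" where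
  "induced_map T S z = (T ^^ first_return_time T S z) z"

definition induced_measure :: "'a measure \<Rightarrow> 'a set \<Rightarrow> 'a measure" where
  "induced_measure M S = restrict_space (uniform_measure M S) S"

lemma sets_induced_measure:
  "sets M = sets N \<Longrightarrow> sets (induced_measure M S) = sets (restrict_space N S)"
  by (simp add: induced_measure_def sets_restrict_space)

lemma measure_induced_measure:
  assumes "prob_space M" "S \<in> sets M" "A \<in> sets M" "A \<subseteq> S"
  shows "measure (induced_measure M S) A = measure M A / measure M S"
proof -
  interpret prob_space M by fact
  have "S \<inter> A = A" using assms by blast
  moreover have "measure M A = 0" if "measure M S = 0"
    using that assms finite_measure_mono[of A S] measure_nonneg[of M A] by simp
  ultimately have "emeasure (uniform_measure M S) A = ennreal (measure M A / measure M S)"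
    using assms divide_ennreal[of "measure M A" "measure M S"]
    by (cases "measure M S = 0")
       (auto simp: emeasure_eq_measure zero_less_measure_iff)
  then have "measure (uniform_measure M S) A = measure M A / measure M S"
    by (simp add: measure_def)
  then show ?thesis
    using assms by (simp add: induced_measure_def measure_restrict_space)
qed

definition coin_space :: "(nat \<Rightarrow> bool) measure" where
  "coin_space = PiM UNIV (\<lambda>_. count_space UNIV)"

definition left_shift :: "(nat \<Rightarrow> bool) \<Rightarrow> nat \<Rightarrow> bool" where
  "left_shift \<omega> = (\<lambda>i. \<omega> (Suc i))"

definition switch_left :: "real \<Rightarrow> real" where
  "switch_left \<beta> = 1 / (\<beta>\<^sup>2 - 1)"

definition switch_right :: "real \<Rightarrow> real" where
  "switch_right \<beta> = \<beta> / (\<beta>\<^sup>2 - 1)"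

definition phase_space :: "real \<Rightarrow> ((nat \<Rightarrow> bool) \<times> real) measure" where
  "phase_space \<beta> = coin_space \<Otimes>\<^sub>M restrict_space borel {0..1 / (\<beta> - 1)}"

definition switch_region :: "real \<Rightarrow> ((nat \<Rightarrow> bool) \<times> real) set" where
  "switch_region \<beta> = UNIV \<times> {switch_left \<beta>..switch_right \<beta>}"

text \<open>The digits \<open>0\<close>, \<open>1\<close> are encoded as \<open>False\<close>, \<open>True\<close>, and the first digit of \<open>\<omega>\<close> is
  \<open>\<omega> 0\<close>. Only the values on \<open>space (phase_space \<beta>)\<close> are relevant.\<close>

definition shrinking_map ::
    "real \<Rightarrow> (nat \<Rightarrow> bool) \<times> real \<Rightarrow> (nat \<Rightarrow> bool) \<times> real" where
  "shrinking_map \<beta> = (\<lambda>(\<omega>, x).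
     if x < switch_left \<beta> then (\<omega>, \<beta> * x)
     else if x \<le> switch_right \<beta> then (left_shift \<omega>, \<beta> * x - of_bool (\<omega> 0))
     else (\<omega>, \<beta> * x - 1))"

definition switch_space :: "real \<Rightarrow> ((nat \<Rightarrow> bool) \<times> real) measure" where
  "switch_space \<beta> = restrict_space (phase_space \<beta>) (switch_region \<beta>)"

definition induced_shrinking_map ::
    "real \<Rightarrow> (nat \<Rightarrow> bool) \<times> real \<Rightarrow> (nat \<Rightarrow> bool) \<times> real" where
  "induced_shrinking_map \<beta> = induced_map (shrinking_map \<beta>) (switch_region \<beta>)"

end

theory Submission imports Defs begin

text \<open>
  Write \<open>a\<close>, \<open>b\<close> for the ends of the switch region. The equation for \<open>\<beta>\<close> says that
  \<open>\<beta> a - 1 = a / \<beta>^(n - 1)\<close>, so that every branch of the induced map is full: up to the orbits of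
  \<open>a\<close> and \<open>b\<close>, the induced map is the full shift on the labels \<open>(d, t)\<close>, where \<open>d\<close> is the digit used
  and \<open>2 \<le> t \<le> n\<close> the return time. Its measure of maximal entropy is the uniform Bernoulli measure,
  with entropy \<open>ln (2 (n - 1))\<close>. The map \<open>K\<close> is the tower over this shift with heights \<open>t\<close>, and its
  measure of maximal entropy, with entropy \<open>ln \<lambda>\<close>, is carried by the tower over the Bernoulli measure
  with weights \<open>\<lambda>^(- t)\<close>, where \<open>2 (\<lambda>^(-2) + \<dots> + \<lambda>^(- n)) = 1\<close>. As \<open>n \<ge> 3\<close>, these weights are not
  all equal.

  The upper bounds and the uniqueness come from Gibbs' inequality with respect to a sub-Markov kernel
  with weights \<open>\<lambda>^(- t)\<close>: equality forces the law of the itinerary to be the Markov law of the kernel.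
  On the orbits of \<open>a\<close> and \<open>b\<close> and on the fixed points \<open>0\<close> and \<open>1 / (\<beta> - 1)\<close> of \<open>K\<close> the bound is strict,
  so that these sets are null for a measure of maximal entropy.
\<close>

section \<open>Entropy of finite-valued functions\<close>

text \<open>Entropy is bounded for \<open>K\<close> itself, not by inducing an arbitrary invariant
  measure and comparing entropies. Recording at each point the time until the next entry to the
  switch region makes this possible: an entry with return time \<open>t\<close> has weight
  \<open>(1 / lam) ^ t\<close>, a waiting step has weight \<open>1\<close>, and up to a coboundary
  this is a constant cost \<open>ln lam\<close> per unit of time. That the weights of all labels add
  up to \<open>1\<close> is the equation for \<open>lam\<close>. Two obstacles shape the coding.
  From \<open>a\<close> with digit \<open>0\<close>, or from \<open>b\<close> with digit
  \<open>1\<close>, the return takes one step, which happens nowhere else in the switch region. The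
  orbits of the end points therefore get states of their own, with two continuations per entry, of
  total weight \<open>1 / lam + (1 / lam) ^ n < 1\<close>. At the fixed points of \<open>K\<close>
  no digit is ever consumed, so an itinerary does not see the first coordinate; there the value of
  the partition under study is added to the state, at no cost since \<open>K\<close> is the identity
  on these points.\<close>

definition eta :: "real \<Rightarrow> real" where
  "eta t = - t * ln t"

text \<open>The tangent-line bound \<open>ln t \<le> t - 1\<close> at \<open>t = q / p\<close>. The
  linear term \<open>q - p\<close> is kept so that the inequality can be summed when the
  \<open>q\<close> have total mass below \<open>1\<close>, without normalising.\<close>

lemma eta_gibbs:
  assumes "0 \<le> p" "0 \<le> q" "0 < p \<Longrightarrow> 0 < q"
  shows "eta p \<le> - p * ln q + q - p"
proof (cases "p = 0")
  case False
  then have p: "0 < p" and q: "0 < q" using assms by auto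
  have "ln (q / p) \<le> q / p - 1" using p q by (intro ln_le_minus_one) simp
  then have "p * ln (q / p) \<le> p * (q / p - 1)" using p by (intro mult_left_mono) auto
  then show ?thesis using p q by (simp add: eta_def ln_div algebra_simps)
qed (use assms in \<open>simp add: eta_def\<close>)

lemma eta_gibbs_eq:
  assumes "0 \<le> p" "0 \<le> q" "0 < p \<Longrightarrow> 0 < q" "- p * ln q + q - p \<le> eta p"
  shows "p = q"
proof (cases "p = 0")
  case True
  then show ?thesis using assms by (simp add: eta_def)
next
  case False
  then have p: "0 < p" and q: "0 < q" using assms by auto
  have "p * (q / p - 1) \<le> p * ln (q / p)"
    using assms(4) p q by (simp add: eta_def ln_div algebra_simps)
  then have "q / p - 1 \<le> ln (q / p)" using p by simp
  then have "ln (q / p) = q / p - 1"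
    using ln_le_minus_one[of "q / p"] p q by simp
  then have "q / p = 1" using ln_eq_minus_one[of "q / p"] p q by simp
  then show ?thesis using p by simp
qed

definition law :: "'a measure \<Rightarrow> ('a \<Rightarrow> 'b) \<Rightarrow> 'b \<Rightarrow> real" where
  "law M X v = measure M (X -` {v} \<inter> space M)"

definition ent :: "'a measure \<Rightarrow> ('a \<Rightarrow> 'b) \<Rightarrow> real" where
  "ent M X = (\<Sum>v\<in>X ` space M. eta (law M X v))"

lemma law_nonneg[simp]: "0 \<le> law M X v"
  by (simp add: law_def)

lemma law_outside: "v \<notin> X ` space M \<Longrightarrow> law M X v = 0"
proof -
  assume "v \<notin> X ` space M"
  then have "X -` {v} \<inter> space M = {}" by auto
  then show ?thesis by (simp add: law_def)
qed

lemma ent_superset: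
  assumes "finite R" "X ` space M \<subseteq> R"
  shows "ent M X = (\<Sum>v\<in>R. eta (law M X v))"
  unfolding ent_def using assms
  by (intro sum.mono_neutral_left) (auto simp: law_outside eta_def)

lemma law_inj:
  assumes "inj_on f (X ` space M)" "v \<in> X ` space M"
  shows "law M (\<lambda>z. f (X z)) (f v) = law M X v"
proof -
  have "(\<lambda>z. f (X z)) -` {f v} \<inter> space M = X -` {v} \<inter> space M"
    using assms by (auto simp: inj_on_def)
  then show ?thesis by (simp add: law_def)
qed

lemma ent_inj:
  assumes "inj_on f (X ` space M)"
  shows "ent M (\<lambda>z. f (X z)) = ent M X"
proof -
  have "(\<lambda>z. f (X z)) ` space M = f ` (X ` space M)" by auto
  then show ?thesis
    using assms by (simp add: ent_def sum.reindex law_inj)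
qed

text \<open>Functions that determine each other have the same fibres. This is the tool for cutting
  words into head, middle and last letter.\<close>

lemma ent_recode:
  assumes "\<And>z. z \<in> space M \<Longrightarrow> Y z = f (X z)" "\<And>z. z \<in> space M \<Longrightarrow> X z = g (Y z)"
  shows "ent M Y = ent M X"
proof -
  have "ent M Y = ent M (\<lambda>z. f (X z))"
    using assms(1) unfolding ent_def law_def
    by (intro sum.cong arg_cong[where f=eta] arg_cong[where f="measure M"] image_cong) auto
  also have "\<dots> = ent M X"
  proof (rule ent_inj, rule inj_on_inverseI[where g=g])
    fix x assume "x \<in> X ` space M"
    then show "g (f x) = x" using assms by (metis imageE)
  qed
  finally show ?thesis .
qed

section \<open>Gibbs' inequality for kernels and strong subadditivity\<close>

context prob_space begin

lemma law_sets:
  assumes "simple_function M X"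
  shows "X -` V \<inter> space M \<in> sets M"
  using assms by (rule simple_functionD(2))

lemma law_le_1: "law M X v \<le> 1"
  by (simp add: law_def)

lemma sum_law:
  assumes X: "simple_function M X"
  shows "(\<Sum>v\<in>X ` space M \<inter> V. law M X v) = prob (X -` V \<inter> space M)"
proof -
  have fin: "finite (X ` space M)" using X by (rule simple_functionD(1))
  have "X -` V \<inter> space M = (\<Union>v\<in>X ` space M \<inter> V. X -` {v} \<inter> space M)" by auto
  moreover have "prob (\<Union>v\<in>X ` space M \<inter> V. X -` {v} \<inter> space M) =
      (\<Sum>v\<in>X ` space M \<inter> V. prob (X -` {v} \<inter> space M))"
    using fin X by (intro finite_measure_finite_Union)
      (auto intro: simple_functionD(2) simp: disjoint_family_on_def)
  ultimately show ?thesis unfolding law_def by metis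
qed

lemma integral_simple:
  fixes g :: "'b \<Rightarrow> real"
  assumes X: "simple_function M X"
  shows "(\<integral>z. g (X z) \<partial>M) = (\<Sum>v\<in>X ` space M. g v * law M X v)"
proof -
  have fin: "finite (X ` space M)" using X by (rule simple_functionD(1))
  have "(\<integral>z. g (X z) \<partial>M) =
    (\<integral>z. (\<Sum>v\<in>X ` space M. g v * indicator (X -` {v} \<inter> space M) z) \<partial>M)"
  proof (intro Bochner_Integration.integral_cong refl)
    fix z assume z: "z \<in> space M"
    have "(\<Sum>v\<in>X ` space M. g v * indicator (X -` {v} \<inter> space M) z) =
      (\<Sum>v\<in>X ` space M. if X z = v then g v else 0)"
      using z by (intro sum.cong) auto
    also have "\<dots> = g (X z)" using fin z by simp
    finally show "g (X z) = (\<Sum>v\<in>X ` space M. g v * indicator (X -` {v} \<inter> space M) z)" ..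
  qed
  also have "\<dots> = (\<Sum>v\<in>X ` space M. g v * law M X v)"
    using X by (subst Bochner_Integration.integral_sum)
      (auto simp: law_def simple_functionD(2) emeasure_eq_measure intro!: sum.cong)
  finally show ?thesis .
qed

lemma integrable_simple:
  fixes g :: "'b \<Rightarrow> real"
  assumes X: "simple_function M X"
  shows "integrable M (\<lambda>z. g (X z))"
proof -
  have fin: "finite (X ` space M)" using X by (rule simple_functionD(1))
  have "simple_function M (\<lambda>z. g (X z))" by (rule simple_function_compose1[OF X])
  then have "(\<lambda>z. g (X z)) \<in> borel_measurable M" by (rule borel_measurable_simple_function)
  moreover have "norm (g (X z)) \<le> (\<Sum>v\<in>X ` space M. \<bar>g v\<bar>)" if "z \<in> space M" for z
    using fin that by (simp add: member_le_sum[of "X z" _ "\<lambda>v. \<bar>g v\<bar>"])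
  ultimately show ?thesis by (intro integrable_const_bound) auto
qed

lemma law_marginal:
  assumes "simple_function M X" "simple_function M Y" "finite R" "Y ` space M \<subseteq> R"
  shows "law M X v = (\<Sum>y\<in>R. law M (\<lambda>z. (X z, Y z)) (v, y))"
proof -
  have eq: "X -` {v} \<inter> space M = (\<Union>y\<in>R. (\<lambda>z. (X z, Y z)) -` {(v, y)} \<inter> space M)"
    using assms(4) by auto
  show ?thesis
    unfolding law_def eq using assms
    by (intro finite_measure_finite_Union)
      (auto intro!: law_sets simple_function_Pair simp: disjoint_family_on_def)
qed

lemma law_pair_le:
  assumes "simple_function M X" "simple_function M Y"
  shows "law M (\<lambda>z. (X z, Y z)) (x, y) \<le> law M X x"
    and "law M (\<lambda>z. (X z, Y z)) (x, y) \<le> law M Y y"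
  using assms unfolding law_def by (auto intro!: finite_measure_mono law_sets)

lemma ent_eq_integral:
  assumes X: "simple_function M X"
  shows "ent M X = - (\<integral>z. ln (law M X (X z)) \<partial>M)"
  unfolding ent_def by (subst integral_simple[OF X]) (simp add: eta_def sum_negf mult.commute)

lemma ent_nonneg: "0 \<le> ent M X"
proof -
  have "0 \<le> eta (law M X v)" for v
    using law_le_1[of X v] by (cases "law M X v = 0") (auto simp: eta_def mult_le_0_iff less_le)
  then show ?thesis unfolding ent_def by (intro sum_nonneg) auto
qed

lemma AE_law_pos:
  assumes X: "simple_function M X"
  shows "AE z in M. 0 < law M X (X z)"
proof -
  have fin: "finite (X ` space M)" using X by (rule simple_functionD(1))
  let ?N = "\<Union>v\<in>X ` space M \<inter> {v. law M X v = 0}. X -` {v} \<inter> space M"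
  have "?N \<in> null_sets M"
    using fin X by (intro null_sets.finite_UN)
      (auto simp: law_def null_sets_def emeasure_eq_measure simple_functionD(2))
  moreover have "{z \<in> space M. \<not> 0 < law M X (X z)} \<subseteq> ?N"
    using law_nonneg[of M X] by (auto simp: less_le)
  ultimately show ?thesis by (rule AE_I')
qed

lemma ent_le_pair:
  assumes X: "simple_function M X" and Y: "simple_function M Y"
  shows "ent M X \<le> ent M (\<lambda>z. (X z, Y z))"
proof -
  have XY: "simple_function M (\<lambda>z. (X z, Y z))" using X Y by (rule simple_function_Pair)
  have "(\<integral>z. ln (law M (\<lambda>z. (X z, Y z)) (X z, Y z)) \<partial>M) \<le> (\<integral>z. ln (law M X (X z)) \<partial>M)"
  proof (rule integral_mono_AE)
    show "integrable M (\<lambda>z. ln (law M (\<lambda>z. (X z, Y z)) (X z, Y z)))"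
      using integrable_simple[OF XY, of "\<lambda>v. ln (law M (\<lambda>z. (X z, Y z)) v)"] by simp
    show "integrable M (\<lambda>z. ln (law M X (X z)))"
      by (rule integrable_simple[OF X])
    show "AE z in M. ln (law M (\<lambda>z. (X z, Y z)) (X z, Y z)) \<le> ln (law M X (X z))"
      using AE_law_pos[OF XY] law_pair_le(1)[OF X Y] by (auto elim!: eventually_mono intro: ln_mono)
  qed
  then show ?thesis by (simp add: ent_eq_integral[OF X] ent_eq_integral[OF XY])
qed

text \<open>Strong subadditivity, Fano's inequality and the Markov bound on entropy are all instances of
  the following Gibbs inequality for a sub-Markov kernel \<open>r\<close>.\<close>

lemma
  assumes X: "simple_function M X" and Y: "simple_function M Y"
    and fY: "finite RY" and RY: "Y ` space M \<subseteq> RY"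
    and r0: "\<And>x y. 0 \<le> r x y"
    and r1: "\<And>x. 0 < law M X x \<Longrightarrow> (\<Sum>y\<in>RY. r x y) \<le> 1"
    and rpos: "\<And>x y. 0 < law M (\<lambda>z. (X z, Y z)) (x, y) \<Longrightarrow> 0 < r x y"
  shows cond_gibbs: "ent M (\<lambda>z. (X z, Y z)) \<le> ent M X - (\<integral>z. ln (r (X z) (Y z)) \<partial>M)"
    and cond_gibbs_eq: "ent M X - (\<integral>z. ln (r (X z) (Y z)) \<partial>M) \<le> ent M (\<lambda>z. (X z, Y z)) \<Longrightarrow>
      y \<in> RY \<Longrightarrow> law M (\<lambda>z. (X z, Y z)) (x, y) = law M X x * r x y"
proof -
  have XY: "simple_function M (\<lambda>z. (X z, Y z))" using X Y by (rule simple_function_Pair)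
  let ?RX = "X ` space M"
  let ?p = "\<lambda>x y. law M (\<lambda>z. (X z, Y z)) (x, y)" and ?q = "law M X"
  have fX: "finite ?RX" using X by (rule simple_functionD(1))
  have sub: "(\<lambda>z. (X z, Y z)) ` space M \<subseteq> ?RX \<times> RY" using RY by auto
  \<comment> \<open>\<open>gap x y\<close> is the deficit of Gibbs' inequality at one pair of
    values. It is nonnegative, and its sum is at most the deficit of the entropy bound, so equality
    there makes every term vanish.\<close>
  define gap where "gap x y = (- ?p x y * ln (?q x * r x y) + ?q x * r x y - ?p x y) - eta (?p x y)" for x y
  have pos: "0 < ?p x y \<Longrightarrow> 0 < ?q x \<and> 0 < r x y" for x y
    using law_pair_le(1)[OF X Y, of x y] rpos[of x y] by auto
  have gap0: "0 \<le> gap x y" for x y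
    unfolding gap_def using eta_gibbs[of "?p x y" "?q x * r x y"] pos[of x y] r0[of x y] by simp
  have entXY: "ent M (\<lambda>z. (X z, Y z)) = (\<Sum>x\<in>?RX. \<Sum>y\<in>RY. eta (?p x y))"
    using ent_superset[OF _ sub] fX fY by (simp add: sum.cartesian_product case_prod_beta)
  have entX: "ent M X = (\<Sum>x\<in>?RX. \<Sum>y\<in>RY. - ?p x y * ln (?q x))"
    unfolding ent_def eta_def
    by (intro sum.cong refl) (simp add: law_marginal[OF X Y fY RY] sum_distrib_right sum_negf)
  have int: "(\<integral>z. ln (r (X z) (Y z)) \<partial>M) = (\<Sum>x\<in>?RX. \<Sum>y\<in>RY. ?p x y * ln (r x y))"
  proof -
    have "(\<integral>z. ln (r (X z) (Y z)) \<partial>M) =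
      (\<Sum>v\<in>(\<lambda>z. (X z, Y z)) ` space M. ln (r (fst v) (snd v)) * law M (\<lambda>z. (X z, Y z)) v)"
      using integral_simple[OF XY, of "\<lambda>v. ln (r (fst v) (snd v))"] by simp
    also have "\<dots> = (\<Sum>v\<in>?RX \<times> RY. ln (r (fst v) (snd v)) * law M (\<lambda>z. (X z, Y z)) v)"
      using fX fY sub by (intro sum.mono_neutral_left) (auto simp: law_outside)
    finally show ?thesis by (simp add: sum.cartesian_product case_prod_beta mult.commute)
  qed
  have "(\<Sum>x\<in>?RX. \<Sum>y\<in>RY. gap x y) =
     (\<Sum>x\<in>?RX. \<Sum>y\<in>RY. (- ?p x y * ln (?q x)) - ?p x y * ln (r x y) + (?q x * r x y - ?p x y) - eta (?p x y))"
  proof (intro sum.cong refl)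
    fix x y
    have "?p x y * ln (?q x * r x y) = ?p x y * ln (?q x) + ?p x y * ln (r x y)"
    proof (cases "?p x y = 0")
      case False
      then have "0 < ?p x y" using law_nonneg[of M _ "(x, y)"] by (simp add: less_le)
      then show ?thesis using pos[of x y] by (simp add: ln_mult algebra_simps)
    qed simp
    then show "gap x y = (- ?p x y * ln (?q x)) - ?p x y * ln (r x y) + (?q x * r x y - ?p x y) - eta (?p x y)"
      by (simp add: gap_def)
  qed
  also have "\<dots> = ent M X - (\<integral>z. ln (r (X z) (Y z)) \<partial>M) +
      (\<Sum>x\<in>?RX. \<Sum>y\<in>RY. ?q x * r x y - ?p x y) - ent M (\<lambda>z. (X z, Y z))"
    unfolding entXY entX int by (simp add: sum.distrib sum_subtractf)
  finally have gapsum: "(\<Sum>x\<in>?RX. \<Sum>y\<in>RY. gap x y) = ent M X - (\<integral>z. ln (r (X z) (Y z)) \<partial>M) +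
      (\<Sum>x\<in>?RX. \<Sum>y\<in>RY. ?q x * r x y - ?p x y) - ent M (\<lambda>z. (X z, Y z))" .
  \<comment> \<open>The sub-Markov property enters here: mass missing from the kernel only
    helps.\<close>
  have "(\<Sum>x\<in>?RX. \<Sum>y\<in>RY. ?q x * r x y - ?p x y) \<le> 0"
  proof (rule sum_nonpos)
    fix x assume "x \<in> ?RX"
    have "(\<Sum>y\<in>RY. ?q x * r x y - ?p x y) = ?q x * (\<Sum>y\<in>RY. r x y) - ?q x"
      by (simp add: sum_subtractf sum_distrib_left law_marginal[OF X Y fY RY, of x])
    also have "\<dots> \<le> 0"
      using r1[of x] law_nonneg[of M X x] by (cases "?q x = 0") (auto simp: mult_left_le)
    finally show "(\<Sum>y\<in>RY. ?q x * r x y - ?p x y) \<le> 0" .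
  qed
  with gapsum have up: "(\<Sum>x\<in>?RX. \<Sum>y\<in>RY. gap x y) \<le>
      ent M X - (\<integral>z. ln (r (X z) (Y z)) \<partial>M) - ent M (\<lambda>z. (X z, Y z))" by simp
  moreover have "0 \<le> (\<Sum>x\<in>?RX. \<Sum>y\<in>RY. gap x y)" by (intro sum_nonneg gap0)
  ultimately show "ent M (\<lambda>z. (X z, Y z)) \<le> ent M X - (\<integral>z. ln (r (X z) (Y z)) \<partial>M)" by simp
  assume "ent M X - (\<integral>z. ln (r (X z) (Y z)) \<partial>M) \<le> ent M (\<lambda>z. (X z, Y z))"
  then have "(\<Sum>x\<in>?RX. \<Sum>y\<in>RY. gap x y) = 0"
    using up by (intro antisym sum_nonneg gap0) simp
  then have "\<forall>x\<in>?RX. \<forall>y\<in>RY. gap x y = 0"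
    using fX fY by (simp add: sum_nonneg_eq_0_iff gap0 sum_nonneg)
  moreover assume "y \<in> RY"
  ultimately have *: "x \<in> ?RX \<Longrightarrow> gap x y = 0" by blast
  show "law M (\<lambda>z. (X z, Y z)) (x, y) = law M X x * r x y"
  proof (cases "x \<in> ?RX")
    case True
    with * have "gap x y = 0" by simp
    then show ?thesis
      using eta_gibbs_eq[of "?p x y" "?q x * r x y"] pos[of x y] r0[of x y] by (simp add: gap_def)
  next
    case False
    then have "(x, y) \<notin> (\<lambda>z. (X z, Y z)) ` space M" by auto
    then show ?thesis using False by (simp add: law_outside)
  qed
qed

text \<open>The kernel is the conditional law of \<open>C\<close> given \<open>B\<close>, used as a
  guess for \<open>C\<close> given both \<open>A\<close> and \<open>B\<close>.\<close>

lemma ent_strong_subadditive: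
  assumes A: "simple_function M A" and B: "simple_function M B" and C: "simple_function M C"
  shows "ent M (\<lambda>z. ((A z, B z), C z)) \<le>
    ent M (\<lambda>z. (A z, B z)) + ent M (\<lambda>z. (B z, C z)) - ent M B"
proof -
  have BC: "simple_function M (\<lambda>z. (B z, C z))" using B C by (rule simple_function_Pair)
  have AB: "simple_function M (\<lambda>z. (A z, B z))" using A B by (rule simple_function_Pair)
  let ?r = "\<lambda>ab c. law M (\<lambda>z. (B z, C z)) (snd ab, c) / law M B (snd ab)"
  have "ent M (\<lambda>z. ((A z, B z), C z)) \<le> ent M (\<lambda>z. (A z, B z)) - (\<integral>z. ln (?r (A z, B z) (C z)) \<partial>M)"
  proof (rule cond_gibbs[OF AB C simple_functionD(1)[OF C] order_refl])
    fix x :: "'b \<times> 'c"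
    have "(\<Sum>y\<in>C ` space M. ?r x y) = law M B (snd x) / law M B (snd x)"
      by (simp only: law_marginal[OF B C simple_functionD(1)[OF C] order_refl, of "snd x"] sum_divide_distrib[symmetric])
    then show "(\<Sum>y\<in>C ` space M. ?r x y) \<le> 1" by simp
  next
    fix x y assume *: "0 < law M (\<lambda>z. ((A z, B z), C z)) (x, y)"
    have "law M (\<lambda>z. ((A z, B z), C z)) (x, y) \<le> law M (\<lambda>z. (B z, C z)) (snd x, y)"
      unfolding law_def by (intro finite_measure_mono law_sets[OF BC]) auto
    with * law_pair_le(1)[OF B C, of "snd x" y]
    show "0 < ?r x y" by (auto intro!: divide_pos_pos)
  qed auto
  also have "(\<integral>z. ln (?r (A z, B z) (C z)) \<partial>M) =
    (\<integral>z. ln (law M (\<lambda>z. (B z, C z)) (B z, C z)) - ln (law M B (B z)) \<partial>M)"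
  proof (rule integral_cong_AE)
    show "(\<lambda>z. ln (?r (A z, B z) (C z))) \<in> borel_measurable M"
      using borel_measurable_integrable[OF integrable_simple[OF BC, of "\<lambda>v. ln (?r (undefined, fst v) (snd v))"]] by simp
    show "(\<lambda>z. ln (law M (\<lambda>z. (B z, C z)) (B z, C z)) - ln (law M B (B z))) \<in> borel_measurable M"
      using borel_measurable_integrable[OF integrable_simple[OF BC, of "\<lambda>v. ln (law M (\<lambda>z. (B z, C z)) v) - ln (law M B (fst v))"]] by simp
    show "AE z in M. ln (?r (A z, B z) (C z)) = ln (law M (\<lambda>z. (B z, C z)) (B z, C z)) - ln (law M B (B z))"
      using AE_law_pos[OF BC] AE_law_pos[OF B] by eventually_elim (simp add: ln_div)
  qed
  also have "\<dots> = (\<integral>z. ln (law M (\<lambda>z. (B z, C z)) (B z, C z)) \<partial>M) - (\<integral>z. ln (law M B (B z)) \<partial>M)"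
    using integrable_simple[OF BC, of "\<lambda>v. ln (law M (\<lambda>z. (B z, C z)) v)"] integrable_simple[OF B, of "\<lambda>v. ln (law M B v)"]
    by (intro Bochner_Integration.integral_diff) auto
  also have "\<dots> = ent M B - ent M (\<lambda>z. (B z, C z))"
    using ent_eq_integral[OF B] ent_eq_integral[OF BC] by simp
  finally show ?thesis by simp
qed

end

section \<open>Entropy of a measure-preserving map\<close>

definition word :: "('a \<Rightarrow> 'a) \<Rightarrow> ('a \<Rightarrow> 'b) \<Rightarrow> nat \<Rightarrow> 'a \<Rightarrow> 'b list" where
  "word T s m z = map (\<lambda>i. s ((T ^^ i) z)) [0..<m]"

lemma word_0[simp]: "word T s 0 z = []"
  by (simp add: word_def)

lemma word_Suc: "word T s (Suc m) z = s z # word T s m (T z)"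
proof -
  have "[0..<Suc m] = 0 # map Suc [0..<m]" by (simp add: upt_conv_Cons map_Suc_upt del: upt_Suc)
  then show ?thesis unfolding word_def by (simp add: funpow_swap1 del: upt_Suc)
qed

lemma word_Suc_append: "word T s (Suc m) z = word T s m z @ [s ((T ^^ m) z)]"
  by (simp add: word_def)

lemma length_word[simp]: "length (word T s m z) = m"
  by (simp add: word_def)

lemma take_word: "m \<le> m' \<Longrightarrow> take m (word T s m' z) = word T s m z"
  by (simp add: word_def take_map)

lemma nth_word: "i < m \<Longrightarrow> word T s m z ! i = s ((T ^^ i) z)"
  by (simp add: word_def)

lemma word_add: "word T s (i + m) z = word T s i z @ word T s m ((T ^^ i) z)"
  by (rule nth_equalityI) (auto simp: nth_word nth_append funpow_add[symmetric, THEN fun_cong, unfolded o_def])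

definition entropy_rate :: "'a measure \<Rightarrow> ('a \<Rightarrow> 'a) \<Rightarrow> ('a \<Rightarrow> 'b) \<Rightarrow> real" where
  "entropy_rate M T s = lim (\<lambda>m. ent M (word T s m) / real m)"

text \<open>The increments decrease, hence so do the averages \<open>H m / m\<close>, which are
  bounded below. From index \<open>k\<close> on, \<open>H\<close> grows at most linearly, with slope
  the \<open>k\<close>-th increment.\<close>

lemma
  fixes H :: "nat \<Rightarrow> real"
  assumes H0: "H 0 = 0" and H: "\<And>m. 0 \<le> H m"
    and d: "\<And>m. H (Suc (Suc m)) - H (Suc m) \<le> H (Suc m) - H m"
  shows concave_rate_convergent: "convergent (\<lambda>m. H m / real m)"
    and concave_rate_le: "lim (\<lambda>m. H m / real m) \<le> H (Suc k) - H k"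
proof -
  define D where "D i = H (Suc i) - H i" for i
  have dec: "decseq D" unfolding decseq_Suc_iff using d by (simp add: D_def)
  have Hsum: "H m = (\<Sum>i<m. D i)" for m
    by (simp add: D_def sum_lessThan_telescope H0)
  have avg: "real m * D m \<le> H m" for m
  proof -
    have "(\<Sum>i<m. D m) \<le> (\<Sum>i<m. D i)" using decseqD[OF dec] by (intro sum_mono) simp
    then show ?thesis by (simp add: Hsum)
  qed
  have "decseq (\<lambda>m. H (Suc m) / real (Suc m))"
    unfolding decseq_Suc_iff
  proof
    fix m
    have "H (Suc (Suc m)) = H (Suc m) + D (Suc m)" by (simp add: D_def)
    then show "H (Suc (Suc m)) / real (Suc (Suc m)) \<le> H (Suc m) / real (Suc m)"
      using avg[of "Suc m"] by (simp add: field_simps)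
  qed
  then have "convergent (\<lambda>m. H (Suc m) / real (Suc m))"
    by (rule decseq_convergent[of _ 0]) (auto simp: convergent_def H)
  then show conv: "convergent (\<lambda>m. H m / real m)"
    by (subst (asm) convergent_Suc_iff)
  then have lim: "(\<lambda>m. H m / real m) \<longlonglongrightarrow> lim (\<lambda>m. H m / real m)"
    by (simp add: convergent_LIMSEQ_iff)
  have up: "H (k + j) \<le> H k + real j * D k" for j
  proof (induction j)
    case (Suc j)
    have "D (k + j) \<le> D k" using decseqD[OF dec, of k "k + j"] by simp
    then show ?case using Suc by (simp add: D_def algebra_simps)
  qed simp
  have "(\<lambda>m. (H k - real k * D k) / real m + D k) \<longlonglongrightarrow> 0 + D k"
    by (intro tendsto_intros lim_const_over_n)
  then have "lim (\<lambda>m. H m / real m) \<le> 0 + D k"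
  proof (rule LIMSEQ_le[OF lim])
    show "\<exists>N. \<forall>m\<ge>N. H m / real m \<le> (H k - real k * D k) / real m + D k"
    proof (intro exI allI impI)
      fix m assume m: "Suc k \<le> m"
      have "H m \<le> H k + real (m - k) * D k" using up[of "m - k"] m by simp
      then show "H m / real m \<le> (H k - real k * D k) / real m + D k"
        using m by (simp add: field_simps of_nat_diff)
    qed
  qed
  then show "lim (\<lambda>m. H m / real m) \<le> H (Suc k) - H k" by (simp add: D_def)
qed

section \<open>Stationary processes and their entropy rate\<close>

locale mpt = prob_space M for M :: "'a measure" +
  fixes T :: "'a \<Rightarrow> 'a"
  assumes T: "T \<in> measurable M M" and inv: "distr M M T = M"
begin

lemma T_space: "z \<in> space M \<Longrightarrow> T z \<in> space M"
  using T by (rule measurable_space)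

lemma funpow_T: "T ^^ i \<in> measurable M M"
  by (rule measurable_compose_n) (rule T)

lemma prob_T: "A \<in> sets M \<Longrightarrow> prob (T -` A \<inter> space M) = prob A"
  using measure_distr[OF T, of A] by (simp add: inv)

lemma simple_T: "simple_function M X \<Longrightarrow> simple_function M (\<lambda>z. X (T z))"
  by (rule simple_function_comp[OF T])

lemma law_T:
  assumes "simple_function M X" shows "law M (\<lambda>z. X (T z)) v = law M X v"
proof -
  have "(\<lambda>z. X (T z)) -` {v} \<inter> space M = T -` (X -` {v} \<inter> space M) \<inter> space M"
    using T_space by auto
  then show ?thesis unfolding law_def using prob_T[OF law_sets[OF assms]] by simp
qed

lemma ent_T:
  assumes X: "simple_function M X" shows "ent M (\<lambda>z. X (T z)) = ent M X"
proof -
  have "ent M (\<lambda>z. X (T z)) = (\<Sum>v\<in>X ` space M. eta (law M (\<lambda>z. X (T z)) v))"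
    using simple_functionD(1)[OF X] T_space by (intro ent_superset) auto
  then show ?thesis by (simp add: law_T[OF X] ent_def)
qed

lemma simple_word: "simple_function M s \<Longrightarrow> simple_function M (word T s m)"
proof (induction m)
  case (Suc m)
  have "simple_function M (\<lambda>z. s z # word T s m (T z))"
    by (rule simple_function_compose2[OF Suc.prems simple_T[OF Suc.IH[OF Suc.prems]]])
  then show ?case by (simp add: word_Suc[abs_def])
qed (simp add: word_0[abs_def])

lemma ent_word_0: "ent M (word T s 0) = 0"
proof -
  have "(\<lambda>z. []) -` {[]} \<inter> space M = space M" by auto
  then show ?thesis using not_empty by (simp add: ent_def law_def eta_def prob_space image_constant_conv word_0[abs_def])
qed

text \<open>Strong subadditivity for the first letter, the middle word of length \<open>m\<close>
  and the last letter; invariance identifies the entropies of shifted words.\<close>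

lemma ent_increment:
  assumes s: "simple_function M s"
  shows "ent M (word T s (Suc (Suc m))) - ent M (word T s (Suc m)) \<le>
    ent M (word T s (Suc m)) - ent M (word T s m)"
proof -
  let ?B = "\<lambda>z. word T s m (T z)" and ?C = "\<lambda>z. s ((T ^^ m) (T z))"
  have B: "simple_function M ?B" and C: "simple_function M ?C"
    using simple_T[OF simple_word[OF s]] simple_T[OF simple_function_comp[OF funpow_T s]] by auto
  have 1: "ent M (word T s (Suc (Suc m))) = ent M (\<lambda>z. ((s z, ?B z), ?C z))"
    by (rule ent_recode[where f="\<lambda>((a, b), c). a # b @ [c]" and g="\<lambda>w. ((hd w, butlast (tl w)), last (tl w))"])
      (auto simp: word_Suc[of _ _ "Suc m"] word_Suc_append[of _ _ m])
  have 2: "ent M (word T s (Suc m)) = ent M (\<lambda>z. (s z, ?B z))"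
    by (rule ent_recode[where f="\<lambda>(a, b). a # b" and g="\<lambda>w. (hd w, tl w)"]) (auto simp: word_Suc)
  have "ent M (\<lambda>z. word T s (Suc m) (T z)) = ent M (\<lambda>z. (?B z, ?C z))"
    by (rule ent_recode[where f="\<lambda>(b, c). b @ [c]" and g="\<lambda>w. (butlast w, last w)"])
      (auto simp: word_Suc_append)
  then have 3: "ent M (word T s (Suc m)) = ent M (\<lambda>z. (?B z, ?C z))"
    by (simp add: ent_T[OF simple_word[OF s]])
  show ?thesis
    using ent_strong_subadditive[OF s B C] 1 2 3 ent_T[OF simple_word[OF s, of m]] by simp
qed

lemma entropy_rate_tendsto:
  assumes s: "simple_function M s"
  shows "(\<lambda>m. ent M (word T s m) / real m) \<longlonglongrightarrow> entropy_rate M T s"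
  using concave_rate_convergent[where H="\<lambda>m. ent M (word T s m)", OF ent_word_0 ent_nonneg ent_increment[OF s]]
  by (simp add: entropy_rate_def convergent_LIMSEQ_iff)

lemma entropy_rate_le_increment:
  assumes s: "simple_function M s"
  shows "entropy_rate M T s \<le> ent M (word T s (Suc k)) - ent M (word T s k)"
  unfolding entropy_rate_def
  by (rule concave_rate_le[where H="\<lambda>m. ent M (word T s m)", OF ent_word_0 ent_nonneg ent_increment[OF s]])

text \<open>If all cylinders are uniformly small, the information \<open>- ln\<close> of the
  cylinder around a point is almost surely at least \<open>m * ln l - ln C\<close>, and so is its
  mean. Both lower bounds on entropy come from this.\<close>

lemma entropy_rate_ge:
  assumes s: "simple_function M s" and C: "0 < C" and l: "0 < l"
    and le: "\<And>m w. law M (word T s m) w \<le> C * (1 / l) ^ m"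
  shows "ln l \<le> entropy_rate M T s"
proof -
  have *: "ent M (word T s m) \<ge> real m * ln l - ln C" for m
  proof -
    have w: "simple_function M (word T s m)" by (rule simple_word[OF s])
    have "(\<integral>z. ln (law M (word T s m) (word T s m z)) \<partial>M) \<le> (\<integral>z. ln C - real m * ln l \<partial>M)"
    proof (rule integral_mono_AE)
      show "integrable M (\<lambda>z. ln (law M (word T s m) (word T s m z)))"
        by (rule integrable_simple[OF w])
      have "ln p \<le> ln C - real m * ln l" if "0 < p" "p \<le> C * (1 / l) ^ m" for p
      proof -
        have "ln p \<le> ln (C * (1 / l) ^ m)" using that by (intro ln_mono) auto
        also have "\<dots> = ln C - real m * ln l" using C l by (simp add: ln_mult ln_realpow ln_div)
        finally show ?thesis .
      qed
      then show "AE z in M. ln (law M (word T s m) (word T s m z)) \<le> ln C - real m * ln l"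
        using AE_law_pos[OF w] le by (auto elim!: eventually_mono)
    qed simp
    then show ?thesis by (simp add: ent_eq_integral[OF w] prob_space)
  qed
  have "(\<lambda>m. ln l - ln C / real m) \<longlonglongrightarrow> ln l - 0"
    by (intro tendsto_intros lim_const_over_n)
  then have "ln l - 0 \<le> entropy_rate M T s"
  proof (rule LIMSEQ_le[OF _ entropy_rate_tendsto[OF s]])
    show "\<exists>N. \<forall>m\<ge>N. ln l - ln C / real m \<le> ent M (word T s m) / real m"
    proof (intro exI allI impI)
      fix m :: nat assume m: "1 \<le> m"
      have "(real m * ln l - ln C) / real m \<le> ent M (word T s m) / real m"
        using *[of m] by (intro divide_right_mono) auto
      then show "ln l - ln C / real m \<le> ent M (word T s m) / real m"
        using m by (simp add: diff_divide_distrib)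
    qed
  qed
  then show ?thesis by simp
qed

end

subsection \<open>Partitions and finite-valued functions\<close>

definition fibres :: "'a measure \<Rightarrow> ('a \<Rightarrow> 'b) \<Rightarrow> 'a set set" where
  "fibres M s = (\<lambda>v. s -` {v} \<inter> space M) ` (s ` space M)"

context mpt begin

lemma fibres_partition:
  assumes s: "simple_function M s"
  shows "finite_measurable_partition M (fibres M s)"
  unfolding finite_measurable_partition_def
proof (intro conjI)
  show "finite (fibres M s)" using simple_functionD(1)[OF s] by (simp add: fibres_def)
  show "fibres M s \<subseteq> sets M" using law_sets[OF s] by (auto simp: fibres_def)
  show "partition_on (space M) (fibres M s)"
    by (rule partition_onI) (auto simp: fibres_def disjnt_def)
qed

text \<open>A nonempty cell of the join fixes one letter for each time, hence one word. With this,
  entropy of partitions becomes entropy rate of finite-valued functions.\<close>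

lemma iterated_join_fibres: "iterated_join M T (fibres M s) m = fibres M (word T s m)"
proof (intro set_eqI iffI)
  have eq: "space M \<inter> (\<Inter>i<m. (T ^^ i) -` (s -` {v i} \<inter> space M)) =
      word T s m -` {map v [0..<m]} \<inter> space M" for v
    using measurable_space[OF funpow_T] by (auto simp: word_def)
  fix C
  {
    assume "C \<in> iterated_join M T (fibres M s) m"
    then obtain A where A: "\<forall>i<m. A i \<in> fibres M s" and ne: "C \<noteq> {}"
      and C: "C = space M \<inter> (\<Inter>i<m. (T ^^ i) -` A i)"
      by (auto simp: iterated_join_def)
    have "\<exists>v. A i = s -` {v} \<inter> space M" if "i < m" for i
    proof -
      from A that have "A i \<in> fibres M s" by blast
      then show ?thesis by (auto simp: fibres_def)
    qed
    then obtain v where "\<And>i. i < m \<Longrightarrow> A i = s -` {v i} \<inter> space M" by metis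
    then have "C = word T s m -` {map v [0..<m]} \<inter> space M"
      unfolding eq[symmetric] C by (intro arg_cong2[where f="(\<inter>)"] INF_cong refl) simp
    then have C': "C = word T s m -` {map v [0..<m]} \<inter> space M" .
    with ne obtain z where z: "z \<in> space M" "word T s m z = map v [0..<m]" by auto
    show "C \<in> fibres M (word T s m)"
      unfolding fibres_def C' z(2)[symmetric] using z(1) by (intro imageI)
  }
  assume "C \<in> fibres M (word T s m)"
  then obtain z where z: "z \<in> space M" and C: "C = word T s m -` {word T s m z} \<inter> space M"
    by (auto simp: fibres_def)
  let ?A = "\<lambda>i. s -` {s ((T ^^ i) z)} \<inter> space M"
  have C': "C = space M \<inter> (\<Inter>i<m. (T ^^ i) -` ?A i)"
    unfolding eq C by (simp add: word_def)
  have A: "\<forall>i<m. ?A i \<in> fibres M s"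
    unfolding fibres_def using measurable_space[OF funpow_T z] by blast
  have "z \<in> C" unfolding C using z by blast
  then have "C \<noteq> {}" by blast
  moreover have "C \<in> {space M \<inter> (\<Inter>i<m. (T ^^ i) -` A i) | A. \<forall>i<m. A i \<in> fibres M s}"
    by (intro CollectI exI[of _ ?A] conjI C' A)
  ultimately show "C \<in> iterated_join M T (fibres M s) m"
    by (simp add: iterated_join_def)
qed

lemma partition_entropy_fibres: "partition_entropy M (fibres M X) = ent M X"
proof -
  have "inj_on (\<lambda>v. X -` {v} \<inter> space M) (X ` space M)" by (rule inj_onI) blast
  then show ?thesis
    by (simp add: partition_entropy_def fibres_def sum.reindex ent_def law_def eta_def sum_negf)
qed

lemma entropy_wrt_fibres: "entropy_wrt_partition M T (fibres M s) = entropy_rate M T s"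
  by (simp add: entropy_wrt_partition_def entropy_rate_def iterated_join_fibres partition_entropy_fibres)

lemma ks_entropy_ge: "simple_function M s \<Longrightarrow> ereal (entropy_rate M T s) \<le> ks_entropy M T"
  unfolding ks_entropy_def by (rule SUP_upper2[of "fibres M s"]) (auto simp: fibres_partition entropy_wrt_fibres)

text \<open>A point is sent to the cell containing it. Hence bounds over all partitions need only
  treat functions whose values are sets of points.\<close>

lemma partition_eq_fibres:
  assumes P: "finite_measurable_partition M P"
  obtains s :: "'a \<Rightarrow> 'a set" where "simple_function M s" "P = fibres M s"
proof
  let ?s = "\<lambda>z. THE A. A \<in> P \<and> z \<in> A"
  have fin: "finite P" and sets: "P \<subseteq> sets M" and part: "partition_on (space M) P"
    using P by (auto simp: finite_measurable_partition_def)
  have s: "?s z = A" if "A \<in> P" "z \<in> A" for z A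
    using that part by (intro the_equality) (auto simp: partition_on_def disjoint_def)
  have fib: "?s -` {A} \<inter> space M = A" if "A \<in> P" for A
  proof (intro set_eqI iffI)
    fix z assume z: "z \<in> ?s -` {A} \<inter> space M"
    then obtain B where "B \<in> P" "z \<in> B" using partition_onD1[OF part] by blast
    then show "z \<in> A" using s z by auto
  next
    fix z assume "z \<in> A"
    then show "z \<in> ?s -` {A} \<inter> space M" using s that partition_onD1[OF part] by auto
  qed
  have img: "?s ` space M = P"
  proof (intro set_eqI iffI)
    fix A assume "A \<in> ?s ` space M"
    then obtain z where "z \<in> space M" "A = ?s z" by auto
    moreover from this(1) obtain B where "B \<in> P" "z \<in> B" using partition_onD1[OF part] by blast
    ultimately show "A \<in> P" using s by auto
  next
    fix A assume "A \<in> P"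
    moreover from this obtain z where z: "z \<in> A" using part by (metis ex_in_conv partition_on_def)
    moreover have "z \<in> space M" using \<open>A \<in> P\<close> z partition_onD1[OF part] by blast
    ultimately show "A \<in> ?s ` space M" using imageI[of z "space M" ?s] s[of A z] by simp
  qed
  show "simple_function M ?s"
    unfolding simple_function_def img using fin sets fib by auto
  show "P = fibres M ?s" unfolding fibres_def img using fib by auto
qed

lemma ks_entropy_le:
  assumes "\<And>s :: 'a \<Rightarrow> 'a set. simple_function M s \<Longrightarrow> entropy_rate M T s \<le> c"
  shows "ks_entropy M T \<le> ereal c"
  unfolding ks_entropy_def
proof (rule SUP_least)
  fix P assume "P \<in> {P. finite_measurable_partition M P}"
  then obtain s :: "'a \<Rightarrow> 'a set" where "simple_function M s" "P = fibres M s"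
    using partition_eq_fibres by blast
  then show "ereal (entropy_wrt_partition M T P) \<le> ereal c"
    using assms by (simp add: entropy_wrt_fibres)
qed

end

subsection \<open>Generators\<close>

definition itin_sets :: "'a measure \<Rightarrow> ('a \<Rightarrow> 'a) \<Rightarrow> ('a \<Rightarrow> 'b) \<Rightarrow> 'a set set" where
  "itin_sets M T s = sigma_sets (space M) {word T s m -` V \<inter> space M | m V. True}"

lemma itin_sets_word: "word T s m -` V \<inter> space M \<in> itin_sets M T s"
  unfolding itin_sets_def by (rule sigma_sets.Basic) blast

lemma sigma_algebra_itin: "sigma_algebra (space M) (itin_sets M T s)"
  unfolding itin_sets_def by (rule sigma_algebra_sigma_sets) auto

context mpt begin

lemma itin_sets_subset:
  assumes "simple_function M s" shows "itin_sets M T s \<subseteq> sets M"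
  unfolding itin_sets_def
  using law_sets[OF simple_word[OF assms]] by (intro sets.sigma_sets_subset) auto

lemma itin_sets_T:
  assumes "A \<in> itin_sets M T s" shows "T -` A \<inter> space M \<in> itin_sets M T s"
  using assms unfolding itin_sets_def
proof induction
  case (Basic A)
  then obtain m V where A: "A = word T s m -` V \<inter> space M" by auto
  have eq: "T -` A \<inter> space M = word T s (Suc m) -` {w. tl w \<in> V} \<inter> space M"
    unfolding A using T_space by (auto simp: word_Suc)
  show ?case unfolding eq by (rule itin_sets_word[unfolded itin_sets_def])
next
  case Empty
  then show ?case by (simp add: sigma_sets.Empty)
next
  case (Compl A)
  have eq: "T -` (space M - A) \<inter> space M = space M - (T -` A \<inter> space M)" using T_space by auto
  show ?case unfolding eq by (rule sigma_sets.Compl[OF Compl.IH])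
next
  case (Union A)
  have eq: "T -` (\<Union>i. A i) \<inter> space M = (\<Union>i. T -` A i \<inter> space M)" by auto
  show ?case unfolding eq by (rule sigma_sets.Union[OF Union.IH])
qed

lemma word_sets_lift:
  "m \<le> m' \<Longrightarrow> word T s m -` V \<inter> space M = word T s m' -` {w. take m w \<in> V} \<inter> space M"
  by (auto simp: take_word)

text \<open>Events determined by finitely many letters form an algebra, and the events that they
  approximate in measure are closed under complements and countable unions.\<close>

lemma itin_sets_approx:
  assumes s: "simple_function M s" and A: "A \<in> itin_sets M T s" and \<delta>: "0 < \<delta>"
  shows "\<exists>m V. prob (sym_diff A (word T s m -` V \<inter> space M)) < \<delta>"
  using A \<delta> unfolding itin_sets_def
proof (induction arbitrary: \<delta>)
  case (Basic A)
  then obtain m V where A: "A = word T s m -` V \<inter> space M" by blast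
  show ?case unfolding A using Basic.prems by (intro exI[of _ m] exI[of _ V]) simp
next
  case Empty
  have "sym_diff {} (word T s 0 -` {} \<inter> space M) = {}" by auto
  then show ?case using Empty by (metis measure_empty)
next
  case (Compl A)
  then obtain m V where *: "prob (sym_diff A (word T s m -` V \<inter> space M)) < \<delta>" by blast
  have "A \<subseteq> space M" using Compl.hyps by (rule sigma_sets_into_sp[rotated]) auto
  then have "sym_diff (space M - A) (word T s m -` (- V) \<inter> space M) = sym_diff A (word T s m -` V \<inter> space M)"
    by auto
  then show ?case using * by metis
next
  case (Union A)
  have Aset: "A i \<in> sets M" for i
    using Union.hyps itin_sets_subset[OF s] by (auto simp: itin_sets_def)
  have "incseq (\<lambda>N. \<Union>i<N. A i)" by (rule incseq_SucI) (auto simp: less_Suc_eq)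
  then have "(\<lambda>N. prob (\<Union>i<N. A i)) \<longlonglongrightarrow> prob (\<Union>N. \<Union>i<N. A i)"
    using Aset by (intro finite_Lim_measure_incseq) auto
  moreover have "(\<Union>N. \<Union>i<N. A i) = (\<Union>i. A i)" by auto
  ultimately have "(\<lambda>N. prob (\<Union>i<N. A i)) \<longlonglongrightarrow> prob (\<Union>i. A i)" by simp
  from LIMSEQ_D[OF this, of "\<delta> / 2"] Union.prems
  obtain N where N: "\<bar>prob (\<Union>i<N. A i) - prob (\<Union>i. A i)\<bar> < \<delta> / 2" by auto
  have tail: "prob ((\<Union>i. A i) - (\<Union>i<N. A i)) < \<delta> / 2"
  proof -
    have "prob ((\<Union>i. A i) - (\<Union>i<N. A i)) = prob (\<Union>i. A i) - prob (\<Union>i<N. A i)"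
      using Aset by (intro finite_measure_Diff) auto
    then show ?thesis using N by linarith
  qed
  \<comment> \<open>Half of \<open>\<delta>\<close> is spent on the tail of the union, half on the
    \<open>N\<close> approximations; \<open>Suc N\<close> keeps the quotient meaningful for
    \<open>N = 0\<close>.\<close>
  have "\<forall>i. \<exists>m V. prob (sym_diff (A i) (word T s m -` V \<inter> space M)) < \<delta> / (2 * real (Suc N))"
    using Union.prems by (intro allI Union.IH) auto
  then obtain m V where mV: "\<And>i. prob (sym_diff (A i) (word T s (m i) -` V i \<inter> space M)) < \<delta> / (2 * real (Suc N))"
    by metis
  let ?B = "\<lambda>i. word T s (m i) -` V i \<inter> space M"
  have Bset: "?B i \<in> sets M" for i by (rule law_sets[OF simple_word[OF s]])
  \<comment> \<open>A common length for the finitely many words; a sum avoids a maximum over a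
    possibly empty set.\<close>
  define m' where "m' = (\<Sum>i<N. m i)"
  have eqB: "(\<Union>i<N. ?B i) = word T s m' -` (\<Union>i<N. {w. take (m i) w \<in> V i}) \<inter> space M"
  proof -
    have "?B i = word T s m' -` {w. take (m i) w \<in> V i} \<inter> space M" if "i < N" for i
      using that by (intro word_sets_lift) (auto simp: m'_def intro: member_le_sum)
    then show ?thesis by auto
  qed
  have "prob (sym_diff (\<Union>i. A i) (\<Union>i<N. ?B i)) < \<delta>"
  proof -
    have "sym_diff (\<Union>i. A i) (\<Union>i<N. ?B i) \<subseteq>
        ((\<Union>i. A i) - (\<Union>i<N. A i)) \<union> (\<Union>i<N. sym_diff (A i) (?B i))" by auto
    then have "prob (sym_diff (\<Union>i. A i) (\<Union>i<N. ?B i)) \<le>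
        prob (((\<Union>i. A i) - (\<Union>i<N. A i)) \<union> (\<Union>i<N. sym_diff (A i) (?B i)))"
      using Aset Bset by (intro finite_measure_mono) auto
    also have "\<dots> \<le> prob ((\<Union>i. A i) - (\<Union>i<N. A i)) + prob (\<Union>i<N. sym_diff (A i) (?B i))"
      using Aset Bset by (intro measure_Un_le) auto
    also have "prob (\<Union>i<N. sym_diff (A i) (?B i)) \<le> (\<Sum>i<N. prob (sym_diff (A i) (?B i)))"
      using Aset Bset by (intro finite_measure_subadditive_finite) auto
    also have "\<dots> \<le> (\<Sum>i<N. \<delta> / (2 * real (Suc N)))"
      using mV by (intro sum_mono less_imp_le) auto
    also have "\<dots> \<le> \<delta> / 2" using Union.prems by (simp add: field_simps)
    finally show ?thesis using tail by linarith
  qed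
  then show ?case unfolding eqB by (intro exI)
qed

text \<open>For each of the finitely many values of \<open>p\<close>, a finite word tells with small
  error whether it is taken. \<open>f\<close> picks the value that the word suggests, which is
  unambiguous outside the union of the errors.\<close>

lemma generator_approx:
  assumes p: "simple_function M p" and s: "simple_function M s"
    and gen: "\<And>v. v \<in> p ` space M \<Longrightarrow> \<exists>A\<in>itin_sets M T s. prob (sym_diff (p -` {v} \<inter> space M) A) = 0"
    and \<delta>: "0 < \<delta>"
  shows "\<exists>m f. prob {z\<in>space M. p z \<noteq> f (word T s m z)} < \<delta>"
proof -
  let ?P = "\<lambda>v. p -` {v} \<inter> space M" and ?R = "p ` space M"
  have fin: "finite ?R" by (rule simple_functionD(1)[OF p])
  define c where "c = real (Suc (card ?R))"
  have "\<exists>m V. prob (sym_diff (?P v) (word T s m -` V \<inter> space M)) < \<delta> / c" if v: "v \<in> ?R" for v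
  proof -
    obtain A where A: "A \<in> itin_sets M T s" "prob (sym_diff (?P v) A) = 0" using gen[OF v] by blast
    obtain m V where V: "prob (sym_diff A (word T s m -` V \<inter> space M)) < \<delta> / c"
      using itin_sets_approx[OF s A(1), of "\<delta> / c"] \<delta> by (auto simp: c_def)
    let ?B = "word T s m -` V \<inter> space M"
    have As: "A \<in> sets M" using A itin_sets_subset[OF s] by auto
    have "prob (sym_diff (?P v) ?B) \<le> prob (sym_diff (?P v) A \<union> sym_diff A ?B)"
      using As law_sets[OF p] law_sets[OF simple_word[OF s]] by (intro finite_measure_mono) auto
    also have "\<dots> \<le> prob (sym_diff (?P v) A) + prob (sym_diff A ?B)"
      using As law_sets[OF p] law_sets[OF simple_word[OF s]] by (intro measure_Un_le) auto
    finally show ?thesis using A V by (intro exI[of _ m] exI[of _ V]) linarith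
  qed
  then have "\<forall>v\<in>?R. \<exists>m V. prob (sym_diff (?P v) (word T s m -` V \<inter> space M)) < \<delta> / c" by blast
  from this[unfolded bchoice_iff] obtain m where
    "\<forall>v\<in>?R. \<exists>V. prob (sym_diff (?P v) (word T s (m v) -` V \<inter> space M)) < \<delta> / c" by blast
  from this[unfolded bchoice_iff] obtain V where
    "\<forall>v\<in>?R. prob (sym_diff (?P v) (word T s (m v) -` V v \<inter> space M)) < \<delta> / c" by blast
  then have mV: "\<And>v. v \<in> ?R \<Longrightarrow> prob (sym_diff (?P v) (word T s (m v) -` V v \<inter> space M)) < \<delta> / c" by blast
  let ?B = "\<lambda>v. word T s (m v) -` V v \<inter> space M"
  define n where "n = (\<Sum>v\<in>?R. m v)"
  have take_n: "take (m v) (word T s n z) = word T s (m v) z" if "v \<in> ?R" for v z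
    using that fin by (intro take_word) (auto simp: n_def intro: member_le_sum)
  define f where "f w = (SOME v. v \<in> ?R \<and> take (m v) w \<in> V v)" for w
  have sets: "sym_diff (?P v) (?B v) \<in> sets M" for v
    using law_sets[OF p] law_sets[OF simple_word[OF s]] by auto
  have sub: "{z\<in>space M. p z \<noteq> f (word T s n z)} \<subseteq> (\<Union>v\<in>?R. sym_diff (?P v) (?B v))"
  proof
    fix z assume "z \<in> {z\<in>space M. p z \<noteq> f (word T s n z)}"
    then have z: "z \<in> space M" and ne: "p z \<noteq> f (word T s n z)" by auto
    show "z \<in> (\<Union>v\<in>?R. sym_diff (?P v) (?B v))"
    proof (rule ccontr)
      assume *: "z \<notin> (\<Union>v\<in>?R. sym_diff (?P v) (?B v))"
      have iff: "take (m v) (word T s n z) \<in> V v \<longleftrightarrow> p z = v" if v: "v \<in> ?R" for v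
      proof -
        have "z \<notin> sym_diff (?P v) (?B v)" using * v by blast
        then have "word T s (m v) z \<in> V v \<longleftrightarrow> p z = v" using z by blast
        then show ?thesis by (simp only: take_n[OF v])
      qed
      have "f (word T s n z) = p z"
        unfolding f_def
      proof (rule some_equality)
        show "p z \<in> ?R \<and> take (m (p z)) (word T s n z) \<in> V (p z)" using iff[of "p z"] z by simp
        show "v = p z" if "v \<in> ?R \<and> take (m v) (word T s n z) \<in> V v" for v
          using iff[of v] that by simp
      qed
      then show False using ne by simp
    qed
  qed
  have "prob {z\<in>space M. p z \<noteq> f (word T s n z)} \<le> prob (\<Union>v\<in>?R. sym_diff (?P v) (?B v))"
    using fin sets sub by (intro finite_measure_mono sets.finite_UN) auto
  also have "\<dots> \<le> (\<Sum>v\<in>?R. prob (sym_diff (?P v) (?B v)))"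
    using fin sets by (intro finite_measure_subadditive_finite) auto
  also have "\<dots> \<le> (\<Sum>v\<in>?R. \<delta> / c)" using mV by (intro sum_mono less_imp_le)
  also have "\<dots> < \<delta>" using \<delta> by (simp add: c_def field_simps)
  finally show ?thesis by blast
qed

text \<open>The kernel guesses \<open>f w\<close> with probability \<open>1 - \<epsilon>\<close> and otherwise chooses uniformly.\<close>

lemma fano:
  assumes p: "simple_function M p" and W: "simple_function M W" and \<epsilon>: "0 < \<epsilon>" "\<epsilon> < 1"
    and \<delta>: "prob {z\<in>space M. p z \<noteq> f (W z)} \<le> \<delta>"
  shows "ent M (\<lambda>z. (W z, p z)) \<le> ent M W - ln (1 - \<epsilon>) + \<delta> * ln (real (card (p ` space M)) / \<epsilon>)"
proof -
  let ?R = "p ` space M"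
  define k where "k = real (card ?R)"
  have fin: "finite ?R" by (rule simple_functionD(1)[OF p])
  have k: "1 \<le> k" using fin not_empty by (simp add: k_def Suc_le_eq card_gt_0_iff)
  define r where "r w y = (if y = f w then 1 - \<epsilon> else 0) + \<epsilon> / k" for w y
  have Wp: "simple_function M (\<lambda>z. (W z, p z))" using W p by (rule simple_function_Pair)
  let ?bad = "{z\<in>space M. p z \<noteq> f (W z)}"
  have badset: "?bad \<in> sets M"
  proof -
    have eq: "?bad = (\<lambda>z. (W z, p z)) -` {v. snd v \<noteq> f (fst v)} \<inter> space M" by auto
    show ?thesis unfolding eq by (rule law_sets[OF Wp])
  qed
  have "ent M (\<lambda>z. (W z, p z)) \<le> ent M W - (\<integral>z. ln (r (W z) (p z)) \<partial>M)"
  proof (rule cond_gibbs[OF W p fin order_refl])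
    fix w
    have "(\<Sum>y\<in>?R. r w y) \<le> (1 - \<epsilon>) + \<epsilon>"
      unfolding r_def sum.distrib using fin \<epsilon> k by (intro add_mono) (auto simp: k_def)
    then show "(\<Sum>y\<in>?R. r w y) \<le> 1" by simp
  qed (use \<epsilon> k in \<open>auto simp: r_def add_pos_pos add_nonneg_nonneg\<close>)
  \<comment> \<open>A correct guess costs at most \<open>- ln (1 - \<epsilon>)\<close>, a wrong one
    at most \<open>ln (k / \<epsilon>)\<close> more.\<close>
  moreover have "(\<integral>z. ln (1 - \<epsilon>) - indicator ?bad z * ln (k / \<epsilon>) \<partial>M) \<le> (\<integral>z. ln (r (W z) (p z)) \<partial>M)"
  proof (rule integral_mono)
    show "integrable M (\<lambda>z. ln (1 - \<epsilon>) - indicator ?bad z * ln (k / \<epsilon>))"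
      using badset by (intro Bochner_Integration.integrable_diff integrable_mult_left) (auto simp: emeasure_eq_measure)
    show "integrable M (\<lambda>z. ln (r (W z) (p z)))"
      using integrable_simple[OF Wp, of "\<lambda>v. ln (r (fst v) (snd v))"] by simp
    fix z assume "z \<in> space M"
    show "ln (1 - \<epsilon>) - indicator ?bad z * ln (k / \<epsilon>) \<le> ln (r (W z) (p z))"
    proof (cases "p z = f (W z)")
      case True
      then show ?thesis using \<epsilon> k by (auto simp: r_def intro!: ln_mono)
    next
      case False
      have "ln (1 - \<epsilon>) \<le> 0" using \<epsilon> by simp
      then show ?thesis using False \<epsilon> k \<open>z \<in> space M\<close> by (simp add: r_def ln_div)
    qed
  qed
  moreover have "(\<integral>z. ln (1 - \<epsilon>) - indicator ?bad z * ln (k / \<epsilon>) \<partial>M) = ln (1 - \<epsilon>) - prob ?bad * ln (k / \<epsilon>)"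
    using badset by (subst Bochner_Integration.integral_diff) (auto simp: prob_space emeasure_eq_measure)
  moreover have "prob ?bad * ln (k / \<epsilon>) \<le> \<delta> * ln (k / \<epsilon>)"
    using \<delta> \<epsilon> k by (intro mult_right_mono) auto
  ultimately show ?thesis by (simp add: k_def)
qed

text \<open>The Kolmogorov-Sinai theorem. Once the words of \<open>s\<close> predict
  \<open>p\<close> well, Fano's inequality lets one letter of \<open>p\<close> be adjoined to a word
  of \<open>s\<close> at cost at most \<open>\<eta>\<close>; adjoining \<open>m\<close> letters one
  at a time costs \<open>m * \<eta>\<close> plus a constant.\<close>

lemma entropy_rate_le_generator:
  assumes p: "simple_function M p" and s: "simple_function M s"
    and gen: "\<And>v. v \<in> p ` space M \<Longrightarrow> \<exists>A\<in>itin_sets M T s. prob (sym_diff (p -` {v} \<inter> space M) A) = 0"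
  shows "entropy_rate M T p \<le> entropy_rate M T s"
proof (rule field_le_epsilon)
  fix \<eta> :: real assume \<eta>: "0 < \<eta>"
  define k where "k = real (card (p ` space M))"
  have k: "1 \<le> k" using simple_functionD(1)[OF p] not_empty by (simp add: k_def Suc_le_eq card_gt_0_iff)
  \<comment> \<open>With this choice and that of \<open>\<delta>\<close> below, each of the two
    error terms in Fano's inequality is at most \<open>\<eta> / 2\<close>.\<close>
  define \<epsilon> where "\<epsilon> = 1 - exp (- \<eta> / 2)"
  have \<epsilon>: "0 < \<epsilon>" "\<epsilon> < 1" using \<eta> by (auto simp: \<epsilon>_def)
  have lnk: "0 < ln (k / \<epsilon>)" using k \<epsilon> by (intro ln_gt_zero) (simp add: field_simps)
  define \<delta> where "\<delta> = \<eta> / (2 * ln (k / \<epsilon>))"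
  have "0 < \<delta>" using \<eta> lnk by (simp add: \<delta>_def)
  then obtain N f where Nf: "prob {z\<in>space M. p z \<noteq> f (word T s N z)} < \<delta>"
    using generator_approx[OF p s gen] by blast
  let ?W = "word T s" and ?P = "word T p"
  have W: "simple_function M (?W m)" and P: "simple_function M (?P m)" for m
    by (rule simple_word[OF s], rule simple_word[OF p])
  define e where "e m = ent M (\<lambda>z. (p z, ?W m z)) - ent M (?W m)" for m
  define G where "G m = ent M (\<lambda>z. (?P m z, ?W m z))" for m
  have e_le: "e m \<le> \<eta>" if m: "N \<le> m" for m
  proof -
    have "ent M (\<lambda>z. (?W m z, p z)) \<le> ent M (?W m) - ln (1 - \<epsilon>) + \<delta> * ln (real (card (p ` space M)) / \<epsilon>)"
      by (rule fano[OF p W \<epsilon>, where f="\<lambda>w. f (take N w)"]) (use Nf m in \<open>simp add: take_word\<close>)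
    moreover have "ln (1 - \<epsilon>) = - \<eta> / 2" by (simp add: \<epsilon>_def)
    moreover have "\<delta> * ln (k / \<epsilon>) = \<eta> / 2" using lnk by (simp add: \<delta>_def)
    moreover have "ent M (\<lambda>z. (?W m z, p z)) = ent M (\<lambda>z. (p z, ?W m z))"
      by (rule ent_recode[where f=prod.swap and g=prod.swap]) auto
    ultimately show ?thesis by (simp add: e_def k_def)
  qed
  \<comment> \<open>Strong subadditivity twice: the first letter of \<open>p\<close> is split off
    given the whole word of \<open>s\<close>, then the first letter of \<open>s\<close> is split off
    given the rest. What remains is the shifted pair of words of length \<open>m\<close>.\<close>
  have G_Suc: "G (Suc m) \<le> G m + ent M (?W (Suc m)) - ent M (?W m) + e (Suc m)" for m
  proof -
    let ?B = "?W (Suc m)" and ?C = "\<lambda>z. ?P m (T z)" and ?B' = "\<lambda>z. ?W m (T z)"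
    have C: "simple_function M ?C" and B': "simple_function M ?B'" by (rule simple_T[OF P], rule simple_T[OF W])
    have "G (Suc m) = ent M (\<lambda>z. ((p z, ?B z), ?C z))"
      unfolding G_def by (rule ent_recode[where f="\<lambda>((a, b), c). (a # c, b)" and g="\<lambda>(u, w). ((hd u, w), tl u)"])
        (auto simp: word_Suc)
    also have "\<dots> \<le> ent M (\<lambda>z. (p z, ?B z)) + ent M (\<lambda>z. (?B z, ?C z)) - ent M ?B"
      by (rule ent_strong_subadditive[OF p W C])
    also have "ent M (\<lambda>z. (?B z, ?C z)) = ent M (\<lambda>z. ((s z, ?B' z), ?C z))"
      by (rule ent_recode[where f="\<lambda>((a, b), c). (a # b, c)" and g="\<lambda>(w, c). ((hd w, tl w), c)"])
        (auto simp: word_Suc)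
    also have "\<dots> \<le> ent M (\<lambda>z. (s z, ?B' z)) + ent M (\<lambda>z. (?B' z, ?C z)) - ent M ?B'"
      by (rule ent_strong_subadditive[OF s B' C])
    also have "ent M (\<lambda>z. (s z, ?B' z)) = ent M ?B"
      by (rule ent_recode[where g="\<lambda>(a, b). a # b" and f="\<lambda>w. (hd w, tl w)"]) (auto simp: word_Suc)
    also have "ent M ?B' = ent M (?W m)" by (rule ent_T[OF W])
    also have "ent M (\<lambda>z. (?B' z, ?C z)) = ent M (\<lambda>z. (?P m (T z), ?W m (T z)))"
      by (rule ent_recode[where f=prod.swap and g=prod.swap]) auto
    also have "\<dots> = G m" unfolding G_def using ent_T[OF simple_function_Pair[OF P W], of m m] by simp
    finally show ?thesis by (simp add: e_def)
  qed
  \<comment> \<open>The costs at lengths up to \<open>N\<close> are collected in a constant, which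
    disappears after division by \<open>m\<close>.\<close>
  define c where "c = (\<Sum>i<N. \<bar>e (Suc i)\<bar>)"
  have G_le: "G m \<le> ent M (?W m) + c + real m * \<eta>" for m
  proof -
    have "G m \<le> ent M (?W m) + (\<Sum>i<m. e (Suc i))"
    proof (induction m)
      case 0
      have "G 0 = ent M (?W 0)"
        unfolding G_def by (rule ent_recode[where f="\<lambda>w. ([], w)" and g=snd]) auto
      then show ?case by (simp add: word_0[abs_def])
    next
      case (Suc m)
      then show ?case using G_Suc[of m] by simp
    qed
    also have "(\<Sum>i<m. e (Suc i)) \<le> (\<Sum>i<m. (if i < N then \<bar>e (Suc i)\<bar> else 0) + \<eta>)"
      using e_le \<eta> by (intro sum_mono) (auto intro: order_trans[of _ \<eta>] simp: abs_if)
    also have "\<dots> = (\<Sum>i\<in>{..<m} \<inter> {..<N}. \<bar>e (Suc i)\<bar>) + real m * \<eta>"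
      by (simp add: sum.distrib sum.inter_restrict)
    also have "(\<Sum>i\<in>{..<m} \<inter> {..<N}. \<bar>e (Suc i)\<bar>) \<le> c"
      unfolding c_def by (intro sum_mono2) auto
    finally show ?thesis by simp
  qed
  have le: "ent M (?P m) / real m \<le> ent M (?W m) / real m + c / real m + \<eta>" if "1 \<le> m" for m
  proof -
    have "ent M (?P m) \<le> ent M (?W m) + c + real m * \<eta>"
      using ent_le_pair[OF P W, of m m] G_le[of m] by (simp add: G_def)
    then have "ent M (?P m) / real m \<le> (ent M (?W m) + c + real m * \<eta>) / real m"
      by (rule divide_right_mono) simp
    then show ?thesis using that by (simp add: add_divide_distrib)
  qed
  have "(\<lambda>m. ent M (?W m) / real m + c / real m + \<eta>) \<longlonglongrightarrow> entropy_rate M T s + 0 + \<eta>"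
    by (intro tendsto_intros entropy_rate_tendsto[OF s] lim_const_over_n)
  from LIMSEQ_le[OF entropy_rate_tendsto[OF p] this] le
  show "entropy_rate M T p \<le> entropy_rate M T s + \<eta>" by auto
qed

end

subsection \<open>Markov bounds and uniqueness\<close>

context mpt begin

lemma mpt_funpow: "mpt M (T ^^ m)"
proof
  show "T ^^ m \<in> measurable M M" by (rule funpow_T)
  show "distr M M (T ^^ m) = M"
  proof (induction m)
    case 0
    show ?case by (simp add: distr_id2 id_def)
  next
    case (Suc m)
    have "distr M M (T ^^ Suc m) = distr (distr M M (T ^^ m)) M T"
      using T funpow_T by (subst distr_distr) auto
    then show ?case by (simp only: Suc inv)
  qed
qed

lemma law_word_last:
  assumes s: "simple_function M s"
  shows "law M (\<lambda>z. (word T s (Suc m) z, s ((T ^^ Suc m) z))) (w, j) = law M (word T s (Suc (Suc m))) (w @ [j])"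
  unfolding law_def
  by (intro arg_cong[where f="measure M"]) (auto simp: word_Suc_append[of _ _ "Suc m"] simp del: funpow.simps)

text \<open>Up to the coboundary of \<open>f\<close>, the kernel charges \<open>\<kappa> i\<close> for leaving the state \<open>i\<close>.\<close>

lemma
  fixes f \<kappa> :: "'b \<Rightarrow> real" and N :: "'b \<Rightarrow> 'b set"
  assumes s: "simple_function M s"
    and fin: "\<And>i. finite (N i)"
    and N: "\<And>i j. 0 < law M (\<lambda>z. (s z, s (T z))) (i, j) \<Longrightarrow> j \<in> N i"
    and sub: "\<And>i. 0 < law M s i \<Longrightarrow> (\<Sum>j\<in>N i. exp (f j - f i - \<kappa> i)) \<le> 1"
  shows markov_entropy_le: "entropy_rate M T s \<le> (\<integral>z. \<kappa> (s z) \<partial>M)"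
    and markov_entropy_eq: "(\<integral>z. \<kappa> (s z) \<partial>M) \<le> entropy_rate M T s \<Longrightarrow> w \<noteq> [] \<Longrightarrow>
      law M (word T s (Suc (length w))) (w @ [j]) =
      law M (word T s (length w)) w * (if j \<in> N (last w) then exp (f j - f (last w) - \<kappa> (last w)) else 0)"
proof -
  define r where "r i j = (if j \<in> N i then exp (f j - f i - \<kappa> i) else 0)" for i j
  have r0: "0 \<le> r i j" for i j by (simp add: r_def)
  have rsum: "(\<Sum>j\<in>R. r i j) \<le> 1" if "finite R" "0 < law M s i" for R i
  proof -
    have "(\<Sum>j\<in>R. r i j) = (\<Sum>j\<in>R \<inter> N i. exp (f j - f i - \<kappa> i))"
      unfolding r_def using that by (simp add: sum.inter_restrict)
    also have "\<dots> \<le> (\<Sum>j\<in>N i. exp (f j - f i - \<kappa> i))" using fin by (intro sum_mono2) auto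
    finally show ?thesis using sub[OF that(2)] by simp
  qed
  have W: "simple_function M (word T s m)" for m by (rule simple_word[OF s])
  have sT: "simple_function M (\<lambda>z. s ((T ^^ m) z))" for m
    using simple_function_comp[OF funpow_T s] .
  have ssT: "simple_function M (\<lambda>z. (s z, s (T z)))"
    using s simple_T[OF s] by (rule simple_function_Pair)
  \<comment> \<open>Invariance carries the hypotheses on single letters and on pairs of letters over
    to the end of a word of any length.\<close>
  have last: "law M (word T s (Suc m)) w \<le> law M s (last w)" for m w
  proof -
    interpret Tm: mpt M "T ^^ m" by (rule mpt_funpow)
    have "law M (word T s (Suc m)) w \<le> law M (\<lambda>z. s ((T ^^ m) z)) (last w)"
      unfolding law_def by (intro finite_measure_mono law_sets[OF sT]) (auto simp: word_Suc_append)
    also have "\<dots> = law M s (last w)" by (rule Tm.law_T[OF s])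
    finally show ?thesis .
  qed
  have last2: "law M (\<lambda>z. (word T s (Suc m) z, s ((T ^^ Suc m) z))) (w, j) \<le> law M (\<lambda>z. (s z, s (T z))) (last w, j)" for m w j
  proof -
    interpret Tm: mpt M "T ^^ m" by (rule mpt_funpow)
    have "law M (\<lambda>z. (word T s (Suc m) z, s ((T ^^ Suc m) z))) (w, j) \<le>
        law M (\<lambda>z. (\<lambda>z. (s z, s (T z))) ((T ^^ m) z)) (last w, j)"
      unfolding law_def by (intro finite_measure_mono law_sets[OF Tm.simple_T[OF ssT]]) (auto simp: word_Suc_append)
    also have "\<dots> = law M (\<lambda>z. (s z, s (T z))) (last w, j)" by (rule Tm.law_T[OF ssT])
    finally show ?thesis .
  qed
  \<comment> \<open>The coboundary \<open>f (s (T z)) - f (s z)\<close> has mean zero by invariance,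
    so the mean cost depends neither on \<open>f\<close> nor on the length of the word.\<close>
  have cost: "- (\<integral>z. ln (r (last (word T s (Suc m) z)) (s ((T ^^ Suc m) z))) \<partial>M) = (\<integral>z. \<kappa> (s z) \<partial>M)" for m
  proof -
    interpret Tm: mpt M "T ^^ m" by (rule mpt_funpow)
    have meas: "(\<lambda>z. ln (r (s z) (s (T z)))) \<in> borel_measurable M"
      using borel_measurable_integrable[OF integrable_simple[OF ssT, of "\<lambda>v. ln (r (fst v) (snd v))"]] by simp
    have i: "integrable M (\<lambda>z. f (s z))" "integrable M (\<lambda>z. f (s (T z)))" "integrable M (\<lambda>z. \<kappa> (s z))"
      using integrable_simple[OF s] integrable_simple[OF simple_T[OF s]] by auto
    have "(\<integral>z. ln (r (last (word T s (Suc m) z)) (s ((T ^^ Suc m) z))) \<partial>M) =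
        (\<integral>z. (\<lambda>z. ln (r (s z) (s (T z)))) ((T ^^ m) z) \<partial>M)"
      by (simp add: word_Suc_append)
    also have "\<dots> = (\<integral>z. ln (r (s z) (s (T z))) \<partial>distr M M (T ^^ m))"
      using integral_distr[OF funpow_T meas] by simp
    also have "\<dots> = (\<integral>z. ln (r (s z) (s (T z))) \<partial>M)" by (simp only: Tm.inv)
    also have "\<dots> = (\<integral>z. f (s (T z)) - f (s z) - \<kappa> (s z) \<partial>M)"
    proof (rule integral_cong_AE[OF meas])
      show "(\<lambda>z. f (s (T z)) - f (s z) - \<kappa> (s z)) \<in> borel_measurable M"
        using i by (auto intro!: borel_measurable_integrable)
      show "AE z in M. ln (r (s z) (s (T z))) = f (s (T z)) - f (s z) - \<kappa> (s z)"
        using AE_law_pos[OF ssT] by eventually_elim (use N in \<open>simp add: r_def\<close>)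
    qed
    also have "\<dots> = (\<integral>z. f (s (T z)) \<partial>M) - (\<integral>z. f (s z) \<partial>M) - (\<integral>z. \<kappa> (s z) \<partial>M)"
      using i by simp
    also have "(\<integral>z. f (s (T z)) \<partial>M) = (\<integral>z. f (s z) \<partial>distr M M T)"
      using integral_distr[OF T, of "\<lambda>z. f (s z)"] i by auto
    finally show ?thesis by (simp add: inv)
  qed
  have r1': "(\<Sum>y\<in>R. r (last w) y) \<le> 1" if "finite R" "0 < law M (word T s (Suc m)) w" for R w m
    using rsum[OF that(1), of "last w"] last[of m w] that(2) by simp
  have rpos': "0 < r (last w) y" if "0 < law M (\<lambda>z. (word T s (Suc m) z, s ((T ^^ Suc m) z))) (w, y)" for w y m
    using last2[of m w y] that N[of "last w" y] by (simp add: r_def)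
  have pair: "ent M (\<lambda>z. (word T s (Suc m) z, s ((T ^^ Suc m) z))) = ent M (word T s (Suc (Suc m)))" for m
    by (rule ent_recode[where g="\<lambda>(a, b). a @ [b]" and f="\<lambda>w. (butlast w, last w)"])
      (auto simp: word_Suc_append[of _ _ "Suc m"] simp del: funpow.simps)
  \<comment> \<open>Inserting \<open>j\<close> makes the equality case available for letters that
    never occur as well.\<close>
  have fR: "finite (insert j (s ` space M))" "(\<lambda>z. s ((T ^^ Suc m) z)) ` space M \<subseteq> insert j (s ` space M)" for j m
    using simple_functionD(1)[OF s] measurable_space[OF funpow_T] by (auto simp del: funpow.simps)
  have ub: "ent M (word T s (Suc (Suc m))) \<le> ent M (word T s (Suc m)) + (\<integral>z. \<kappa> (s z) \<partial>M)" for m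
  proof -
    have "ent M (\<lambda>z. (word T s (Suc m) z, s ((T ^^ Suc m) z))) \<le> ent M (word T s (Suc m)) -
        (\<integral>z. ln (r (last (word T s (Suc m) z)) (s ((T ^^ Suc m) z))) \<partial>M)"
      using fR(1) by (intro cond_gibbs[where r="\<lambda>w. r (last w)", OF W sT fR r0 r1' rpos'])
    then show ?thesis using cost[of m] unfolding pair by simp
  qed
  have "ent M (word T s (Suc (Suc 0))) \<le> ent M (word T s (Suc 0)) + (\<integral>z. \<kappa> (s z) \<partial>M)" by (rule ub)
  then show "entropy_rate M T s \<le> (\<integral>z. \<kappa> (s z) \<partial>M)"
    using entropy_rate_le_increment[OF s, of "Suc 0"] by linarith
  \<comment> \<open>The rate is below every increment of the word entropies, and each of these is
    below the mean cost. If the rate attains the cost, Gibbs' inequality is an equality at every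
    length.\<close>
  assume le: "(\<integral>z. \<kappa> (s z) \<partial>M) \<le> entropy_rate M T s" and "w \<noteq> []"
  then obtain m where m: "length w = Suc m" by (cases w) auto
  have "ent M (word T s (Suc m)) + (\<integral>z. \<kappa> (s z) \<partial>M) \<le> ent M (word T s (Suc (Suc m)))"
    using entropy_rate_le_increment[OF s, of "Suc m"] le by simp
  then have key: "ent M (word T s (Suc m)) -
      (\<integral>z. ln (r (last (word T s (Suc m) z)) (s ((T ^^ Suc m) z))) \<partial>M)
      \<le> ent M (\<lambda>z. (word T s (Suc m) z, s ((T ^^ Suc m) z)))"
    unfolding pair using cost[of m] by linarith
  have "law M (\<lambda>z. (word T s (Suc m) z, s ((T ^^ Suc m) z))) (w, j) = law M (word T s (Suc m)) w * r (last w) j"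
    by (rule cond_gibbs_eq[where r="\<lambda>w. r (last w)" and RY="insert j (s ` space M)",
        OF W sT fR r0 r1'[OF fR(1)] rpos' key]) auto
  then show "law M (word T s (Suc (length w))) (w @ [j]) =
      law M (word T s (length w)) w * (if j \<in> N (last w) then exp (f j - f (last w) - \<kappa> (last w)) else 0)"
    unfolding law_word_last[OF s] m r_def .
qed

text \<open>The preimages of \<open>C\<close> under the iterates increase to the whole space, and
  all have the measure of \<open>C\<close>.\<close>

lemma prob_absorbing:
  assumes C: "C \<in> sets M" and closed: "\<And>z. z \<in> C \<Longrightarrow> T z \<in> C"
    and reach: "\<And>z. z \<in> space M \<Longrightarrow> \<exists>m. (T ^^ m) z \<in> C"
  shows "prob C = 1"
proof -
  let ?A = "\<lambda>m. (T ^^ m) -` C \<inter> space M"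
  have pA: "prob (?A m) = prob C" for m
    by (rule mpt.prob_T[OF mpt_funpow C])
  have "incseq ?A" by (rule incseq_SucI) (use closed in auto)
  then have "(\<lambda>m. prob (?A m)) \<longlonglongrightarrow> prob (\<Union>m. ?A m)"
    using measurable_sets[OF funpow_T C] by (intro finite_Lim_measure_incseq) auto
  moreover have "(\<Union>m. ?A m) = space M" using reach by auto
  ultimately have "(\<lambda>m. prob C) \<longlonglongrightarrow> 1" by (simp add: pA prob_space)
  then show ?thesis by (rule LIMSEQ_unique[OF tendsto_const])
qed

text \<open>\<open>D\<close> lies in its preimage, which has the same measure, so the difference is
  null.\<close>

lemma AE_not_entering:
  assumes D: "D \<in> sets M" and closed: "\<And>z. z \<in> D \<Longrightarrow> T z \<in> D"
  shows "AE z in M. T z \<in> D \<longrightarrow> z \<in> D"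
proof -
  have sub: "D \<subseteq> T -` D \<inter> space M" using closed sets.sets_into_space[OF D] by auto
  have "prob ((T -` D \<inter> space M) - D) = prob (T -` D \<inter> space M) - prob D"
    using D sub measurable_sets[OF T D] by (intro finite_measure_Diff) auto
  then have "(T -` D \<inter> space M) - D \<in> null_sets M"
    using prob_T[OF D] D measurable_sets[OF T D] by (auto simp: null_sets_def emeasure_eq_measure)
  then show ?thesis by (rule AE_I') auto
qed

end

text \<open>Dynkin's theorem. Two word events are written over a common length, which makes them
  stable under intersection.\<close>

lemma itin_sets_unique:
  assumes M: "mpt M T" and M': "mpt M' T" and sets: "sets M' = sets M"
    and s: "simple_function M s"
    and eq: "\<And>m w. law M (word T s m) w = law M' (word T s m) w"
    and A: "A \<in> itin_sets M T s"
  shows "measure M A = measure M' A"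
proof -
  interpret M: mpt M T by fact
  interpret M': mpt M' T by fact
  have space: "space M' = space M" by (rule sets_eq_imp_space_eq[OF sets])
  have s': "simple_function M' s"
    using s by (simp add: simple_function_def space sets)
  let ?G = "{word T s m -` V \<inter> space M | m V. True}"
  have stable: "Int_stable ?G"
  proof (rule Int_stableI)
    fix a b assume "a \<in> ?G" "b \<in> ?G"
    then obtain m V m' V' where ab: "a = word T s m -` V \<inter> space M" "b = word T s m' -` V' \<inter> space M" by blast
    have "a \<inter> b = word T s (m + m') -` {w. take m w \<in> V \<and> take m' w \<in> V'} \<inter> space M"
      unfolding ab by (auto simp: take_word)
    then show "a \<inter> b \<in> ?G" by blast
  qed
  have sub: "sigma_sets (space M) ?G \<subseteq> sets M"
    using M.itin_sets_subset[OF s] by (simp add: itin_sets_def)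
  have closed: "?G \<subseteq> Pow (space M)" by auto
  show ?thesis
    using stable closed A[unfolded itin_sets_def]
  proof (induction rule: sigma_sets_induct_disjoint[consumes 3])
    case (basic A)
    then obtain m V where A: "A = word T s m -` V \<inter> space M" by blast
    have "measure M A = (\<Sum>v\<in>word T s m ` space M \<inter> V. law M (word T s m) v)"
      unfolding A by (rule M.sum_law[OF M.simple_word[OF s], symmetric])
    also have "\<dots> = (\<Sum>v\<in>word T s m ` space M' \<inter> V. law M' (word T s m) v)" by (simp add: eq space)
    also have "\<dots> = measure M' A"
      unfolding A using M'.sum_law[OF M'.simple_word[OF s']] by (simp add: space)
    finally show ?case .
  next
    case empty
    show ?case by simp
  next
    case (compl A)
    then have "A \<in> sets M" using sub by blast
    then show ?case
      using compl.IH M.prob_compl[of A] M'.prob_compl[of A] by (simp add: sets space)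
  next
    case (union A)
    then have "range A \<subseteq> sets M" using sub by blast
    then show ?case
      using union M.finite_measure_UNION[of A] M'.finite_measure_UNION[of A]
      by (simp add: sets sums_unique[OF M.finite_measure_UNION] sums_unique[OF M'.finite_measure_UNION] sums_iff)
  qed
qed

section \<open>Dynamics of the shrinking transformation\<close>

lemma first_return_time_eqI:
  assumes "1 \<le> k" "(T ^^ k) z \<in> S" "\<And>i. 1 \<le> i \<Longrightarrow> i < k \<Longrightarrow> (T ^^ i) z \<notin> S"
  shows "first_return_time T S z = k"
  unfolding first_return_time_def
  by (rule Least_equality) (use assms in \<open>auto simp: not_le[symmetric]\<close>)

lemma first_return_time_props:
  assumes "1 \<le> k" "(T ^^ k) z \<in> S"
  shows "1 \<le> first_return_time T S z" "(T ^^ first_return_time T S z) z \<in> S"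
    "first_return_time T S z \<le> k"
    "1 \<le> i \<Longrightarrow> i < first_return_time T S z \<Longrightarrow> (T ^^ i) z \<notin> S"
  using LeastI[of "\<lambda>k. 1 \<le> k \<and> (T ^^ k) z \<in> S" k] assms
    Least_le[of "\<lambda>k. 1 \<le> k \<and> (T ^^ k) z \<in> S" k] not_less_Least[of i "\<lambda>k. 1 \<le> k \<and> (T ^^ k) z \<in> S"]
  by (auto simp: first_return_time_def)

lemma first_return_time_step:
  assumes "T z \<notin> S" "1 \<le> k" "(T ^^ k) (T z) \<in> S"
  shows "first_return_time T S z = Suc (first_return_time T S (T z))"
proof (rule first_return_time_eqI)
  note * = first_return_time_props[OF assms(2,3)]
  show "(T ^^ Suc (first_return_time T S (T z))) z \<in> S" using *(2) by (simp add: funpow_swap1)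
  fix i assume i: "1 \<le> i" "i < Suc (first_return_time T S (T z))"
  then obtain i' where i': "i = Suc i'" by (cases i) auto
  show "(T ^^ i) z \<notin> S"
  proof (cases "i' = 0")
    case False
    then show ?thesis using *(4)[of i'] i by (simp add: i' funpow_swap1)
  qed (use assms i' in simp)
qed simp

section \<open>The map \<open>K\<close>: constants, symmetry, invariant core and return
  times\<close>

locale shrinking_beta =
  fixes n :: nat and \<beta> :: real
  assumes n: "3 \<le> n" and \<beta>1: "1 < \<beta>" and eqn: "\<beta> ^ n = (\<Sum>k\<le>n - 2. \<beta> ^ k)"
begin

definition a where "a = switch_left \<beta>"
definition b where "b = switch_right \<beta>"
definition e where "e = 1 / (\<beta> - 1)"
definition c where "c = a / \<beta> ^ (n - 1)"

abbreviation "K \<equiv> shrinking_map \<beta>"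
abbreviation "S \<equiv> switch_region \<beta>"
abbreviation "u \<equiv> first_return_time K S"

lemma \<beta>sq: "1 < \<beta>\<^sup>2" using \<beta>1 by (simp add: one_less_power)

lemma a_pos: "0 < a" using \<beta>sq by (simp add: a_def switch_left_def)
lemma a_eq: "\<beta> * \<beta> * a - a = 1"
proof -
  have "(\<beta>\<^sup>2 - 1) * a = 1" using \<beta>sq by (simp add: a_def switch_left_def)
  then show ?thesis by (simp add: algebra_simps power2_eq_square)
qed
lemma b_eq: "b = \<beta> * a" by (simp add: b_def a_def switch_left_def switch_right_def)
lemma e_eq: "e = \<beta> * a + a"
proof -
  have "(\<beta> * a + a) * (\<beta> - 1) = 1" using a_eq by (simp add: algebra_simps)
  then show ?thesis using \<beta>1 by (simp add: e_def field_simps)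
qed

text \<open>Multiplication by \<open>\<beta> - 1\<close> collapses the geometric sum in the equation
  for \<open>\<beta>\<close>. The equation enters everything below in this form.\<close>

lemma golden: "(1 + \<beta> - \<beta> * \<beta>) * \<beta> ^ (n - 1) = 1"
proof -
  have "(\<beta> - 1) * (\<Sum>k<n - 1. \<beta> ^ k) = \<beta> ^ (n - 1) - 1"
    by (simp add: power_diff_1_eq)
  moreover have "{..<n - 1} = {..n - 2}" using n by auto
  ultimately have *: "(\<beta> - 1) * \<beta> ^ n = \<beta> ^ (n - 1) - 1" by (simp add: eqn)
  obtain m where m: "n = Suc m" using n by (cases n) auto
  have "\<beta> ^ m * (\<beta> * \<beta> - \<beta>) = \<beta> ^ m - 1" using * by (simp add: m algebra_simps)
  then show ?thesis by (simp add: m algebra_simps)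
qed

text \<open>Here the choice of \<open>\<beta>\<close> becomes dynamics: the image of
  \<open>a\<close> under the digit \<open>1\<close> climbs back to \<open>a\<close> in
  \<open>n - 1\<close> multiplications by \<open>\<beta>\<close>, so that the end points have
  finitely many second coordinates on their orbits.\<close>

lemma c_eq: "c = \<beta> * a - 1"
proof -
  have "c = (1 + \<beta> - \<beta> * \<beta>) * \<beta> ^ (n - 1) * c" by (simp only: golden mult_1)
  also have "\<dots> = (1 + \<beta> - \<beta> * \<beta>) * a" using \<beta>1 by (simp add: c_def)
  also have "\<dots> = \<beta> * a - 1" using a_eq by (simp add: algebra_simps)
  finally show ?thesis .
qed

lemma c_pos: "0 < c" using a_pos \<beta>1 by (simp add: c_def)
lemma c_power: "\<beta> ^ (n - 1) * c = a" using \<beta>1 by (simp add: c_def)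
lemma c_less_a: "c < a" using a_pos \<beta>1 n by (simp add: c_def divide_less_eq one_less_power)
lemma a_less_b: "a < b" using a_pos \<beta>1 by (simp add: b_eq)
lemma b_less: "b < e - c" using c_less_a by (simp add: e_eq b_eq)
lemma \<beta>b: "\<beta> * b - 1 = a" using a_eq by (simp add: b_eq)
lemma \<beta>e: "\<beta> * e - 1 = e" using a_eq by (simp add: e_eq algebra_simps)
lemma e_a: "e - a = b" by (simp add: e_eq b_eq)

lemmas order_facts = c_pos c_less_a a_less_b b_less

lemma mem_S: "(\<omega>, x) \<in> S \<longleftrightarrow> a \<le> x \<and> x \<le> b"
  by (simp add: switch_region_def a_def b_def)

lemma K_L: "x < a \<Longrightarrow> K (\<omega>, x) = (\<omega>, \<beta> * x)"
  by (simp add: shrinking_map_def a_def)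
lemma K_R: "b < x \<Longrightarrow> K (\<omega>, x) = (\<omega>, \<beta> * x - 1)"
  using a_less_b by (simp add: shrinking_map_def a_def b_def)
lemma K_S: "a \<le> x \<Longrightarrow> x \<le> b \<Longrightarrow> K (\<omega>, x) = (left_shift \<omega>, \<beta> * x - of_bool (\<omega> 0))"
  by (simp add: shrinking_map_def a_def b_def)

text \<open>The symmetry exchanging the digits and the two sides of the switch region. It commutes
  with \<open>K\<close> and halves the case distinctions.\<close>

definition flip :: "(nat \<Rightarrow> bool) \<times> real \<Rightarrow> (nat \<Rightarrow> bool) \<times> real" where
  "flip = (\<lambda>(\<omega>, x). (\<lambda>i. \<not> \<omega> i, e - x))"

lemma flip_S: "flip z \<in> S \<longleftrightarrow> z \<in> S"
  using e_a by (cases z) (auto simp: flip_def mem_S)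

lemma K_flip: "K (flip z) = flip (K z)"
proof -
  obtain \<omega> x where z: "z = (\<omega>, x)" by (cases z)
  have *: "\<beta> * (e - x) = e + 1 - \<beta> * x" using \<beta>e by (simp add: algebra_simps)
  consider "x < a" | "a \<le> x" "x \<le> b" | "b < x" by linarith
  then show ?thesis
  proof cases
    case 1
    then have "b < e - x" using e_a by linarith
    then show ?thesis using 1 * by (simp add: z flip_def K_L K_R)
  next
    case 2
    then have "a \<le> e - x" "e - x \<le> b" using e_a by linarith+
    then show ?thesis using 2 * by (simp add: z flip_def K_S left_shift_def)
  next
    case 3
    then have "e - x < a" using e_a by linarith
    then show ?thesis using 3 * by (simp add: z flip_def K_L K_R)
  qed
qed

lemma funpow_K_flip: "(K ^^ i) (flip z) = flip ((K ^^ i) z)"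
  by (induction i) (simp_all add: K_flip)

lemma u_flip: "u (flip z) = u z"
  by (simp add: first_return_time_def funpow_K_flip flip_S)

lemma funpow_K_L:
  "(\<And>i. i < j \<Longrightarrow> \<beta> ^ i * y < a) \<Longrightarrow> (K ^^ j) (\<omega>, y) = (\<omega>, \<beta> ^ j * y)"
proof (induction j)
  case (Suc j)
  then show ?case using K_L[of "\<beta> ^ j * y" \<omega>] by (simp add: mult.assoc)
qed simp

text \<open>As \<open>b = \<beta> * a\<close>, the interval from \<open>a\<close> to
  \<open>b\<close> with \<open>b\<close> excluded is a fundamental domain for multiplication by
  \<open>\<beta>\<close>: the orbit of a positive \<open>y\<close> meets it once and lies below
  \<open>a\<close> before.\<close>

lemma hit_L:
  assumes j: "1 \<le> j" "a \<le> \<beta> ^ j * y" "\<beta> ^ j * y < b"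
  shows "u (\<omega>, y) = j" "(K ^^ j) (\<omega>, y) = (\<omega>, \<beta> ^ j * y)"
    "i < j \<Longrightarrow> \<beta> ^ i * y < a"
proof -
  obtain m where m: "j = Suc m" using j by (cases j) auto
  have y: "0 < y"
  proof (rule ccontr)
    assume "\<not> 0 < y"
    then have "\<beta> ^ j * y \<le> 0" using \<beta>1 by (simp add: mult_nonneg_nonpos)
    then show False using j a_pos by linarith
  qed
  have less: "\<beta> ^ i * y < a" if "i < j" for i
  proof -
    have "\<beta> ^ i * y \<le> \<beta> ^ m * y" using that m \<beta>1 y by (intro mult_right_mono power_increasing) auto
    moreover have "\<beta> * (\<beta> ^ m * y) < \<beta> * a" using j by (simp add: m b_eq mult.assoc)
    then have "\<beta> ^ m * y < a" using \<beta>1 by simp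
    ultimately show ?thesis by linarith
  qed
  then show "i < j \<Longrightarrow> \<beta> ^ i * y < a" .
  have K: "(K ^^ i) (\<omega>, y) = (\<omega>, \<beta> ^ i * y)" if "i \<le> j" for i
    using that by (intro funpow_K_L less) simp
  from K[of j] show "(K ^^ j) (\<omega>, y) = (\<omega>, \<beta> ^ j * y)" by simp
  show "u (\<omega>, y) = j"
    by (rule first_return_time_eqI) (use K less j in \<open>auto simp: mem_S not_le\<close>)
qed

lemma hit_L_ex:
  assumes y: "0 < y" "y < a"
  obtains j where "1 \<le> j" "a \<le> \<beta> ^ j * y" "\<beta> ^ j * y < b"
proof -
  obtain k where k: "a / y < \<beta> ^ k" using real_arch_pow[OF \<beta>1] by blast
  define j where "j = (LEAST j. a \<le> \<beta> ^ j * y)"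
  have ex: "a \<le> \<beta> ^ k * y" using k y by (simp add: field_simps)
  then have j: "a \<le> \<beta> ^ j * y" unfolding j_def by (rule LeastI)
  have "j \<noteq> 0" using j y by (cases "j = 0") auto
  then obtain m where m: "j = Suc m" by (cases j) auto
  have "\<not> a \<le> \<beta> ^ m * y" using not_less_Least[of m "\<lambda>j. a \<le> \<beta> ^ j * y"] m j_def by simp
  then have "\<beta> ^ j * y < b" using \<beta>1 by (simp add: m b_eq mult.assoc)
  then show thesis using that[of j] j m by simp
qed

text \<open>The interval between the extreme images of the switch region: digit \<open>1\<close>
  sends it onto \<open>[c, a]\<close>, digit \<open>0\<close> onto \<open>[b, e - c]\<close>. It
  stays away from the fixed points \<open>0\<close> and \<open>e\<close>, which bounds the entry
  times.\<close>

definition core :: "((nat \<Rightarrow> bool) \<times> real) set" where "core = UNIV \<times> {c..e - c}"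

lemma mem_core: "(\<omega>, x) \<in> core \<longleftrightarrow> c \<le> x \<and> x \<le> e - c" by (simp add: core_def)

lemma flip_core: "flip z \<in> core \<longleftrightarrow> z \<in> core"
  by (cases z) (auto simp: flip_def mem_core)

lemma S_core: "z \<in> S \<Longrightarrow> z \<in> core"
  using order_facts by (cases z) (auto simp: mem_S mem_core)

lemma u_L:
  assumes "0 < x" "x < a"
  shows "1 \<le> u (\<omega>, x)" "(K ^^ u (\<omega>, x)) (\<omega>, x) \<in> S" "c \<le> x \<Longrightarrow> u (\<omega>, x) \<le> n - 1"
proof -
  obtain j where j: "1 \<le> j" "a \<le> \<beta> ^ j * x" "\<beta> ^ j * x < b" using hit_L_ex[OF assms] by blast
  note * = hit_L[OF j]
  show "1 \<le> u (\<omega>, x)" using j * by simp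
  show "(K ^^ u (\<omega>, x)) (\<omega>, x) \<in> S" using j * by (simp add: mem_S)
  show "u (\<omega>, x) \<le> n - 1" if "c \<le> x"
  proof (rule ccontr)
    assume "\<not> u (\<omega>, x) \<le> n - 1"
    then have "\<beta> ^ (n - 1) * x < a" using *(1) *(3)[of "n - 1"] by simp
    moreover have "\<beta> ^ (n - 1) * c \<le> \<beta> ^ (n - 1) * x" using that \<beta>1 by (intro mult_left_mono) auto
    ultimately show False using c_power by linarith
  qed
qed

lemma reach:
  assumes "0 < x" "x < e" and that: "(\<omega>, x) \<notin> S"
  shows "\<exists>k\<ge>1. (K ^^ k) (\<omega>, x) \<in> S"
proof (cases "x < a")
  case True
  then show ?thesis using u_L[of x \<omega>] assms by blast
next
  case False
  then have "0 < e - x" "e - x < a" using that assms e_a by (auto simp: mem_S)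
  then have "1 \<le> u (flip (\<omega>, x))" "(K ^^ u (flip (\<omega>, x))) (flip (\<omega>, x)) \<in> S"
    using u_L[of "e - x" "\<lambda>i. \<not> \<omega> i"] by (auto simp: flip_def)
  then show ?thesis by (auto simp: funpow_K_flip flip_S)
qed

lemma core_K: "z \<in> core \<Longrightarrow> K z \<in> core"
proof -
  have *: "K (\<omega>, x) \<in> core" if "(\<omega>, x) \<in> core" "x < a \<or> x \<le> b \<and> \<omega> 0" for \<omega> x
  proof (cases "x < a")
    case True
    have "\<beta> * x < b" using True \<beta>1 by (simp add: b_eq)
    moreover have "c \<le> \<beta> * x"
    proof -
      have x: "c \<le> x" using that by (simp add: mem_core)
      then have "0 \<le> (\<beta> - 1) * x" using \<beta>1 c_pos by (intro mult_nonneg_nonneg) auto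
      also have "\<dots> = \<beta> * x - x" by (simp add: algebra_simps)
      finally show ?thesis using x by linarith
    qed
    ultimately show ?thesis using True that order_facts by (auto simp: K_L mem_core)
  next
    case False
    have "\<beta> * a \<le> \<beta> * x" "\<beta> * x \<le> \<beta> * b" using False that \<beta>1 by auto
    then show ?thesis using False that order_facts \<beta>b c_eq by (auto simp: K_S mem_core)
  qed
  assume z: "z \<in> core"
  obtain \<omega> x where zx: "z = (\<omega>, x)" by (cases z)
  show ?thesis
  proof (cases "x < a \<or> x \<le> b \<and> \<omega> 0")
    case True
    then show ?thesis using * z zx by auto
  next
    case False
    have "K (flip z) \<in> core"
      using *[of "\<lambda>i. \<not> \<omega> i" "e - x"] False z flip_core[of z] e_a by (auto simp: zx flip_def)
    then show ?thesis by (simp add: K_flip flip_core)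
  qed
qed

lemma core_notin_S:
  assumes "z \<in> core" "z \<notin> S"
  shows "\<exists>k. 1 \<le> k \<and> k \<le> n - 1 \<and> (K ^^ k) z \<in> S"
proof -
  obtain \<omega> x where zx: "z = (\<omega>, x)" by (cases z)
  show ?thesis
  proof (cases "x < a")
    case True
    then have *: "0 < x" "c \<le> x" using assms c_pos by (auto simp: zx mem_core)
    show ?thesis unfolding zx using u_L[OF *(1) True, of \<omega>] *(2) by blast
  next
    case False
    then have *: "0 < e - x" "e - x < a" "c \<le> e - x"
      using assms c_pos e_a by (auto simp: zx mem_core mem_S)
    have "1 \<le> u (flip z)" "(K ^^ u (flip z)) (flip z) \<in> S" "u (flip z) \<le> n - 1"
      using u_L[OF *(1,2)] *(3) by (auto simp: zx flip_def)
    then show ?thesis by (auto simp: funpow_K_flip flip_S)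
  qed
qed

lemma core_return:
  assumes "z \<in> core"
  shows "\<exists>k. 1 \<le> k \<and> k \<le> n \<and> (K ^^ k) z \<in> S"
proof (cases "K z \<in> S")
  case True
  then show ?thesis using n by (intro exI[of _ 1]) auto
next
  case False
  then obtain k where "k \<le> n - 1" "(K ^^ k) (K z) \<in> S"
    using core_notin_S[OF core_K[OF assms]] by blast
  then show ?thesis using n by (intro exI[of _ "Suc k"]) (auto simp: funpow_swap1)
qed

lemma u_core:
  assumes "z \<in> core"
  shows "1 \<le> u z" "u z \<le> n" "(K ^^ u z) z \<in> S" "z \<notin> S \<Longrightarrow> u z \<le> n - 1"
proof -
  obtain k where k: "1 \<le> k" "k \<le> n" "(K ^^ k) z \<in> S" using core_return[OF assms] by blast
  note * = first_return_time_props[OF k(1,3)]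
  show "1 \<le> u z" "u z \<le> n" "(K ^^ u z) z \<in> S" using * k by auto
  show "u z \<le> n - 1" if "z \<notin> S"
    using core_notin_S[OF assms that] first_return_time_props(3)[of _ K z S] by fastforce
qed

lemma u_eq_1: "z \<in> core \<Longrightarrow> u z = 1 \<longleftrightarrow> K z \<in> S"
  using u_core(3)[of z] first_return_time_eqI[of 1 K z S] by auto

lemma u_step:
  assumes "z \<in> core" "u z \<noteq> 1"
  shows "K z \<notin> S" "u z = Suc (u (K z))"
proof -
  show ns: "K z \<notin> S" using u_eq_1[OF assms(1)] assms(2) by simp
  obtain k where "1 \<le> k" "(K ^^ k) (K z) \<in> S" using core_notin_S[OF core_K[OF assms(1)] ns] by blast
  then show "u z = Suc (u (K z))" by (rule first_return_time_step[where T=K and S=S, OF ns])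
qed

lemma u_step': "K z \<notin> S \<Longrightarrow> z \<in> core \<Longrightarrow> u z = Suc (u (K z))"
  using u_step[of z] u_eq_1[of z] by auto

text \<open>Digit \<open>1\<close> sends the switch region to \<open>[c, a]\<close>, from where only
  multiplications by \<open>\<beta>\<close> follow until the return. The value \<open>a\<close> is
  already in the switch region and is taken only at \<open>b\<close>.\<close>

lemma induced_left:
  assumes z: "(\<omega>, x) \<in> S" and \<omega>: "\<omega> 0"
  shows "(K ^^ u (\<omega>, x)) (\<omega>, x) = (left_shift \<omega>, \<beta> ^ (u (\<omega>, x) - 1) * (\<beta> * x - 1))"
    "u (\<omega>, x) = 1 \<longleftrightarrow> x = b"
proof -
  have x: "a \<le> x" "x \<le> b" using z by (auto simp: mem_S)
  have K: "K (\<omega>, x) = (left_shift \<omega>, \<beta> * x - 1)" using x \<omega> by (simp add: K_S)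
  have "\<beta> * a \<le> \<beta> * x" "\<beta> * x \<le> \<beta> * b" using x \<beta>1 by auto
  then have y: "c \<le> \<beta> * x - 1" "\<beta> * x - 1 \<le> a" using c_eq \<beta>b by auto
  have "\<beta> * x - 1 = a \<longleftrightarrow> \<beta> * x = \<beta> * b" using \<beta>b by linarith
  then have xb: "x = b \<longleftrightarrow> \<beta> * x - 1 = a" using \<beta>1 by simp
  have core: "(\<omega>, x) \<in> core" using z by (rule S_core)
  have S1: "K (\<omega>, x) \<in> S \<longleftrightarrow> x = b" unfolding K mem_S xb using y a_less_b by auto
  show u1: "u (\<omega>, x) = 1 \<longleftrightarrow> x = b" using u_eq_1[OF core] S1 by simp
  show "(K ^^ u (\<omega>, x)) (\<omega>, x) = (left_shift \<omega>, \<beta> ^ (u (\<omega>, x) - 1) * (\<beta> * x - 1))"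
  proof (cases "x = b")
    case True
    then show ?thesis using u1 K by simp
  next
    case False
    then have lt: "\<beta> * x - 1 < a" using xb y by auto
    obtain j where j: "1 \<le> j" "a \<le> \<beta> ^ j * (\<beta> * x - 1)" "\<beta> ^ j * (\<beta> * x - 1) < b"
      using hit_L_ex[of "\<beta> * x - 1"] lt y c_pos by auto
    have "u (\<omega>, x) = Suc (u (K (\<omega>, x)))" using False S1 by (intro u_step' core) simp
    then show ?thesis using hit_L[OF j] by (simp add: K funpow_swap1)
  qed
qed

lemma induced_right:
  assumes z: "(\<omega>, x) \<in> S" and \<omega>: "\<not> \<omega> 0"
  shows "(K ^^ u (\<omega>, x)) (\<omega>, x) = (left_shift \<omega>, e - \<beta> ^ (u (\<omega>, x) - 1) * (\<beta> * (e - x) - 1))"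
    "u (\<omega>, x) = 1 \<longleftrightarrow> x = a"
proof -
  let ?z = "flip (\<omega>, x)"
  have z': "?z = (\<lambda>i. \<not> \<omega> i, e - x)" by (simp add: flip_def)
  have fz: "?z \<in> S" using z by (simp add: flip_S)
  have "(K ^^ u ?z) ?z = (left_shift (\<lambda>i. \<not> \<omega> i), \<beta> ^ (u ?z - 1) * (\<beta> * (e - x) - 1))"
    "u ?z = 1 \<longleftrightarrow> e - x = b"
    unfolding z' using \<omega> by (intro induced_left fz[unfolded z']; simp)+
  then have *: "flip ((K ^^ u (\<omega>, x)) (\<omega>, x)) = (left_shift (\<lambda>i. \<not> \<omega> i), \<beta> ^ (u (\<omega>, x) - 1) * (\<beta> * (e - x) - 1))"
    "u (\<omega>, x) = 1 \<longleftrightarrow> e - x = b"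
    by (simp_all add: u_flip funpow_K_flip)
  show "u (\<omega>, x) = 1 \<longleftrightarrow> x = a" using *(2) e_a by auto
  have "flip (flip w) = w" for w by (cases w) (simp add: flip_def)
  then have "(K ^^ u (\<omega>, x)) (\<omega>, x) = flip (left_shift (\<lambda>i. \<not> \<omega> i), \<beta> ^ (u (\<omega>, x) - 1) * (\<beta> * (e - x) - 1))"
    using *(1) by metis
  then show "(K ^^ u (\<omega>, x)) (\<omega>, x) = (left_shift \<omega>, e - \<beta> ^ (u (\<omega>, x) - 1) * (\<beta> * (e - x) - 1))"
    by (simp add: flip_def left_shift_def)
qed

text \<open>The inverse branches of the induced map.\<close>

definition br :: "bool \<times> nat \<Rightarrow> real \<Rightarrow> real" where
  "br = (\<lambda>(d, t) x. if d then 1 / \<beta> + x / \<beta> ^ t else e - 1 / \<beta> - (e - x) / \<beta> ^ t)"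

text \<open>Branches are full because \<open>c = a / \<beta> ^ (n - 1)\<close>: for
  \<open>t \<le> n\<close> the point \<open>x / \<beta> ^ (t - 1)\<close> lies above
  \<open>c\<close>, so it is the image of a point of the switch region under the digit
  \<open>1\<close>. At an end point \<open>x\<close> the return time could drop, hence the strict
  bounds.\<close>

lemma br_return:
  assumes d: "\<omega> 0 = d" and t: "2 \<le> t" "t \<le> n" and x: "a < x" "x < b"
  shows "(\<omega>, br (d, t) x) \<in> S" "u (\<omega>, br (d, t) x) = t"
    "(K ^^ t) (\<omega>, br (d, t) x) = (left_shift \<omega>, x)"
proof -
  have *: "(\<omega>, 1 / \<beta> + x / \<beta> ^ t) \<in> S \<and> u (\<omega>, 1 / \<beta> + x / \<beta> ^ t) = t \<and>
      (K ^^ t) (\<omega>, 1 / \<beta> + x / \<beta> ^ t) = (left_shift \<omega>, x)"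
    if \<omega>: "\<omega> 0" and x: "a < x" "x < b" for \<omega> x
  proof -
    obtain j where j: "t = Suc j" "1 \<le> j" using t by (cases t) auto
    let ?y = "x / \<beta> ^ j" and ?x = "1 / \<beta> + x / \<beta> ^ t"
    have yx: "?y = \<beta> * ?x - 1" using \<beta>1 by (simp add: j field_simps)
    have jy: "\<beta> ^ j * ?y = x" using \<beta>1 by simp
    have h: "u (\<omega>', ?y) = j" "(K ^^ j) (\<omega>', ?y) = (\<omega>', x)" "?y < a" for \<omega>'
      using hit_L(1,2)[of j ?y \<omega>'] hit_L(3)[of j ?y 0] j x unfolding jy by auto
    have "c \<le> ?y"
    proof -
      have "c \<le> a / \<beta> ^ j" unfolding c_def using a_pos \<beta>1 t j by (intro divide_left_mono power_increasing) auto
      also have "\<dots> \<le> ?y" using x \<beta>1 by (intro divide_right_mono) auto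
      finally show ?thesis .
    qed
    then have "\<beta> * a \<le> \<beta> * ?x" "\<beta> * ?x \<le> \<beta> * b" using h(3) unfolding yx by (auto simp: c_eq \<beta>b[symmetric])
    then have S: "(\<omega>, ?x) \<in> S" using \<beta>1 by (simp add: mem_S)
    have K: "K (\<omega>, ?x) = (left_shift \<omega>, ?y)" using S \<omega> unfolding yx by (simp add: K_S mem_S)
    have "K (\<omega>, ?x) \<notin> S" using h(3) by (simp add: K mem_S)
    then have "u (\<omega>, ?x) = Suc (u (K (\<omega>, ?x)))" using u_step'[OF _ S_core[OF S]] by simp
    also have "u (K (\<omega>, ?x)) = j" unfolding K by (rule h)
    finally have "u (\<omega>, ?x) = t" by (simp only: j)
    moreover have "(K ^^ t) z = (K ^^ j) (K z)" for z by (simp add: j funpow_swap1)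
    then have "(K ^^ t) (\<omega>, ?x) = (left_shift \<omega>, x)" unfolding K by (simp only: K h)
    ultimately show ?thesis using S by simp
  qed
  have "(\<omega>, br (d, t) x) \<in> S \<and> u (\<omega>, br (d, t) x) = t \<and> (K ^^ t) (\<omega>, br (d, t) x) = (left_shift \<omega>, x)"
  proof (cases d)
    case True
    then show ?thesis using *[of \<omega> x] d x by (simp add: br_def)
  next
    case False
    have x': "a < e - x" "e - x < b" using x e_a by auto
    let ?z = "(\<omega>, br (d, t) x)"
    have fl: "flip ?z = (\<lambda>i. \<not> \<omega> i, 1 / \<beta> + (e - x) / \<beta> ^ t)" using False by (simp add: flip_def br_def)
    have **: "?z \<in> S" "u ?z = t" "flip ((K ^^ t) ?z) = (left_shift (\<lambda>i. \<not> \<omega> i), e - x)"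
      using *[of "\<lambda>i. \<not> \<omega> i" "e - x"] d False x'
      by (simp_all only: fl[symmetric] flip_S u_flip funpow_K_flip) auto
    then show ?thesis by (cases "(K ^^ t) ?z") (auto simp: flip_def left_shift_def fun_eq_iff)
  qed
  then show "(\<omega>, br (d, t) x) \<in> S" "u (\<omega>, br (d, t) x) = t"
    "(K ^^ t) (\<omega>, br (d, t) x) = (left_shift \<omega>, x)" by auto
qed

end

section \<open>Measurability and generators\<close>

text \<open>A measurable space, with the zero measure as a dummy, so that measurability of functions
  along itineraries can be expressed.\<close>

definition itin_algebra :: "'a measure \<Rightarrow> ('a \<Rightarrow> 'a) \<Rightarrow> ('a \<Rightarrow> 'b) \<Rightarrow> 'a measure" where
  "itin_algebra M T s = measure_of (space M) (itin_sets M T s) (\<lambda>_. 0)"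

lemma space_itin_algebra[simp]: "space (itin_algebra M T s) = space M"
  by (simp add: itin_algebra_def space_measure_of_conv)

lemma sets_itin_algebra[simp]: "sets (itin_algebra M T s) = itin_sets M T s"
  unfolding itin_algebra_def by (rule sigma_algebra.sets_measure_of_eq[OF sigma_algebra_itin])

lemma measurable_word: "(\<lambda>z. g (word T s m z)) \<in> measurable (itin_algebra M T s) (count_space UNIV)"
proof (rule measurableI)
  fix A
  have "(\<lambda>z. g (word T s m z)) -` A \<inter> space M = word T s m -` (g -` A) \<inter> space M" by auto
  then show "(\<lambda>z. g (word T s m z)) -` A \<inter> space (itin_algebra M T s) \<in> sets (itin_algebra M T s)"
    using itin_sets_word by simp
qed simp

text \<open>Unfolding the recursion along a word of length \<open>m\<close>, with \<open>0\<close>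
  in place of the last value, gives \<open>f\<close> up to an error \<open>C * \<rho> ^ m\<close>.
  Hence \<open>f\<close> is a limit of functions of words.\<close>

lemma (in mpt) contraction_measurable:
  fixes f :: "'a \<Rightarrow> real"
  assumes f: "\<And>z. z \<in> space M \<Longrightarrow> f z = \<alpha> (s z) * f (T z) + \<gamma> (s z)"
    and \<alpha>: "\<And>z. z \<in> space M \<Longrightarrow> \<bar>\<alpha> (s z)\<bar> \<le> \<rho>" and \<rho>: "\<rho> < 1"
    and C: "\<And>z. z \<in> space M \<Longrightarrow> \<bar>f z\<bar> \<le> C"
  shows "f \<in> borel_measurable (itin_algebra M T s)"
proof -
  define \<phi> where "\<phi> = rec_list (0::real) (\<lambda>v _ r. \<alpha> v * r + \<gamma> v)"
  have \<phi>: "\<phi> [] = 0" "\<phi> (v # w) = \<alpha> v * \<phi> w + \<gamma> v" for v w by (simp_all add: \<phi>_def)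
  have \<rho>0: "0 \<le> \<rho>" using \<alpha> not_empty by (meson abs_ge_zero ex_in_conv order_trans)
  have bound: "\<bar>f z - \<phi> (word T s m z)\<bar> \<le> C * \<rho> ^ m" if "z \<in> space M" for m z
    using that
  proof (induction m arbitrary: z)
    case 0
    then show ?case using C by (simp add: \<phi>)
  next
    case (Suc m)
    have "f z - \<phi> (word T s (Suc m) z) = \<alpha> (s z) * (f (T z) - \<phi> (word T s m (T z)))"
      using f[OF Suc.prems] by (simp add: word_Suc \<phi> algebra_simps)
    then have "\<bar>f z - \<phi> (word T s (Suc m) z)\<bar> \<le> \<rho> * (C * \<rho> ^ m)"
      using \<alpha>[OF Suc.prems] Suc.IH[OF T_space[OF Suc.prems]] \<rho>0 by (auto simp: abs_mult intro!: mult_mono)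
    then show ?case by (simp add: mult_ac)
  qed
  show ?thesis
  proof (rule borel_measurable_LIMSEQ_metric)
    show "(\<lambda>z. \<phi> (word T s m z)) \<in> borel_measurable (itin_algebra M T s)" for m
      using measurable_compose[OF measurable_word[where g="\<lambda>w. w"], of \<phi> borel] by simp
    fix z assume "z \<in> space (itin_algebra M T s)"
    then have z: "z \<in> space M" by simp
    have "(\<lambda>m. C * \<rho> ^ m) \<longlonglongrightarrow> 0"
      using \<rho> \<rho>0 by (intro tendsto_mult_right_zero LIMSEQ_power_zero) simp
    then have "(\<lambda>m. f z - \<phi> (word T s m z)) \<longlonglongrightarrow> 0"
      by (rule Lim_null_comparison[rotated]) (simp add: bound[OF z])
    from tendsto_diff[OF tendsto_const[of "f z"] this]
    show "(\<lambda>m. \<phi> (word T s m z)) \<longlonglongrightarrow> f z" by simp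
  qed
qed

text \<open>\<open>L\<close> and \<open>R\<close> are the two sides of the switch region;
  \<open>Sw\<close> marks its points, together with the digit about to be used.\<close>

datatype side = L | R | Sw bool

instance side :: finite
proof
  have "(UNIV :: side set) \<subseteq> {L, R, Sw True, Sw False}"
  proof
    fix x :: side show "x \<in> {L, R, Sw True, Sw False}" by (cases x) auto
  qed
  then show "finite (UNIV :: side set)" by (rule finite_subset) simp
qed

text \<open>The side on which the orbit travels until the next entry. After the digit
  \<open>1\<close> a point of the switch region lies at \<open>a\<close> or left of it, whence
  \<open>L\<close> for \<open>Sw True\<close>.\<close>

fun nxt :: "side \<Rightarrow> side" where
  "nxt L = L" | "nxt R = R" | "nxt (Sw True) = L" | "nxt (Sw False) = R"

fun dg :: "side \<Rightarrow> real" where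
  "dg L = 0" | "dg R = 1" | "dg (Sw q) = of_bool q"

lemma space_coin[simp]: "space coin_space = UNIV"
  by (simp add: coin_space_def space_PiM)

lemma measurable_coin_coord[measurable]: "(\<lambda>\<omega>. \<omega> i) \<in> measurable coin_space (count_space UNIV)"
  unfolding coin_space_def by (rule measurable_component_singleton) simp

lemma measurable_coinI:
  assumes "\<And>i. {z\<in>space N. f z i} \<in> sets N"
  shows "f \<in> measurable N coin_space"
  unfolding coin_space_def
proof (rule measurable_PiM_single')
  show "(\<lambda>z. f z i) \<in> measurable N (count_space UNIV)" for i
    using assms[of i] by (simp add: pred_def[symmetric] measurable_cong_sets)
qed auto

lemma measurable_left_shift: "left_shift \<in> measurable coin_space coin_space"
proof (rule measurable_coinI)
  show "{z\<in>space coin_space. left_shift z i} \<in> sets coin_space" for i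
    unfolding left_shift_def by measurable
qed

section \<open>Measurability of \<open>K\<close> and of the induced map, and their state
  functions\<close>

context shrinking_beta begin

lemma space_phase: "space (phase_space \<beta>) = UNIV \<times> {0..e}"
  by (simp add: phase_space_def space_pair_measure e_def space_restrict_space)

lemma fst_phase[measurable]: "fst \<in> measurable (phase_space \<beta>) coin_space"
  by (simp add: phase_space_def)

lemma snd_phase'[measurable]: "snd \<in> measurable (phase_space \<beta>) (restrict_space borel {0..e})"
  by (simp add: phase_space_def e_def)

lemma snd_phase[measurable]: "snd \<in> borel_measurable (phase_space \<beta>)"
  using snd_phase' by (simp add: measurable_restrict_space2_iff)

lemma measurable_phaseI:
  assumes "(\<lambda>z. fst (f z)) \<in> measurable N coin_space" "(\<lambda>z. snd (f z)) \<in> borel_measurable N"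
    "\<And>z. z \<in> space N \<Longrightarrow> 0 \<le> snd (f z) \<and> snd (f z) \<le> e"
  shows "f \<in> measurable N (phase_space \<beta>)"
proof -
  have "(\<lambda>z. snd (f z)) \<in> measurable N (restrict_space borel {0..e})"
    using assms by (intro measurable_restrict_space2) auto
  then show ?thesis
    unfolding phase_space_def e_def[symmetric] using assms(1)
    by (intro measurable_pair) (simp_all add: comp_def)
qed

lemma digit_phase[measurable]: "(\<lambda>z. fst z i) \<in> measurable (phase_space \<beta>) (count_space UNIV)"
  by (rule measurable_compose[OF fst_phase measurable_coin_coord])

lemma S_eq: "S = {z. a \<le> snd z \<and> snd z \<le> b}"
  by (auto simp: mem_S)

lemma K_range: "z \<in> space (phase_space \<beta>) \<Longrightarrow> K z \<in> space (phase_space \<beta>)"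
proof -
  assume z: "z \<in> space (phase_space \<beta>)"
  obtain \<omega> x where zx: "z = (\<omega>, x)" by (cases z)
  have x: "0 \<le> x" "x \<le> e" using z by (auto simp: zx space_phase)
  consider "x < a" | "a \<le> x" "x \<le> b" | "b < x" by linarith
  then show ?thesis
  proof cases
    case 1
    have "\<beta> * x \<le> b" using 1 \<beta>1 by (simp add: b_eq)
    then show ?thesis using 1 x \<beta>1 order_facts by (simp add: zx K_L space_phase)
  next
    case 2
    then have "(\<omega>, x) \<in> core" by (intro S_core) (simp add: mem_S)
    then show ?thesis using core_K[of "(\<omega>, x)"] c_pos by (auto simp: zx core_def space_phase)
  next
    case 3
    have "\<beta> * b \<le> \<beta> * x" "\<beta> * x \<le> \<beta> * e" using 3 x \<beta>1 by auto
    then show ?thesis using 3 a_pos \<beta>b \<beta>e by (simp add: zx K_R space_phase)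
  qed
qed

lemma K_eq: "K z = (if a \<le> snd z \<and> snd z \<le> b then left_shift (fst z) else fst z,
  if snd z < a then \<beta> * snd z else if snd z \<le> b then \<beta> * snd z - of_bool (fst z 0) else \<beta> * snd z - 1)"
  by (cases z) (auto simp: K_L K_R K_S not_less not_le)

lemma K_measurable: "K \<in> measurable (phase_space \<beta>) (phase_space \<beta>)"
proof (rule measurable_phaseI)
  have [measurable]: "(\<lambda>z. left_shift (fst z)) \<in> measurable (phase_space \<beta>) coin_space"
    by (rule measurable_compose[OF fst_phase measurable_left_shift])
  show "(\<lambda>z. fst (K z)) \<in> measurable (phase_space \<beta>) coin_space"
    unfolding K_eq fst_conv by measurable
  show "(\<lambda>z. snd (K z)) \<in> borel_measurable (phase_space \<beta>)"
    unfolding K_eq snd_conv by measurable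
  fix z assume "z \<in> space (phase_space \<beta>)"
  then show "0 \<le> snd (K z) \<and> snd (K z) \<le> e" using K_range[of z] by (auto simp: space_phase)
qed

lemma K_funpow_measurable[measurable]: "K ^^ i \<in> measurable (phase_space \<beta>) (phase_space \<beta>)"
  by (rule measurable_compose_n[OF K_measurable])

lemma S_sets: "S \<in> sets (phase_space \<beta>)"
proof -
  have eq: "S = {z\<in>space (phase_space \<beta>). a \<le> snd z \<and> snd z \<le> b}"
    using order_facts by (auto simp: S_eq space_phase)
  show ?thesis unfolding eq by measurable
qed

lemma u_measurable[measurable]: "u \<in> measurable (phase_space \<beta>) (count_space UNIV)"
proof -
  have [measurable]: "Measurable.pred (phase_space \<beta>) (\<lambda>z. (K ^^ k) z \<in> S)" for k
    using measurable_sets[OF K_funpow_measurable S_sets, of k] by (simp add: pred_def vimage_def Int_def conj_commute)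
  show ?thesis unfolding first_return_time_def[abs_def] by measurable
qed

definition I where "I = induced_shrinking_map \<beta>"

lemma I_eq: "I z = (K ^^ u z) z"
  by (simp add: I_def induced_shrinking_map_def induced_map_def)

lemma space_switch: "space (switch_space \<beta>) = S"
  using sets.sets_into_space[OF S_sets] by (auto simp: switch_space_def space_restrict_space)

lemma sets_switch: "A \<in> sets (switch_space \<beta>) \<longleftrightarrow> A \<in> sets (phase_space \<beta>) \<and> A \<subseteq> S"
  using S_sets unfolding switch_space_def by (subst sets_restrict_space_iff) auto

lemma I_S: "z \<in> S \<Longrightarrow> I z \<in> S"
  using u_core(3)[OF S_core] by (simp add: I_eq)

lemma I_measurable: "I \<in> measurable (switch_space \<beta>) (switch_space \<beta>)"
  unfolding switch_space_def
proof (rule measurable_restrict_space2)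
  have "(\<lambda>z. (K ^^ u z) z) \<in> measurable (phase_space \<beta>) (phase_space \<beta>)"
    by (rule measurable_compose_countable[OF _ u_measurable]) (rule K_funpow_measurable)
  then show "I \<in> measurable (restrict_space (phase_space \<beta>) S) (phase_space \<beta>)"
    unfolding I_eq[abs_def] by (rule measurable_restrict_space1)
  show "I \<in> space (restrict_space (phase_space \<beta>) S) \<rightarrow> S"
    using I_S by (auto simp: space_restrict_space)
qed

lemma fst_I: "z \<in> S \<Longrightarrow> fst (I z) = left_shift (fst z)"
  using induced_left(1)[of "fst z" "snd z"] induced_right(1)[of "fst z" "snd z"]
  by (cases "fst z 0") (auto simp: I_eq)

text \<open>Second coordinates on the orbits of \<open>a\<close> and \<open>b\<close>: the points
  \<open>a / \<beta> ^ j\<close> climb from \<open>c\<close> to \<open>a\<close>, and the second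
  half is their mirror image, with \<open>b\<close> at \<open>j = 0\<close>.\<close>

definition D :: "real set" where
  "D = (\<lambda>j. a / \<beta> ^ j) ` {..n - 1} \<union> (\<lambda>j. e - a / \<beta> ^ j) ` {..n - 1}"

definition F :: "((nat \<Rightarrow> bool) \<times> real) set" where "F = UNIV \<times> {0, e}"

definition sd :: "(nat \<Rightarrow> bool) \<times> real \<Rightarrow> side" where
  "sd z = (if snd z < a then L else if snd z \<le> b then Sw (fst z 0) else R)"

text \<open>The state of a point: its side, whether it lies on the orbit of an end point of the switch
  region, the time until the next entry to the switch region, and, on the fixed points \<open>F\<close>, the label
  \<open>g\<close>. Points outside \<open>core\<close> and \<open>F\<close> are wandering and get time \<open>0\<close>.\<close>

definition st :: "((nat \<Rightarrow> bool) \<times> real \<Rightarrow> 'c) \<Rightarrow> (nat \<Rightarrow> bool) \<times> real \<Rightarrow> side \<times> bool \<times> nat \<times> 'c option" where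
  "st g z = (sd z, snd z \<in> D, if z \<in> core then u z else 0, if z \<in> F then Some (g z) else None)"

definition ist :: "(nat \<Rightarrow> bool) \<times> real \<Rightarrow> bool \<times> bool \<times> nat" where
  "ist z = (fst z 0, snd z \<in> D, u z)"

lemma D_finite: "finite D" by (simp add: D_def)

lemma sd_Sw: "(\<exists>q. sd z = Sw q) \<longleftrightarrow> z \<in> S"
  by (cases z) (auto simp: sd_def mem_S)

lemma not_sd_Sw: "(\<forall>q. sd z \<noteq> Sw q) \<longleftrightarrow> z \<notin> S"
  by (metis sd_Sw)

lemma sd_SwD: "sd z = Sw q \<Longrightarrow> z \<in> S"
  by (metis sd_Sw)

lemma K_snd: "snd (K z) = \<beta> * snd z - dg (sd z)"
  using K_eq[of z] a_less_b by (auto simp: sd_def)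

lemma D_pred[measurable]: "Measurable.pred (phase_space \<beta>) (\<lambda>z. snd z \<in> D)"
proof -
  have "D \<in> sets borel" using D_finite by (intro borel_closed finite_imp_closed)
  then show ?thesis by measurable
qed

lemma simple_st:
  assumes M: "sets M = sets (phase_space \<beta>)" and g: "simple_function M g"
  shows "simple_function M (st g)"
proof -
  note space = sets_eq_imp_space_eq[OF M]
  have sf: "simple_function M f" if "f \<in> measurable (phase_space \<beta>) (count_space UNIV)" "finite (range f)" for f :: "_ \<Rightarrow> 'z"
    unfolding simple_function_def
  proof (intro conjI ballI)
    show "finite (f ` space M)" using that(2) by (rule finite_subset[rotated]) auto
    show "f -` {x} \<inter> space M \<in> sets M" for x
      unfolding M space by (rule measurable_sets[OF that(1)]) simp
  qed
  have "simple_function M sd"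
    by (rule sf) (simp_all add: sd_def[abs_def] finite_subset[OF subset_UNIV])
  moreover have "simple_function M (\<lambda>z. snd z \<in> D)"
    by (rule sf) (auto intro: finite_subset[OF subset_UNIV])
  moreover have "simple_function M (\<lambda>z. if z \<in> core then u z else 0)"
  proof (rule sf)
    have [measurable]: "core \<in> sets (phase_space \<beta>)"
    proof -
      have eq: "core = {z\<in>space (phase_space \<beta>). c \<le> snd z \<and> snd z \<le> e - c}"
        using order_facts by (auto simp: core_def space_phase)
      show ?thesis unfolding eq by measurable
    qed
    show "(\<lambda>z. if z \<in> core then u z else 0) \<in> measurable (phase_space \<beta>) (count_space UNIV)" by measurable
    show "finite (range (\<lambda>z. if z \<in> core then u z else 0))"
    proof (rule finite_subset)
      show "range (\<lambda>z. if z \<in> core then u z else 0) \<subseteq> {..n}"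
      proof (rule image_subsetI)
        show "(if z \<in> core then u z else 0) \<in> {..n}" for z using u_core(2)[of z] by simp
      qed
    qed simp
  qed
  moreover have "simple_function M (\<lambda>z. if z \<in> F then Some (g z) else None)"
  proof (rule simple_function_If_set)
    show "simple_function M (\<lambda>z. Some (g z))" by (rule simple_function_compose1[OF g])
    have eq: "F \<inter> space M = {z\<in>space (phase_space \<beta>). snd z = 0 \<or> snd z = e}"
      by (auto simp: F_def space)
    show "F \<inter> space M \<in> sets M" unfolding eq M by measurable
  qed simp
  ultimately show ?thesis
    unfolding st_def[abs_def] by (intro simple_function_Pair)
qed

lemma simple_ist:
  assumes M: "sets M = sets (switch_space \<beta>)"
  shows "simple_function M ist"
  unfolding simple_function_def
proof (intro conjI ballI)
  note space = sets_eq_imp_space_eq[OF M]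
  have "ist ` space M \<subseteq> UNIV \<times> UNIV \<times> {..n}"
    using u_core(2)[OF S_core] by (auto simp: ist_def space space_switch)
  then show "finite (ist ` space M)" by (rule finite_subset) simp
  fix x
  have "ist \<in> measurable (phase_space \<beta>) (count_space UNIV)"
    unfolding ist_def[abs_def] by measurable
  then have "ist -` {x} \<inter> space (phase_space \<beta>) \<in> sets (phase_space \<beta>)" by (rule measurable_sets) simp
  then have "ist -` {x} \<inter> space (phase_space \<beta>) \<inter> S \<in> sets (phase_space \<beta>)" using S_sets by (rule sets.Int)
  moreover have "ist -` {x} \<inter> space (phase_space \<beta>) \<inter> S = ist -` {x} \<inter> space M"
    using sets.sets_into_space[OF S_sets] by (auto simp: space space_switch)
  ultimately show "ist -` {x} \<inter> space M \<in> sets M" by (simp add: M sets_switch space space_switch)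
qed

lemma fst_K_funpow: "(\<And>l. l < m \<Longrightarrow> (K ^^ l) z \<notin> S) \<Longrightarrow> fst ((K ^^ m) z) = fst z"
  by (induction m) (auto simp: K_eq S_eq)

lemma F_K: "z \<in> F \<Longrightarrow> K z = z"
  using a_pos order_facts \<beta>e by (auto simp: F_def K_L K_R)

text \<open>The sides determine the second coordinate through the expansion in base
  \<open>\<beta>\<close> with digits \<open>dg\<close>. The digits of the first coordinate are read
  one by one at the visits to the switch region; on \<open>F\<close> there are no visits, hence the
  removal of \<open>F\<close>.\<close>

lemma generator_K:
  assumes M: "mpt M K" and sets: "sets M = sets (phase_space \<beta>)" and A: "A \<in> sets M"
  shows "A - F \<in> itin_sets M K (st g)"
proof -
  interpret mpt M K by fact
  have space: "space M = UNIV \<times> {0..e}" using sets_eq_imp_space_eq[OF sets] space_phase by simp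
  let ?G = "itin_algebra M K (st g)"
  have snd_G: "snd \<in> borel_measurable ?G"
  proof (rule contraction_measurable[where \<alpha>="\<lambda>_. 1 / \<beta>" and \<gamma>="\<lambda>v. dg (fst v) / \<beta>" and \<rho>="1 / \<beta>" and C=e])
    show "snd z = 1 / \<beta> * snd (K z) + dg (fst (st g z)) / \<beta>" for z
      using \<beta>1 by (simp add: K_snd st_def field_simps)
  qed (use \<beta>1 space in auto)
  have FG: "F \<in> sets ?G"
  proof -
    have eq: "F = {z\<in>space ?G. snd z = 0 \<or> snd z = e}" using order_facts by (auto simp: F_def space)
    note [measurable] = snd_G
    show ?thesis unfolding eq by measurable
  qed
  have noF: "(K ^^ m) z \<in> S \<Longrightarrow> z \<notin> F" for m z
  proof
    assume "(K ^^ m) z \<in> S" "z \<in> F"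
    moreover from this(2) have "(K ^^ m) z = z" by (induction m) (simp_all add: F_K)
    ultimately show False using order_facts a_pos by (auto simp: F_def mem_S)
  qed
  \<comment> \<open>Points whose first visit to the switch region, time \<open>0\<close> included,
    is at time \<open>m\<close>. Until then the first coordinate does not change.\<close>
  define fe where "fe m = word K (st g) (Suc m) -` {w. (\<exists>q. fst (w ! m) = Sw q) \<and> (\<forall>l<m. \<not> (\<exists>q. fst (w ! l) = Sw q))} \<inter> space M" for m
  have fe: "fe m = {z\<in>space M. (K ^^ m) z \<in> S \<and> (\<forall>l<m. (K ^^ l) z \<notin> S)}" for m
    unfolding fe_def by (auto simp: nth_word st_def sd_Sw not_sd_Sw dest: sd_SwD)
  have feG: "fe m \<in> sets ?G" for m unfolding fe_def sets_itin_algebra by (rule itin_sets_word)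
  have wG: "word K (st g) m -` V \<inter> space M \<in> sets ?G" for m V
    unfolding sets_itin_algebra by (rule itin_sets_word)
  have ex_fe: "\<exists>m. z \<in> fe m" if z: "z \<in> space M" "z \<notin> F" for z
  proof -
    obtain \<omega> x where zx: "z = (\<omega>, x)" by (cases z)
    have "0 < x" "x < e" using z by (auto simp: space F_def zx)
    then have ex: "\<exists>k. (K ^^ k) z \<in> S" using reach[of x \<omega>] by (cases "z \<in> S") (auto simp: zx intro: exI[of _ 0])
    then have "(K ^^ (LEAST k. (K ^^ k) z \<in> S)) z \<in> S" by (rule LeastI_ex)
    moreover have "\<forall>l<(LEAST k. (K ^^ k) z \<in> S). (K ^^ l) z \<notin> S" using not_less_Least by blast
    ultimately show ?thesis unfolding fe using z by blast
  qed
  have digit: "{z\<in>space M. z \<notin> F \<and> fst z i} \<in> sets ?G" for i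
  proof (induction i)
    case 0
    have eq: "{z\<in>space M. z \<notin> F \<and> fst z 0} = (\<Union>m. fe m \<inter> (word K (st g) (Suc m) -` {w. fst (w ! m) = Sw True} \<inter> space M))"
    proof (intro set_eqI iffI)
      fix z assume z: "z \<in> {z\<in>space M. z \<notin> F \<and> fst z 0}"
      then obtain m where m: "z \<in> fe m" using ex_fe by blast
      then have "fst ((K ^^ m) z) = fst z" by (intro fst_K_funpow) (auto simp: fe)
      then have "sd ((K ^^ m) z) = Sw True" using m z by (auto simp: fe sd_def S_eq)
      then have "z \<in> fe m \<inter> (word K (st g) (Suc m) -` {w. fst (w ! m) = Sw True} \<inter> space M)"
        using m z by (auto simp: nth_word st_def)
      then show "z \<in> (\<Union>m. fe m \<inter> (word K (st g) (Suc m) -` {w. fst (w ! m) = Sw True} \<inter> space M))" by blast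
    next
      fix z assume "z \<in> (\<Union>m. fe m \<inter> (word K (st g) (Suc m) -` {w. fst (w ! m) = Sw True} \<inter> space M))"
      then obtain m where m: "z \<in> fe m" "sd ((K ^^ m) z) = Sw True" "z \<in> space M"
        by (auto simp: nth_word st_def)
      have "fst ((K ^^ m) z) = fst z" using m by (intro fst_K_funpow) (auto simp: fe)
      then show "z \<in> {z\<in>space M. z \<notin> F \<and> fst z 0}"
        using m noF[of m z] by (auto simp: sd_def fe split: if_splits)
    qed
    show ?case unfolding eq
      by (intro sets.countable_UN image_subsetI sets.Int[OF feG wG])
  next
    case (Suc i)
    let ?W = "{z\<in>space M. z \<notin> F \<and> fst z i}"
    have pre: "(K ^^ m) -` ?W \<inter> space M \<in> sets ?G" for m
    proof (induction m)
      case 0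
      have "(K ^^ 0) -` ?W \<inter> space M = ?W" by auto
      then show ?case using Suc by simp
    next
      case (Suc m)
      have eq: "(K ^^ Suc m) -` ?W \<inter> space M = K -` ((K ^^ m) -` ?W \<inter> space M) \<inter> space M"
        using T_space by (auto simp: funpow_swap1)
      show ?case unfolding eq sets_itin_algebra
        by (rule itin_sets_T[OF Suc.IH[unfolded sets_itin_algebra]])
    qed
    \<comment> \<open>The first visit consumes one digit, so digit \<open>i + 1\<close> now is digit
      \<open>i\<close> just after it.\<close>
    have key: "fst ((K ^^ Suc m) z) i = fst z (Suc i) \<and> (K ^^ Suc m) z \<notin> F" if "z \<in> fe m" for z m
    proof
      have S: "(K ^^ m) z \<in> S" and eq: "fst ((K ^^ m) z) = fst z"
        using that fst_K_funpow[of m z] by (auto simp: fe)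
      show "fst ((K ^^ Suc m) z) i = fst z (Suc i)" using S eq by (simp add: K_eq S_eq left_shift_def)
      have "(K ^^ Suc m) z \<in> core" using core_K[OF S_core[OF S]] by simp
      then show "(K ^^ Suc m) z \<notin> F" using c_pos by (auto simp: core_def F_def)
    qed
    have eq: "{z\<in>space M. z \<notin> F \<and> fst z (Suc i)} = (\<Union>m. fe m \<inter> ((K ^^ Suc m) -` ?W \<inter> space M))"
    proof (intro set_eqI iffI)
      fix z assume z: "z \<in> {z\<in>space M. z \<notin> F \<and> fst z (Suc i)}"
      then obtain m where m: "z \<in> fe m" using ex_fe by blast
      have "(K ^^ Suc m) z \<in> space M" using measurable_space[OF funpow_T] z by blast
      then have "z \<in> fe m \<inter> ((K ^^ Suc m) -` ?W \<inter> space M)" using m z key[OF m] by (auto simp del: funpow.simps)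
      then show "z \<in> (\<Union>m. fe m \<inter> ((K ^^ Suc m) -` ?W \<inter> space M))" by blast
    next
      fix z assume "z \<in> (\<Union>m. fe m \<inter> ((K ^^ Suc m) -` ?W \<inter> space M))"
      then obtain m where m: "z \<in> fe m" "fst ((K ^^ Suc m) z) i" "z \<in> space M" by (auto simp del: funpow.simps)
      then show "z \<in> {z\<in>space M. z \<notin> F \<and> fst z (Suc i)}"
        using key[OF m(1)] noF[of m z] by (auto simp: fe)
    qed
    show ?case unfolding eq by (intro sets.countable_UN image_subsetI sets.Int feG pre)
  qed
  \<comment> \<open>Collapsing \<open>F\<close> to one point hides the digits that the itinerary
    does not see; elsewhere \<open>h\<close> is the identity.\<close>
  define h where "h z = (if z \<in> F then (\<lambda>_. False, 0) else z)" for z :: "(nat \<Rightarrow> bool) \<times> real"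
  have "h \<in> measurable ?G (phase_space \<beta>)"
  proof (rule measurable_phaseI)
    show "(\<lambda>z. fst (h z)) \<in> measurable ?G coin_space"
    proof (rule measurable_coinI)
      fix i
      have eq: "{z\<in>space ?G. fst (h z) i} = {z\<in>space M. z \<notin> F \<and> fst z i}" by (auto simp: h_def)
      show "{z\<in>space ?G. fst (h z) i} \<in> sets ?G" unfolding eq by (rule digit)
    qed
    have "(\<lambda>z. if z \<in> F then 0 else snd z) \<in> borel_measurable ?G"
      using FG snd_G by measurable
    moreover have "(\<lambda>z. snd (h z)) = (\<lambda>z. if z \<in> F then 0 else snd z)" by (auto simp: h_def)
    ultimately show "(\<lambda>z. snd (h z)) \<in> borel_measurable ?G" by simp
    show "0 \<le> snd (h z) \<and> snd (h z) \<le> e" if "z \<in> space ?G" for z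
      using that order_facts by (auto simp: h_def space)
  qed
  then have "h -` A \<inter> space ?G \<in> sets ?G" using A by (intro measurable_sets) (simp_all add: sets)
  then have "(h -` A \<inter> space ?G) - F \<in> sets ?G" using FG by (rule sets.Diff)
  moreover have "(h -` A \<inter> space ?G) - F = A - F"
    using sets.sets_into_space[OF A] by (auto simp: h_def)
  ultimately show ?thesis by simp
qed

text \<open>The inverse branch over one return contracts by \<open>1 / \<beta> ^ u z\<close>, and
  each step of the induced map consumes exactly one digit.\<close>

lemma generator_I:
  assumes M: "mpt M I" and sets: "sets M = sets (switch_space \<beta>)" and A: "A \<in> sets M"
  shows "A \<in> itin_sets M I ist"
proof -
  interpret mpt M I by fact
  have space: "space M = S" using sets_eq_imp_space_eq[OF sets] space_switch by simp
  let ?G = "itin_algebra M I ist"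
  have snd_G: "snd \<in> borel_measurable ?G"
  proof (rule contraction_measurable[where \<alpha>="\<lambda>v. 1 / \<beta> ^ snd (snd v)" and \<rho>="1 / \<beta>" and C=e
      and \<gamma>="\<lambda>v. if fst v then 1 / \<beta> else e - 1 / \<beta> - e / \<beta> ^ snd (snd v)"])
    fix z assume "z \<in> space M"
    then have z: "z \<in> S" by (simp add: space)
    obtain \<omega> x where zx: "z = (\<omega>, x)" by (cases z)
    have u: "1 \<le> u z" using u_core(1)[OF S_core[OF z]] .
    then obtain j where j: "u (\<omega>, x) = Suc j" by (cases "u (\<omega>, x)") (auto simp: zx)
    show "snd z = 1 / \<beta> ^ snd (snd (ist z)) * snd (I z) +
        (if fst (ist z) then 1 / \<beta> else e - 1 / \<beta> - e / \<beta> ^ snd (snd (ist z)))"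
    proof (cases "\<omega> 0")
      case True
      then show ?thesis using induced_left(1)[of \<omega> x] z \<beta>1 j by (simp add: zx ist_def I_eq field_simps)
    next
      case False
      then show ?thesis using induced_right(1)[of \<omega> x] z \<beta>1 j by (simp add: zx ist_def I_eq field_simps)
    qed
    have "\<beta> ^ 1 \<le> \<beta> ^ u z" using u \<beta>1 by (intro power_increasing) auto
    then show "\<bar>1 / \<beta> ^ snd (snd (ist z))\<bar> \<le> 1 / \<beta>" using \<beta>1 by (simp add: ist_def frac_le)
    show "\<bar>snd z\<bar> \<le> e" using z order_facts by (auto simp: S_eq)
  qed (use \<beta>1 in simp)
  have fst_funpow: "fst ((I ^^ i) z) = (\<lambda>k. fst z (i + k)) \<and> (I ^^ i) z \<in> S" if "z \<in> S" for i z
    using that by (induction i) (auto simp: fst_I I_S left_shift_def)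
  have "(\<lambda>z. z) \<in> measurable ?G (phase_space \<beta>)"
  proof (rule measurable_phaseI)
    show "(\<lambda>z. fst z) \<in> measurable ?G coin_space"
    proof (rule measurable_coinI)
      fix i
      have eq: "{z\<in>space ?G. fst z i} = word I ist (Suc i) -` {w. fst (w ! i)} \<inter> space M"
        using fst_funpow by (auto simp: nth_word ist_def space)
      show "{z\<in>space ?G. fst z i} \<in> sets ?G" unfolding eq sets_itin_algebra by (rule itin_sets_word)
    qed
    show "0 \<le> snd z \<and> snd z \<le> e" if "z \<in> space ?G" for z
      using that order_facts by (auto simp: S_eq space)
  qed (rule snd_G)
  then have "(\<lambda>z. z) -` A \<inter> space ?G \<in> sets ?G"
    by (rule measurable_sets) (use A sets_switch in \<open>simp add: sets\<close>)
  moreover have "(\<lambda>z. z) -` A \<inter> space ?G = A" using sets.sets_into_space[OF A] by auto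
  ultimately show ?thesis by simp
qed

end

section \<open>Upper bounds and uniqueness\<close>

lemma invariant_probsD:
  assumes "M \<in> invariant_probs N T"
  shows "mpt M T" "sets M = sets N"
  using assms by (auto simp: invariant_probs_def mpt_def mpt_axioms_def)

text \<open>An event of positive probability contains a point with any given almost sure property.
  This turns claims about laws into claims about single points.\<close>

lemma (in prob_space) law_posE:
  assumes X: "simple_function M X" and pos: "0 < law M X v" and AE: "AE z in M. P z"
  obtains z where "z \<in> space M" "X z = v" "P z"
proof (rule ccontr)
  assume *: "\<not> thesis"
  have "AE z in M. z \<notin> X -` {v} \<inter> space M"
    using AE by eventually_elim (use * that in auto)
  then have "prob (X -` {v} \<inter> space M) = 0"
    using law_sets[OF X, of "{v}"] by (simp add: prob_eq_0)
  then show False using pos by (simp add: law_def)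
qed

section \<open>Exceptional orbits and the weighted state graph of \<open>K\<close>\<close>

context shrinking_beta begin

definition lam :: real where
  "lam = (SOME l. 1 < l \<and> 2 * (\<Sum>t=2..n. (1 / l) ^ t) = 1)"

lemma lam: "1 < lam" "2 * (\<Sum>t=2..n. (1 / lam) ^ t) = 1"
proof -
  let ?f = "\<lambda>z::real. 2 * (\<Sum>t=2..n. z ^ t)"
  have f0: "?f 0 = 0" by (simp add: zero_power)
  have f1: "?f 1 > 1" using n by simp
  \<comment> \<open>The unknown is \<open>z = 1 / lam\<close>; the left side is \<open>0\<close> at
    \<open>z = 0\<close> and \<open>2 * (n - 1)\<close> at \<open>z = 1\<close>.\<close>
  have "\<exists>z. 0 \<le> z \<and> z \<le> 1 \<and> ?f z = 1"
    by (rule IVT') (use f0 f1 in \<open>auto intro!: continuous_intros\<close>)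
  then obtain z where z: "0 \<le> z" "z \<le> 1" "?f z = 1" by blast
  have z': "0 < z" "z < 1" using z f0 f1 by (auto simp: less_le)
  have "1 < 1 / z \<and> ?f (1 / (1 / z)) = 1" using z' z(3) by simp
  then have "1 < lam \<and> 2 * (\<Sum>t=2..n. (1 / lam) ^ t) = 1"
    unfolding lam_def by (rule someI)
  then show "1 < lam" "2 * (\<Sum>t=2..n. (1 / lam) ^ t) = 1" by auto
qed

text \<open>The total weight of the two continuations on an exceptional orbit. The terms
  \<open>t = 2\<close> and \<open>t = 3\<close> alone give
  \<open>2 * (z ^ 2 + z ^ 3) \<le> 1\<close>, which forces \<open>z < 0.6\<close>, and
  \<open>0.6 + 0.6 ^ 3 = 0.816\<close>.\<close>

lemma lam_exc: "1 / lam + (1 / lam) ^ n < 1"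
proof -
  define z where "z = 1 / lam"
  have z: "0 < z" "z < 1" using lam by (auto simp: z_def)
  have "(\<Sum>t\<in>{2, 3}. z ^ t) \<le> (\<Sum>t=2..n. z ^ t)" using n z by (intro sum_mono2) auto
  then have *: "2 * (z ^ 2 + z ^ 3) \<le> 1" using lam(2) by (simp add: z_def)
  have "z < 6 / 10"
  proof (rule ccontr)
    assume "\<not> z < 6 / 10"
    then have "(6 / 10) ^ 2 \<le> z ^ 2" "(6 / 10) ^ 3 \<le> z ^ 3" by (auto intro: power_mono)
    then show False using * by (simp add: power2_eq_square power3_eq_cube)
  qed
  moreover from this have "z ^ 3 \<le> (6 / 10) ^ 3" using z by (intro power_mono) auto
  moreover have "z ^ n \<le> z ^ 3" using n z by (intro power_decreasing) auto
  ultimately show ?thesis by (simp add: z_def[symmetric] power3_eq_cube)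
qed

lemma D_flip: "e - x \<in> D \<longleftrightarrow> x \<in> D"
proof -
  have "e - y \<in> D" if "y \<in> D" for y using that by (auto simp: D_def)
  from this[of x] this[of "e - x"] show ?thesis by auto
qed

lemma D_cases:
  assumes "x \<in> D" shows "c \<le> x \<and> x \<le> a \<or> b \<le> x \<and> x \<le> e - c"
proof -
  have "c \<le> a / \<beta> ^ j \<and> a / \<beta> ^ j \<le> a" if "j \<le> n - 1" for j
  proof
    show "c \<le> a / \<beta> ^ j" unfolding c_def using a_pos \<beta>1 that by (intro divide_left_mono power_increasing) auto
    show "a / \<beta> ^ j \<le> a" using a_pos \<beta>1 by (simp add: divide_le_eq)
  qed
  then show ?thesis using assms e_a unfolding D_def by force
qed

lemma a_D: "a \<in> D" unfolding D_def by (rule UnI1, rule image_eqI[of _ _ 0]) auto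
lemma b_D: "b \<in> D" using a_D D_flip[of a] e_a by simp

lemma D_S: "snd z \<in> D \<Longrightarrow> z \<in> S \<Longrightarrow> snd z = a \<or> snd z = b"
  using D_cases[of "snd z"] by (auto simp: S_eq)

text \<open>\<open>a\<close> goes to \<open>b\<close> or \<open>c\<close> according to the digit,
  and every other \<open>a / \<beta> ^ j\<close> moves up one step; the symmetry does the
  rest.\<close>

lemma D_K: "snd z \<in> D \<Longrightarrow> snd (K z) \<in> D"
proof -
  have *: "snd (K (\<omega>, a / \<beta> ^ j)) \<in> D" if j: "j \<le> n - 1" for \<omega> j
  proof (cases j)
    case 0
    have "c \<in> D" unfolding D_def c_def by auto
    moreover have "b - 1 = c" by (simp add: c_eq b_eq)
    ultimately show ?thesis using 0 a_less_b b_D by (auto simp: K_S b_eq[symmetric])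
  next
    case (Suc i)
    have "a / \<beta> ^ j < a" using a_pos \<beta>1 Suc by (simp add: divide_less_eq one_less_power del: power_Suc)
    then have "snd (K (\<omega>, a / \<beta> ^ j)) = a / \<beta> ^ i" using \<beta>1 by (simp add: K_L Suc)
    moreover have "i \<in> {..n - 1}" using Suc j by simp
    ultimately show ?thesis unfolding D_def by blast
  qed
  assume "snd z \<in> D"
  then obtain j where j: "j \<le> n - 1" and "snd z = a / \<beta> ^ j \<or> snd z = e - a / \<beta> ^ j"
    unfolding D_def by blast
  then show ?thesis
  proof (elim disjE)
    assume "snd z = a / \<beta> ^ j"
    then show ?thesis using *[OF j, of "fst z"] by (cases z) auto
  next
    assume "snd z = e - a / \<beta> ^ j"
    then have "flip z = (\<lambda>i. \<not> fst z i, a / \<beta> ^ j)" by (cases z) (simp add: flip_def)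
    then have "snd (flip (K z)) \<in> D" using *[OF j] by (simp add: K_flip[symmetric])
    moreover have "snd (flip (K z)) = e - snd (K z)" by (cases "K z") (simp add: flip_def)
    ultimately show ?thesis by (simp add: D_flip)
  qed
qed

lemma u_a: "u (\<omega>, a) = (if \<omega> 0 then n else 1)"
proof (cases "\<omega> 0")
  case True
  have S: "(\<omega>, a) \<in> S" using a_less_b by (simp add: mem_S)
  have K: "K (\<omega>, a) = (left_shift \<omega>, c)" using True a_less_b by (simp add: K_S c_eq)
  have "u (left_shift \<omega>, c) = n - 1"
    by (rule hit_L(1)) (use c_power a_less_b n in auto)
  moreover have "K (\<omega>, a) \<notin> S" using c_less_a by (simp add: K mem_S)
  ultimately show ?thesis using u_step'[OF _ S_core[OF S]] True n by (simp add: K)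
next
  case False
  then show ?thesis using induced_right(2)[of \<omega> a] a_less_b by (simp add: mem_S)
qed

lemma u_b: "u (\<omega>, b) = (if \<omega> 0 then 1 else n)"
proof -
  have "flip (\<omega>, b) = (\<lambda>i. \<not> \<omega> i, a)" using e_a by (simp add: flip_def)
  then show ?thesis using u_flip[of "(\<omega>, b)"] u_a[of "\<lambda>i. \<not> \<omega> i"] by (auto split: if_splits)
qed

lemma u_main: "z \<in> S \<Longrightarrow> snd z \<notin> D \<Longrightarrow> 2 \<le> u z \<and> u z \<le> n"
proof -
  assume z: "z \<in> S" "snd z \<notin> D"
  have "u z \<noteq> 1"
    using induced_left(2)[of "fst z" "snd z"] induced_right(2)[of "fst z" "snd z"] z a_D b_D
    by (cases "fst z 0") auto
  then show ?thesis using u_core(1,2)[OF S_core[OF z(1)]] by simp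
qed

text \<open>A point travelling on the left enters the switch region below \<open>b\<close>, and on
  \<open>D\<close> this leaves only \<open>a\<close>; symmetrically on the right.\<close>

lemma nxt_sd:
  assumes z: "z \<in> core"
  shows "K z \<notin> S \<Longrightarrow> sd (K z) = nxt (sd z)"
    and "K z \<in> S \<Longrightarrow> snd z \<in> D \<Longrightarrow> snd (K z) = (if nxt (sd z) = L then a else b)"
proof -
  obtain \<omega> x where zx: "z = (\<omega>, x)" by (cases z)
  have x: "c \<le> x" "x \<le> e - c" using z by (auto simp: zx mem_core)
  have "if nxt (sd z) = L then nxt (sd z) = L \<and> snd (K z) < b else nxt (sd z) = R \<and> a < snd (K z)"
  proof -
    consider "x < a" | "a \<le> x" "x \<le> b" "\<omega> 0" | "a \<le> x" "x \<le> b" "\<not> \<omega> 0" | "b < x" by linarith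
    then show ?thesis
    proof cases
      case 1
      then have "\<beta> * x < b" using \<beta>1 by (simp add: b_eq)
      then show ?thesis using 1 by (simp add: zx sd_def K_L)
    next
      case 2
      then have "\<beta> * x \<le> \<beta> * b" using \<beta>1 by simp
      then show ?thesis using 2 \<beta>b a_less_b by (simp add: zx sd_def K_S)
    next
      case 3
      then have "\<beta> * a \<le> \<beta> * x" using \<beta>1 by simp
      then show ?thesis using 3 a_less_b by (simp add: zx sd_def K_S b_eq[symmetric])
    next
      case 4
      then have "\<beta> * b < \<beta> * x" using \<beta>1 by simp
      then show ?thesis using 4 \<beta>b a_less_b by (simp add: zx sd_def K_R)
    qed
  qed
  note key = this
  show "sd (K z) = nxt (sd z)" if "K z \<notin> S"
    using key that by (auto simp: S_eq sd_def[of "K z"] split: if_splits)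
  show "snd (K z) = (if nxt (sd z) = L then a else b)" if "K z \<in> S" "snd z \<in> D"
    using key D_S[OF D_K[OF that(2)] that(1)] by (auto split: if_splits)
qed

text \<open>At \<open>k = 1\<close> the next step enters the switch region: at \<open>a\<close> or
  \<open>b\<close> if \<open>d\<close> holds, with the return times of \<open>u_a\<close> and
  \<open>u_b\<close>, otherwise with any label. Wandering states, \<open>k = 0\<close>, get no
  successor; they have probability zero.\<close>

definition succs :: "side \<times> bool \<times> nat \<times> 'c option \<Rightarrow> (side \<times> bool \<times> nat \<times> 'c option) set" where
  "succs = (\<lambda>(q, d, k, l).
     if l \<noteq> None then {(q, d, k, l)} else if k = 0 then {}
     else if k = 1 then
       (if d then
          (if nxt q = L then {(Sw False, True, 1, None), (Sw True, True, n, None)}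
           else {(Sw False, True, n, None), (Sw True, True, 1, None)})
        else (\<lambda>(q, t). (Sw q, False, t, None)) ` (UNIV \<times> {2..n}))
     else {(nxt q, d, k - 1, None)})"

text \<open>The cost is \<open>0\<close> on the fixed points, where \<open>K\<close> is the identity
  and creates no entropy. This makes the bound strict when \<open>F\<close> has mass.\<close>

definition kap :: "side \<times> bool \<times> nat \<times> 'c option \<Rightarrow> real" where
  "kap = (\<lambda>(q, d, k, l). if l = None then ln lam else 0)"

text \<open>This potential moves the cost of all \<open>t\<close> steps of a return to the moment of
  entry: an entry gets weight \<open>(1 / lam) ^ t\<close>, and waiting is free.\<close>

definition pot :: "side \<times> bool \<times> nat \<times> 'c option \<Rightarrow> real" where
  "pot = (\<lambda>(q, d, k, l). - real k * ln lam)"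

lemma wt_1: "exp (- real t * ln lam) = (1 / lam) ^ t"
proof -
  have "exp (- real t * ln lam) = exp (- ln lam) ^ t"
    using exp_of_nat_mult[of t "- ln lam"] by simp
  then show ?thesis using lam(1) by (simp add: exp_minus inverse_eq_divide)
qed

lemma wt_entry: "exp (pot (q', d', t, None) - pot (q, d, 1, None) - kap (q, d, 1, None)) = (1 / lam) ^ t"
  using wt_1[of t] by (simp add: pot_def kap_def)

lemma wt_wait: "1 \<le> k \<Longrightarrow> exp (pot (q', d', k - 1, None) - pot (q, d, k, None) - kap (q, d, k, None)) = 1"
  by (simp add: pot_def kap_def of_nat_diff algebra_simps)

lemma sum_main: "(\<Sum>j\<in>(\<lambda>(q, t). (Sw q, False, t, None)) ` (UNIV \<times> {2..n}). f j) =
    (\<Sum>q\<in>UNIV. \<Sum>t=2..n. f (Sw q, False, t, None))"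
  by (subst sum.reindex) (auto simp: inj_on_def sum.cartesian_product intro!: sum.cong)

lemma finite_succs: "finite (succs i)"
  by (cases i) (auto simp: succs_def)

lemma sum_exc:
  assumes "d" shows "(\<Sum>j\<in>succs (q, d, 1, None). exp (pot j - pot (q, d, 1, None) - kap (q, d, 1, None))) < 1"
  using lam_exc assms by (simp add: succs_def wt_entry del: One_nat_def)

lemma sum_succs: "(\<Sum>j\<in>succs i. exp (pot j - pot i - kap i)) \<le> 1"
proof -
  obtain q d k l where i: "i = (q, d, k, l)" by (cases i)
  consider "l \<noteq> None" | "l = None" "k = 0" | "l = None" "k = 1" "d" | "l = None" "k = 1" "\<not> d" | "l = None" "2 \<le> k"
    by linarith
  then show ?thesis
  proof cases
    case 3
    then show ?thesis unfolding i by (simp only: less_imp_le[OF sum_exc])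
  next
    case 4
    then have i': "i = (q, d, 1, None)" by (simp add: i)
    have eq: "succs i = (\<lambda>(q, t). (Sw q, False, t, None)) ` (UNIV \<times> {2..n})" using 4 by (simp add: i succs_def)
    have "(\<Sum>j\<in>succs i. exp (pot j - pot i - kap i)) = (\<Sum>q\<in>(UNIV::bool set). \<Sum>t=2..n. (1 / lam) ^ t)"
      unfolding eq sum_main unfolding i' wt_entry ..
    also have "\<dots> = 1" using lam(2) by simp
    finally show ?thesis by simp
  next
    case 5
    then have "exp (pot (nxt q, d, k - 1, l) - pot (q, d, k, l) - kap (q, d, k, l)) = 1"
      by (simp only:) (rule wt_wait, simp)
    moreover have "succs i = {(nxt q, d, k - 1, l)}" using 5 by (simp add: i succs_def)
    ultimately show ?thesis unfolding i by simp
  qed (auto simp: i succs_def pot_def kap_def)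
qed

lemma F_core: "z \<in> F \<Longrightarrow> z \<notin> core"
  using c_pos by (auto simp: F_def core_def)

text \<open>The hypothesis on \<open>D\<close> excludes points that fall onto an exceptional orbit
  from outside, a null event by invariance. What remains has a constant flag along its
  orbit.\<close>

lemma st_succ:
  assumes z: "z \<in> core \<union> F" and D: "snd (K z) \<in> D \<longrightarrow> snd z \<in> D"
  shows "st g (K z) \<in> succs (st g z)"
proof (cases "z \<in> F")
  case True
  then show ?thesis by (simp add: F_K succs_def st_def)
next
  case False
  then have z: "z \<in> core" and Kz: "K z \<in> core" "K z \<notin> F"
    using assms core_K[of z] F_core[of "K z"] by auto
  have DD: "snd (K z) \<in> D \<longleftrightarrow> snd z \<in> D" using D D_K[of z] by auto
  have st: "st g z = (sd z, snd z \<in> D, u z, None)" "st g (K z) = (sd (K z), snd z \<in> D, u (K z), None)"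
    using z Kz False by (simp_all add: st_def DD)
  have u: "1 \<le> u z" by (rule u_core(1)[OF z])
  show ?thesis
  proof (cases "u z = 1")
    case False
    then show ?thesis
      using u u_step[OF z False] nxt_sd(1)[OF z] by (simp add: st succs_def)
  next
    case True
    then have S: "K z \<in> S" using u_eq_1[OF z] by simp
    then have sdK: "sd (K z) = Sw (fst (K z) 0)" by (auto simp: sd_def S_eq)
    show ?thesis
    proof (cases "snd z \<in> D")
      case True
      obtain \<omega>' x' where Kz': "K z = (\<omega>', x')" by (cases "K z")
      have "x' = (if nxt (sd z) = L then a else b)" using nxt_sd(2)[OF z S True] by (simp add: Kz')
      then have "u (K z) = (if nxt (sd z) = L then if fst (K z) 0 then n else 1 else if fst (K z) 0 then 1 else n)"
        by (simp add: Kz' u_a u_b)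
      then show ?thesis using True \<open>u z = 1\<close> by (auto simp: st succs_def sdK)
    next
      case False
      then have "2 \<le> u (K z) \<and> u (K z) \<le> n" using u_main[OF S] DD by simp
      then show ?thesis using False \<open>u z = 1\<close> by (auto simp: st succs_def sdK image_iff)
    qed
  qed
qed

section \<open>The entropy bound for \<open>K\<close>\<close>

context
  fixes M assumes M: "M \<in> invariant_probs (phase_space \<beta>) K"
begin

lemma mptK: "mpt M K" and setsK: "sets M = sets (phase_space \<beta>)"
  using invariant_probsD[OF M] by auto

interpretation mpt M K by (rule mptK)

lemma spaceK: "space M = UNIV \<times> {0..e}"
  using sets_eq_imp_space_eq[OF setsK] space_phase by simp

lemma sets_sndK:
  assumes "B \<in> sets borel" shows "{z\<in>space M. snd z \<in> B} \<in> sets M"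
  using measurable_sets[OF snd_phase assms] sets_eq_imp_space_eq[OF setsK]
  by (simp add: setsK vimage_def Int_def conj_commute)

lemma F_sets: "F \<in> sets M"
proof -
  have "F = {z\<in>space M. snd z \<in> {0, e}}" using order_facts by (auto simp: F_def spaceK)
  then show ?thesis using sets_sndK[of "{0, e}"] by simp
qed

lemma AE_core: "AE z in M. z \<in> core \<union> F"
proof (rule AE_prob_1, rule prob_absorbing)
  have eq: "core \<union> F = {z\<in>space M. snd z \<in> {0, e} \<union> {c..e - c}}"
    using order_facts by (auto simp: F_def core_def spaceK)
  have "{0, e} \<union> {c..e - c} \<in> sets borel" by simp
  then show "core \<union> F \<in> sets M" unfolding eq by (rule sets_sndK)
  show "K z \<in> core \<union> F" if z: "z \<in> core \<union> F" for z
  proof (cases "z \<in> F")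
    case True
    show ?thesis unfolding F_K[OF True] by (rule z)
  next
    case False
    then have "z \<in> core" using z by blast
    then show ?thesis by (intro UnI1 core_K)
  qed
  show "\<exists>m. (K ^^ m) z \<in> core \<union> F" if z: "z \<in> space M" for z
  proof (cases "z \<in> F \<or> z \<in> S")
    case True
    then show ?thesis using S_core[of z] by (intro exI[of _ 0]) auto
  next
    case False
    obtain \<omega> x where zx: "z = (\<omega>, x)" by (cases z)
    have "0 < x" "x < e" using z False by (auto simp: zx F_def spaceK)
    then obtain k where "(K ^^ k) z \<in> S" using reach[of x \<omega>] False by (auto simp: zx)
    then show ?thesis using S_core by (intro exI[of _ k]) blast
  qed
qed

lemma AE_D: "AE z in M. snd (K z) \<in> D \<longrightarrow> snd z \<in> D"
proof -
  have "{z\<in>space M. snd z \<in> D} \<in> sets M" using D_finite by (intro sets_sndK borel_closed finite_imp_closed)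
  then have "AE z in M. K z \<in> {z\<in>space M. snd z \<in> D} \<longrightarrow> z \<in> {z\<in>space M. snd z \<in> D}"
    by (rule AE_not_entering) (use D_K T_space in auto)
  then show ?thesis
    by (rule AE_mp) (use T_space in \<open>auto intro!: AE_I2\<close>)
qed

lemma AE_succs: "AE z in M. st g (K z) \<in> succs (st g z)"
  using AE_core AE_D by eventually_elim (rule st_succ)

text \<open>The rows of the kernel sum to at most \<open>1\<close>, and the mean of
  \<open>kap\<close> is \<open>ln lam\<close> times the mass outside \<open>F\<close>.\<close>

lemma
  assumes g: "simple_function M g"
  shows K_rate_le: "entropy_rate M K (st g) \<le> ln lam * (1 - measure M F)"
    and K_rate_eq: "ln lam * (1 - measure M F) \<le> entropy_rate M K (st g) \<Longrightarrow> w \<noteq> [] \<Longrightarrow>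
      law M (word K (st g) (Suc (length w))) (w @ [j]) = law M (word K (st g) (length w)) w *
        (if j \<in> succs (last w) then exp (pot j - pot (last w) - kap (last w)) else 0)"
proof -
  have s: "simple_function M (st g)" by (rule simple_st[OF setsK g])
  have ssT: "simple_function M (\<lambda>z. (st g z, st g (K z)))"
    using s simple_T[OF s] by (rule simple_function_Pair)
  have N: "j \<in> succs i" if "0 < law M (\<lambda>z. (st g z, st g (K z))) (i, j)" for i j
    using law_posE[OF ssT that AE_succs] by auto
  have int: "(\<integral>z. kap (st g z) \<partial>M) = ln lam * (1 - measure M F)"
  proof -
    have "(\<integral>z. kap (st g z) \<partial>M) = (\<integral>z. ln lam * (1 - indicator F z) \<partial>M)"
      by (intro Bochner_Integration.integral_cong) (auto simp: kap_def st_def indicator_def)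
    also have "\<dots> = ln lam * (1 - measure M F)"
      using F_sets by (simp add: prob_space emeasure_eq_measure)
    finally show ?thesis .
  qed
  show "entropy_rate M K (st g) \<le> ln lam * (1 - measure M F)"
    using markov_entropy_le[OF s finite_succs N sum_succs] by (simp add: int)
  assume "ln lam * (1 - measure M F) \<le> entropy_rate M K (st g)" "w \<noteq> []"
  then show "law M (word K (st g) (Suc (length w))) (w @ [j]) = law M (word K (st g) (length w)) w *
        (if j \<in> succs (last w) then exp (pot j - pot (last w) - kap (last w)) else 0)"
    by (intro markov_entropy_eq[OF s finite_succs N sum_succs]) (simp_all add: int)
qed

text \<open>With \<open>p\<close> itself as the label on \<open>F\<close>, the states determine
  \<open>p\<close> exactly: off \<open>F\<close> through the itinerary, on \<open>F\<close> through
  the label at time \<open>0\<close>.\<close>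

lemma K_rate_arbitrary:
  assumes p: "simple_function M p"
  shows "entropy_rate M K p \<le> entropy_rate M K (st p)"
proof (rule entropy_rate_le_generator[OF p simple_st[OF setsK p]])
  fix v
  let ?A = "p -` {v} \<inter> space M"
  interpret G: sigma_algebra "space M" "itin_sets M K (st p)" by (rule sigma_algebra_itin)
  have "?A - F \<in> itin_sets M K (st p)" by (rule generator_K[OF mptK setsK law_sets[OF p]])
  moreover have eq: "?A \<inter> F = word K (st p) 1 -` {w. snd (snd (snd (w ! 0))) = Some v} \<inter> space M"
    by (auto simp: nth_word st_def split: if_splits)
  have "?A \<inter> F \<in> itin_sets M K (st p)" unfolding eq by (rule itin_sets_word)
  ultimately have "(?A - F) \<union> (?A \<inter> F) \<in> itin_sets M K (st p)" by (rule G.Un)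
  moreover have "(?A - F) \<union> (?A \<inter> F) = ?A" by auto
  ultimately have "?A \<in> itin_sets M K (st p)" by (simp only:)
  then show "\<exists>A\<in>itin_sets M K (st p). prob (sym_diff ?A A) = 0" by (intro bexI[of _ ?A]) simp_all
qed

lemma K_rate_arbitrary':
  assumes p: "simple_function M p" and F: "measure M F = 0"
  shows "entropy_rate M K p \<le> entropy_rate M K (st (\<lambda>_. ()))"
proof (rule entropy_rate_le_generator[OF p simple_st[OF setsK]])
  fix v
  let ?A = "p -` {v} \<inter> space M"
  have A: "?A \<in> sets M" by (rule law_sets[OF p])
  have "sym_diff ?A (?A - F) \<subseteq> F" by auto
  then have "prob (sym_diff ?A (?A - F)) \<le> measure M F" by (rule finite_measure_mono) (rule F_sets)
  then have "prob (sym_diff ?A (?A - F)) = 0" using F measure_nonneg[of M "sym_diff ?A (?A - F)"] by simp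
  then show "\<exists>A\<in>itin_sets M K (st (\<lambda>_. ())). prob (sym_diff ?A A) = 0"
    using generator_K[OF mptK setsK A] by blast
qed simp

lemma K_ks_le': "ks_entropy M K \<le> ereal (ln lam * (1 - measure M F))"
  using K_rate_arbitrary K_rate_le by (intro ks_entropy_le) (rule order_trans)

lemma ln_lam: "0 < ln lam" using lam by simp

lemma K_ks_le: "ks_entropy M K \<le> ereal (ln lam)"
proof -
  have "ln lam * (1 - measure M F) \<le> ln lam * 1" using ln_lam by (intro mult_left_mono) auto
  then show ?thesis using K_ks_le' by (simp add: order_trans)
qed

text \<open>Mass on \<open>F\<close> would lower the bound, so there is none. Then the unlabelled
  states attain the bound, and the equality case of the Markov bound applies.\<close>

lemma
  assumes max: "ereal (ln lam) \<le> ks_entropy M K"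
  shows F_null: "measure M F = 0"
    and K_markov: "w \<noteq> [] \<Longrightarrow>
      law M (word K (st (\<lambda>_. ())) (Suc (length w))) (w @ [j]) = law M (word K (st (\<lambda>_. ())) (length w)) w *
        (if j \<in> succs (last w) then exp (pot j - pot (last w) - kap (last w)) else 0)"
proof -
  have "ln lam \<le> ln lam * (1 - measure M F)"
    using order_trans[OF max K_ks_le'] by simp
  then show F: "measure M F = 0" using ln_lam measure_nonneg[of M F] by (simp add: algebra_simps mult_le_0_iff)
  have "ks_entropy M K \<le> ereal (entropy_rate M K (st (\<lambda>_. ())))"
    by (intro ks_entropy_le K_rate_arbitrary'[OF _ F])
  with max have "ln lam \<le> entropy_rate M K (st (\<lambda>_. ()))" by (metis ereal_less_eq(3) order_trans)
  then show "w \<noteq> [] \<Longrightarrow>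
      law M (word K (st (\<lambda>_. ())) (Suc (length w))) (w @ [j]) = law M (word K (st (\<lambda>_. ())) (length w)) w *
        (if j \<in> succs (last w) then exp (pot j - pot (last w) - kap (last w)) else 0)"
    by (intro K_rate_eq) (simp_all add: F)
qed

end

end

section \<open>Stationary Markov laws\<close>

lemma law_word_1: "law M (word T s (Suc 0)) [i] = law M s i"
  unfolding law_def by (intro arg_cong[where f="measure M"]) (auto simp: word_def)

text \<open>For a Markov law, the first equation is the balance of flow into a state. The second
  conserves mass out of it, and so kills every state whose row sums to less than
  \<open>1\<close>.\<close>

lemma (in mpt) law_stationary:
  assumes s: "simple_function M s"
  shows "law M s j = (\<Sum>i\<in>s ` space M. law M (word T s (Suc (Suc 0))) [i, j])"
    and "law M s i = (\<Sum>j\<in>s ` space M. law M (word T s (Suc (Suc 0))) [i, j])"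
proof -
  have fin: "finite (s ` space M)" by (rule simple_functionD(1)[OF s])
  have "law M s j = law M (\<lambda>z. s (T z)) j" by (rule law_T[OF s, symmetric])
  also have "\<dots> = (\<Sum>i\<in>s ` space M. law M (\<lambda>z. (s (T z), s z)) (j, i))"
    by (rule law_marginal[OF simple_T[OF s] s fin order_refl])
  also have "\<dots> = (\<Sum>i\<in>s ` space M. law M (word T s (Suc (Suc 0))) [i, j])"
    unfolding law_def by (intro sum.cong refl arg_cong[where f="measure M"]) (auto simp: word_Suc)
  finally show "law M s j = (\<Sum>i\<in>s ` space M. law M (word T s (Suc (Suc 0))) [i, j])" .
  have "law M s i = (\<Sum>j\<in>s ` space M. law M (\<lambda>z. (s z, s (T z))) (i, j))"
    using T_space by (intro law_marginal[OF s simple_T[OF s] fin]) auto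
  also have "\<dots> = (\<Sum>j\<in>s ` space M. law M (word T s (Suc (Suc 0))) [i, j])"
    unfolding law_def by (intro sum.cong refl arg_cong[where f="measure M"]) (auto simp: word_Suc)
  finally show "law M s i = (\<Sum>j\<in>s ` space M. law M (word T s (Suc (Suc 0))) [i, j])" .
qed

lemma sum_law_restrict:
  assumes "finite Q" "finite B" "X ` space M \<subseteq> Q"
  shows "(\<Sum>i\<in>Q. law M X i * (if i \<in> B then c else 0)) = c * (\<Sum>i\<in>B. law M X i)"
proof -
  have "(\<Sum>i\<in>Q. law M X i * (if i \<in> B then c else 0)) = (\<Sum>i\<in>Q \<inter> B. law M X i * c)"
    using assms(1) by (simp add: sum.inter_restrict if_distrib cong: if_cong)
  also have "\<dots> = (\<Sum>i\<in>B. law M X i * c)"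
  proof (intro sum.mono_neutral_left assms ballI)
    fix i assume "i \<in> B - Q \<inter> B"
    then have "i \<notin> X ` space M" using assms(3) by blast
    then show "law M X i * c = 0" by (simp add: law_outside)
  qed auto
  finally show ?thesis by (simp add: sum_distrib_left mult.commute)
qed

text \<open>The law of one letter and the common kernel \<open>r\<close> determine all words; words
  determine the itinerary events, and these are all events up to the null set
  \<open>F\<close>.\<close>

lemma mpt_eqI_markov:
  assumes M: "mpt M T" and M': "mpt M' T" and sets: "sets M' = sets M"
    and s: "simple_function M s"
    and single: "\<And>i. law M s i = law M' s i"
    and markov: "\<And>w j. w \<noteq> [] \<Longrightarrow> law M (word T s (Suc (length w))) (w @ [j]) = law M (word T s (length w)) w * r (last w) j"
      "\<And>w j. w \<noteq> [] \<Longrightarrow> law M' (word T s (Suc (length w))) (w @ [j]) = law M' (word T s (length w)) w * r (last w) j"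
    and gen: "\<And>A. A \<in> sets M \<Longrightarrow> A - F \<in> itin_sets M T s"
    and F: "F \<in> sets M" "measure M F = 0" "measure M' F = 0"
  shows "M = M'"
proof -
  interpret M: mpt M T by fact
  interpret M': mpt M' T by fact
  have space: "space M' = space M" by (rule sets_eq_imp_space_eq[OF sets])
  have eq: "law M (word T s (length w)) w = law M' (word T s (length w)) w" for w
  proof (induction w rule: rev_induct)
    case Nil
    have "(\<lambda>z. []) -` {[]} \<inter> space N = space N" for N :: "'a measure" by auto
    then show ?case by (simp add: law_def word_0[abs_def] M.prob_space M'.prob_space)
  next
    case (snoc j w)
    show ?case
    proof (cases "w = []")
      case True
      then show ?thesis using single by (simp add: law_word_1)
    next
      case False
      then show ?thesis using markov[OF False, of j] snoc by simp
    qed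
  qed
  have eq': "law M (word T s m) w = law M' (word T s m) w" for m w
  proof (cases "length w = m")
    case False
    then have "w \<notin> word T s m ` space N" for N by auto
    then show ?thesis by (simp add: law_outside)
  qed (use eq in blast)
  have m: "measure M A = measure M' A" if A: "A \<in> sets M" for A
  proof -
    have "measure N A = measure N (A - F)" if "mpt N T" "sets N = sets M" "measure N F = 0" for N
    proof -
      interpret N: mpt N T by fact
      have "N.prob A \<le> N.prob ((A - F) \<union> F)" using A F that by (intro N.finite_measure_mono) auto
      also have "\<dots> \<le> N.prob (A - F) + N.prob F" using A F that by (intro measure_Un_le) auto
      finally have "N.prob A \<le> N.prob (A - F)" using that by simp
      moreover have "N.prob (A - F) \<le> N.prob A" using A that by (intro N.finite_measure_mono) auto
      ultimately show ?thesis by simp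
    qed
    from this[OF M refl F(2)] this[OF M' sets F(3)] itin_sets_unique[OF M M' sets s eq' gen[OF A]]
    show ?thesis by simp
  qed
  show ?thesis
    by (rule measure_eqI) (simp_all add: sets M.emeasure_eq_measure M'.emeasure_eq_measure m)
qed

section \<open>The law of the states at maximal entropy, and uniqueness for \<open>K\<close>\<close>

context shrinking_beta begin

abbreviation "s0 \<equiv> st (\<lambda>_. ())"

definition wt :: "side \<times> bool \<times> nat \<times> 'c option \<Rightarrow> side \<times> bool \<times> nat \<times> 'c option \<Rightarrow> real" where
  "wt i j = (if j \<in> succs i then exp (pot j - pot i - kap i) else 0)"

text \<open>The stationary vector of the kernel, scaled to one entry per unit of time. A waiting
  state with \<open>k\<close> steps to go collects all returns longer than \<open>k\<close>.\<close>

definition gam :: "side \<times> bool \<times> nat \<times> unit option \<Rightarrow> real" where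
  "gam = (\<lambda>(q, d, k, l). if l \<noteq> None \<or> d \<or> k = 0 then 0
     else if \<exists>q'. q = Sw q' then (if 2 \<le> k \<and> k \<le> n then (1 / lam) ^ k else 0)
     else (\<Sum>t=Suc k..n. (1 / lam) ^ t))"

definition "Gam = (\<Sum>i\<in>s0 ` (UNIV \<times> {0..e}). gam i)"

context
  fixes M assumes M: "M \<in> invariant_probs (phase_space \<beta>) K" and max: "ereal (ln lam) \<le> ks_entropy M K"
begin

interpretation mpt M K by (rule mptK[OF M])

lemma s0: "simple_function M s0"
  by (rule simple_st[OF setsK[OF M]]) simp

lemma law2: "law M (word K s0 (Suc (Suc 0))) [i, j] = law M s0 i * wt i j"
  using K_markov[OF M max, of "[i]" j] by (simp add: law_word_1 wt_def)

lemma law_F: "l \<noteq> None \<Longrightarrow> law M s0 (q, d, k, l) = 0"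
proof (rule ccontr)
  assume l: "l \<noteq> None" and "law M s0 (q, d, k, l) \<noteq> 0"
  then have "0 < law M s0 (q, d, k, l)" by (simp add: less_le)
  moreover have "AE z in M. z \<notin> F" using F_sets[OF M] F_null[OF M max] by (simp add: prob_eq_0)
  ultimately obtain z where "s0 z = (q, d, k, l)" "z \<notin> F" by (rule law_posE[OF s0])
  then show False using l by (simp add: st_def)
qed

lemma law_wandering: "law M s0 (q, d, 0, None) = 0"
proof (rule ccontr)
  assume "law M s0 (q, d, 0, None) \<noteq> 0"
  then have "0 < law M s0 (q, d, 0, None)" by (simp add: less_le)
  then obtain z where "s0 z = (q, d, 0, None)" "z \<in> core \<union> F"
    using AE_core[OF M] by (rule law_posE[OF s0])
  then show False using u_core(1)[of z] by (auto simp: st_def split: if_splits)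
qed

text \<open>At \<open>k = 1\<close> the row sums to less than \<open>1\<close>, while a stationary
  law loses no mass, so this state is null. A state with larger \<open>k\<close> hands all its mass
  to the state with one step less.\<close>

lemma law_exc: "law M s0 (q, True, k, None) = 0"
proof (induction k arbitrary: q)
  case 0
  show ?case by (rule law_wandering)
next
  case (Suc k)
  let ?i = "(q, True, Suc k, None :: unit option)"
  show ?case
  proof (cases "k = 0")
    case True
    have fin: "finite (s0 ` space M)" by (rule simple_functionD(1)[OF s0])
    have "law M s0 ?i = law M s0 ?i * (\<Sum>j\<in>s0 ` space M. wt ?i j)"
      using law_stationary(2)[OF s0, of ?i] by (simp add: law2 sum_distrib_left)
    moreover have "(\<Sum>j\<in>s0 ` space M. wt ?i j) < 1"
    proof -
      have "(\<Sum>j\<in>s0 ` space M. wt ?i j) = (\<Sum>j\<in>s0 ` space M \<inter> succs ?i. exp (pot j - pot ?i - kap ?i))"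
        using fin by (simp add: wt_def sum.inter_restrict)
      also have "\<dots> \<le> (\<Sum>j\<in>succs ?i. exp (pot j - pot ?i - kap ?i))"
        using finite_succs by (intro sum_mono2) auto
      also have "\<dots> < 1" unfolding True by (rule sum_exc[unfolded One_nat_def]) simp
      finally show ?thesis .
    qed
    ultimately show ?thesis by (metis less_irrefl mult_cancel_left1)
  next
    case False
    let ?j = "(nxt q, True, k, None :: unit option)"
    have "wt ?i ?j = 1" using False wt_wait[of "Suc k"] by (simp add: wt_def succs_def)
    then have "law M s0 ?i = law M (word K s0 (Suc (Suc 0))) [?i, ?j]" by (simp add: law2)
    also have "\<dots> \<le> law M (\<lambda>z. s0 (K z)) ?j"
      unfolding law_def using law_sets[OF simple_T[OF s0]]
      by (intro finite_measure_mono) (auto simp: word_Suc)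
    also have "\<dots> = 0" by (simp add: law_T[OF s0] Suc)
    finally show ?thesis using law_nonneg[of M s0 ?i] by simp
  qed
qed

text \<open>The mass one step before the switch region, that is, the frequency of entries.\<close>

definition entry :: real where
  "entry = (\<Sum>i\<in>s0 ` space M \<inter> {i. \<exists>q. i = (q, False, 1, None)}. law M s0 i)"

text \<open>All predecessors have time \<open>1\<close> and pass on the same fraction
  \<open>(1 / lam) ^ t\<close>, so the label is independent of the past.\<close>

lemma law_Sw: "law M s0 (Sw q, False, t, None) = entry * (if 2 \<le> t \<and> t \<le> n then (1 / lam) ^ t else 0)"
proof -
  let ?j = "(Sw q, False, t, None :: unit option)"
  let ?B = "s0 ` space M \<inter> {i. \<exists>q. i = (q, False, 1, None)}"
  have fin: "finite (s0 ` space M)" by (rule simple_functionD(1)[OF s0])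
  have wt: "wt i ?j = (if i \<in> ?B then if 2 \<le> t \<and> t \<le> n then (1 / lam) ^ t else 0 else 0)" if R: "i \<in> s0 ` space M" for i
  proof -
    obtain q' d k l where i: "i = (q', d, k, l)" by (cases i)
    have "nxt q' \<noteq> Sw q" by (cases q' rule: nxt.cases) auto
    then show ?thesis using R wt_entry[of "Sw q" False t q' False]
      by (auto simp: i wt_def succs_def image_iff split: if_splits)
  qed
  have "law M s0 ?j = (\<Sum>i\<in>s0 ` space M. law M s0 i * wt i ?j)"
    using law_stationary(1)[OF s0, of ?j] by (simp add: law2)
  also have "\<dots> = (\<Sum>i\<in>s0 ` space M. law M s0 i * (if i \<in> ?B then if 2 \<le> t \<and> t \<le> n then (1 / lam) ^ t else 0 else 0))"
    by (intro sum.cong refl) (simp only: wt)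
  also have "\<dots> = (if 2 \<le> t \<and> t \<le> n then (1 / lam) ^ t else 0) * (\<Sum>i\<in>?B. law M s0 i)"
    by (rule sum_law_restrict) (use fin in auto)
  finally show ?thesis unfolding entry_def by (simp only: mult.commute)
qed

text \<open>The state is reached with weight \<open>1\<close> from the waiting state with one more
  step to go, or straight from the switch region. The truth value \<open>q = L\<close> is the digit
  that leads to the side \<open>q\<close>.\<close>

lemma law_wait_step:
  assumes q: "q = L \<or> q = R" and k: "1 \<le> k"
  shows "law M s0 (q, False, k, None) = law M s0 (q, False, Suc k, None) + law M s0 (Sw (q = L), False, Suc k, None)"
proof -
  let ?j = "(q, False, k, None :: unit option)"
  let ?B = "{(q, False, Suc k, None), (Sw (q = L), False, Suc k, None :: unit option)}"
  have fin: "finite (s0 ` space M)" by (rule simple_functionD(1)[OF s0])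
  have wt: "wt i ?j = (if i \<in> ?B then 1 else 0)" if l: "snd (snd (snd i)) = None" for i
  proof -
    obtain q' d k' where i: "i = (q', d, k', None)" using l by (cases i) auto
    have nq: "nxt q' = q \<longleftrightarrow> q' = q \<or> q' = Sw (q = L)"
      using q by (cases q' rule: nxt.cases) auto
    show ?thesis
    proof (cases "2 \<le> k'")
      case True
      then show ?thesis using k nq wt_wait[of k' q d q' d] by (auto simp: i wt_def succs_def)
    next
      case False
      then show ?thesis using q k by (auto simp: i wt_def succs_def)
    qed
  qed
  have "law M s0 ?j = (\<Sum>i\<in>s0 ` space M. law M s0 i * wt i ?j)"
    using law_stationary(1)[OF s0, of ?j] by (simp add: law2)
  also have "\<dots> = (\<Sum>i\<in>s0 ` space M. law M s0 i * (if i \<in> ?B then 1 else 0))"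
  proof (intro sum.cong refl)
    fix i
    show "law M s0 i * wt i ?j = law M s0 i * (if i \<in> ?B then 1 else 0)"
    proof (cases "snd (snd (snd i)) = None")
      case True
      then show ?thesis by (simp only: wt)
    next
      case False
      then have "law M s0 i = 0" using law_F by (cases i) auto
      then show ?thesis by simp
    qed
  qed
  also have "\<dots> = 1 * (\<Sum>i\<in>?B. law M s0 i)"
    by (rule sum_law_restrict) (use fin in auto)
  also have "\<dots> = law M s0 (q, False, Suc k, None) + law M s0 (Sw (q = L), False, Suc k, None)"
    using q by auto
  finally show ?thesis .
qed

text \<open>Downward induction on \<open>k\<close>. It starts at \<open>k \<ge> n\<close>, where no
  waiting state occurs because entry times from outside the switch region are at most
  \<open>n - 1\<close>; each step down adds the returns of length exactly
  \<open>Suc k\<close>.\<close>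

lemma law_wait:
  assumes q: "q = L \<or> q = R" and k: "1 \<le> k"
  shows "law M s0 (q, False, k, None) = entry * (\<Sum>t=Suc k..n. (1 / lam) ^ t)"
  using k
proof (induction "n - k" arbitrary: k)
  case 0
  have "s0 z \<noteq> (q, False, k, None)" for z
  proof
    assume *: "s0 z = (q, False, k, None)"
    then have core: "z \<in> core" using 0 by (auto simp: st_def split: if_splits)
    have "z \<notin> S" using * q sd_Sw[of z] by (auto simp: st_def)
    then show False using u_core(4)[OF core] * core 0 n by (simp add: st_def)
  qed
  then have "(q, False, k, None) \<notin> s0 ` space M" by (metis imageE)
  then show ?case using 0 by (simp add: law_outside)
next
  case (Suc m)
  have *: "law M s0 (q, False, Suc k, None) = entry * (\<Sum>t=Suc (Suc k)..n. (1 / lam) ^ t)"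
    by (rule Suc.hyps(1)) (use Suc in simp_all)
  have "(\<Sum>t=Suc k..n. (1 / lam) ^ t) = (1 / lam) ^ Suc k + (\<Sum>t=Suc (Suc k)..n. (1 / lam) ^ t)"
    using Suc.hyps(2) by (intro sum.atLeast_Suc_atMost) simp
  then show ?case
    using law_wait_step[OF q Suc.prems] law_Sw[of "q = L" "Suc k"] Suc by (simp add: * algebra_simps)
qed

lemma law_gam: "law M s0 i = entry * gam i"
proof -
  obtain q d k l where i: "i = (q, d, k, l)" by (cases i)
  consider "l \<noteq> None" | "l = None" "d" | "l = None" "\<not> d" "k = 0" | "l = None" "\<not> d" "1 \<le> k" "q = L \<or> q = R"
    | q' where "l = None" "\<not> d" "1 \<le> k" "q = Sw q'"
    by (cases q; cases l; cases d; cases k) auto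
  then show ?thesis
  proof cases
    case 1
    then show ?thesis using law_F by (simp add: i gam_def)
  next
    case 2
    then show ?thesis using law_exc by (simp add: i gam_def)
  next
    case 3
    then show ?thesis using law_wandering by (simp add: i gam_def)
  next
    case 4
    then show ?thesis using law_wait[OF 4(4,3)] by (auto simp: i gam_def)
  next
    case 5
    then show ?thesis using law_Sw[of q' k] by (auto simp: i gam_def)
  qed
qed

lemma entry: "entry = 1 / Gam" "0 < entry"
proof -
  have "(\<Sum>i\<in>s0 ` space M \<inter> UNIV. law M s0 i) = 1" unfolding sum_law[OF s0] by (simp add: prob_space)
  then have *: "entry * Gam = 1"
    by (simp add: law_gam sum_distrib_left[symmetric] Gam_def spaceK[OF M])
  then show "entry = 1 / Gam" by (metis mult_zero_right nonzero_eq_divide_eq zero_neq_one)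
  have "0 \<le> entry" unfolding entry_def by (intro sum_nonneg) simp
  then show "0 < entry" using * by (cases "entry = 0") auto
qed

end

lemma K_unique:
  assumes "M \<in> invariant_probs (phase_space \<beta>) K" "ereal (ln lam) \<le> ks_entropy M K"
    "M' \<in> invariant_probs (phase_space \<beta>) K" "ereal (ln lam) \<le> ks_entropy M' K"
  shows "M = M'"
proof (rule mpt_eqI_markov[where T=K and s=s0 and r=wt and F=F])
  show "mpt M K" "mpt M' K" using assms mptK by auto
  show "sets M' = sets M" using assms setsK by simp
  show "simple_function M s0" using assms by (intro s0)
  show "law M s0 i = law M' s0 i" for i
    using assms by (simp add: law_gam entry(1))
  show "law M (word K s0 (Suc (length w))) (w @ [j]) = law M (word K s0 (length w)) w * wt (last w) j" if "w \<noteq> []" for w j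
    unfolding wt_def by (rule K_markov[OF assms(1,2) that])
  show "law M' (word K s0 (Suc (length w))) (w @ [j]) = law M' (word K s0 (length w)) w * wt (last w) j" if "w \<noteq> []" for w j
    unfolding wt_def by (rule K_markov[OF assms(3,4) that])
  show "A - F \<in> itin_sets M K s0" if "A \<in> sets M" for A
    using assms that by (intro generator_K mptK setsK)
  show "F \<in> sets M" "measure M F = 0" "measure M' F = 0" using assms F_sets F_null by auto
qed

subsection \<open>The induced map\<close>

text \<open>If \<open>d\<close> holds, the digit \<open>q\<close> decides whether the next point is
  \<open>a\<close> or \<open>b\<close>, which leaves one return time for each next digit.\<close>

definition isuccs :: "bool \<times> bool \<times> nat \<Rightarrow> (bool \<times> bool \<times> nat) set" where
  "isuccs = (\<lambda>(q, d, t). if d then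
      (if q then {(False, True, 1), (True, True, n)} else {(False, True, n), (True, True, 1)})
    else (\<lambda>(q, t). (q, False, t)) ` (UNIV \<times> {2..n}))"

definition N0 :: real where "N0 = 2 * (real n - 1)"

lemma N0: "4 \<le> N0" using n by (simp add: N0_def)

lemma finite_isuccs: "finite (isuccs i)"
  by (cases i) (auto simp: isuccs_def)

lemma card_isuccs: "real (card (isuccs (q, d, t))) = (if d then 2 else N0)"
proof -
  have "card ((\<lambda>(q, t). (q, False, t)) ` ((UNIV :: bool set) \<times> {2..n})) = 2 * (n - 1)"
    by (subst card_image) (auto simp: inj_on_def)
  then show ?thesis using n by (auto simp: isuccs_def N0_def of_nat_diff)
qed

lemma ist_succ:
  assumes z: "z \<in> S" and D: "snd (I z) \<in> D \<longrightarrow> snd z \<in> D"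
  shows "ist (I z) \<in> isuccs (ist z)"
proof (cases "snd z \<in> D")
  case True
  obtain \<omega> x where zx: "z = (\<omega>, x)" by (cases z)
  have x: "x = a \<or> x = b" using D_S[OF True z] by (simp add: zx)
  have np: "\<beta> ^ (n - 1) * (\<beta> * a - 1) = a" using c_power by (simp add: c_eq)
  have eb: "e - b = a" using e_a by simp
  have "I z = (left_shift \<omega>, if \<omega> 0 then a else b)"
    using induced_left(1)[of \<omega> x] induced_right(1)[of \<omega> x] z x np e_a
    by (auto simp: zx I_eq u_a u_b \<beta>b eb simp del: One_nat_def)
  then show ?thesis using x by (auto simp: zx ist_def isuccs_def u_a u_b a_D b_D)
next
  case False
  then have "snd (I z) \<notin> D" using D by simp
  then show ?thesis using u_main[OF I_S[OF z]] False by (auto simp: ist_def isuccs_def image_iff)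
qed

lemma D_funpow_K: "snd z \<in> D \<Longrightarrow> snd ((K ^^ i) z) \<in> D"
  by (induction i) (auto intro: D_K)

definition iwt :: "bool \<times> bool \<times> nat \<Rightarrow> bool \<times> bool \<times> nat \<Rightarrow> real" where
  "iwt i j = (if j \<in> isuccs i then 1 / N0 else 0)"

definition igam :: "bool \<times> bool \<times> nat \<Rightarrow> real" where
  "igam = (\<lambda>(q, d, t). if \<not> d \<and> 2 \<le> t \<and> t \<le> n then 1 / N0 else 0)"

context
  fixes M assumes M: "M \<in> invariant_probs (switch_space \<beta>) I"
begin

lemma mptI: "mpt M I" and setsI: "sets M = sets (switch_space \<beta>)"
  using invariant_probsD[OF M] by auto

interpretation mpt M I by (rule mptI)

lemma spaceI: "space M = S"
  using sets_eq_imp_space_eq[OF setsI] space_switch by simp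

lemma sist: "simple_function M ist" by (rule simple_ist[OF setsI])

lemma AE_isuccs: "AE z in M. ist (I z) \<in> isuccs (ist z)"
proof -
  let ?D = "{z\<in>space (phase_space \<beta>). snd z \<in> D} \<inter> S"
  have "?D \<in> sets (phase_space \<beta>)" using S_sets by measurable
  then have "?D \<in> sets M" by (simp add: setsI sets_switch)
  moreover have "I z \<in> ?D" if "z \<in> ?D" for z
    using that D_funpow_K[of z] I_S[of z] sets.sets_into_space[OF S_sets] by (auto simp: I_eq)
  ultimately have "AE z in M. I z \<in> ?D \<longrightarrow> z \<in> ?D" by (rule AE_not_entering)
  then show ?thesis
  proof (rule AE_mp, intro AE_I2 impI)
    fix z assume z: "z \<in> space M" and D: "I z \<in> ?D \<longrightarrow> z \<in> ?D"
    have "z \<in> S" using z spaceI by simp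
    then show "ist (I z) \<in> isuccs (ist z)"
      using D I_S[of z] sets.sets_into_space[OF S_sets] by (intro ist_succ) auto
  qed
qed

text \<open>Every step of the induced map costs \<open>ln N0\<close>, with no potential: a row of
  the kernel has at most \<open>N0\<close> entries, all equal to \<open>1 / N0\<close>.\<close>

lemma
  shows I_ks_le: "ks_entropy M I \<le> ereal (ln N0)"
    and I_markov: "ereal (ln N0) \<le> ks_entropy M I \<Longrightarrow> w \<noteq> [] \<Longrightarrow>
      law M (word I ist (Suc (length w))) (w @ [j]) = law M (word I ist (length w)) w * iwt (last w) j"
proof -
  have ssT: "simple_function M (\<lambda>z. (ist z, ist (I z)))"
    using sist simple_T[OF sist] by (rule simple_function_Pair)
  have N: "j \<in> isuccs i" if "0 < law M (\<lambda>z. (ist z, ist (I z))) (i, j)" for i j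
    using law_posE[OF ssT that AE_isuccs] by auto
  have ex: "exp (0 - 0 - ln N0) = 1 / N0" using N0 by (simp add: exp_minus inverse_eq_divide)
  have sub: "(\<Sum>j\<in>isuccs i. exp (0 - 0 - ln N0)) \<le> 1" for i
    using N0 card_isuccs by (cases i) (simp add: ex[simplified])
  have "(\<integral>z. ln N0 \<partial>M) = ln N0" by (simp add: prob_space)
  note bound = markov_entropy_le[where N=isuccs and f="\<lambda>_. 0" and \<kappa>="\<lambda>_. ln N0", OF sist finite_isuccs N sub, unfolded this]
    and eq = markov_entropy_eq[where N=isuccs and f="\<lambda>_. 0" and \<kappa>="\<lambda>_. ln N0", OF sist finite_isuccs N sub, unfolded this ex]
  have gen: "entropy_rate M I p \<le> entropy_rate M I ist" if p: "simple_function M p" for p :: "_ \<Rightarrow> 'z"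
  proof (rule entropy_rate_le_generator[OF p sist])
    fix v
    show "\<exists>A\<in>itin_sets M I ist. prob (sym_diff (p -` {v} \<inter> space M) A) = 0"
      using generator_I[OF mptI setsI law_sets[OF p, of "{v}"]]
      by (intro bexI[of _ "p -` {v} \<inter> space M"]) simp_all
  qed
  show "ks_entropy M I \<le> ereal (ln N0)"
    by (rule ks_entropy_le) (auto intro: order_trans[OF gen bound])
  assume "ereal (ln N0) \<le> ks_entropy M I" and w: "w \<noteq> []"
  moreover have "ks_entropy M I \<le> ereal (entropy_rate M I ist)" by (intro ks_entropy_le gen)
  ultimately have "ln N0 \<le> entropy_rate M I ist" by (metis ereal_less_eq(3) order_trans)
  from eq[OF _ this w]
  show "law M (word I ist (Suc (length w))) (w @ [j]) = law M (word I ist (length w)) w * iwt (last w) j"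
    by (simp add: iwt_def)
qed

text \<open>On exceptional states the row sums to at most \<open>2 / N0 < 1\<close>, so they are
  null. All other predecessors pass on the same fraction, so the label is uniform and independent of
  the past.\<close>

lemma law_igam:
  assumes max: "ereal (ln N0) \<le> ks_entropy M I"
  shows "law M ist i = igam i"
proof -
  have fin: "finite (ist ` space M)" by (rule simple_functionD(1)[OF sist])
  have law2: "law M (word I ist (Suc (Suc 0))) [i, j] = law M ist i * iwt i j" for i j
    using I_markov[OF max, of "[i]" j] by (simp add: law_word_1)
  have exc: "law M ist (q, True, t) = 0" for q t
  proof -
    let ?i = "(q, True, t)"
    have "law M ist ?i = law M ist ?i * (\<Sum>j\<in>ist ` space M. iwt ?i j)"
      using law_stationary(2)[OF sist, of ?i] by (simp add: law2 sum_distrib_left)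
    moreover have "(\<Sum>j\<in>ist ` space M. iwt ?i j) < 1"
    proof -
      have "(\<Sum>j\<in>ist ` space M. iwt ?i j) = (\<Sum>j\<in>ist ` space M \<inter> isuccs ?i. 1 / N0)"
        by (simp only: iwt_def sum.inter_restrict[OF fin])
      also have "\<dots> \<le> (\<Sum>j\<in>isuccs ?i. 1 / N0)"
        using finite_isuccs N0 by (intro sum_mono2) auto
      also have "\<dots> < 1" using card_isuccs[of q True t] N0 by simp
      finally show ?thesis .
    qed
    ultimately show ?thesis by (metis less_irrefl mult_cancel_left1)
  qed
  let ?R = "ist ` space M"
  let ?B = "?R \<inter> {i. \<not> fst (snd i)}"
  have "(\<Sum>i\<in>?R \<inter> UNIV. law M ist i) = 1" unfolding sum_law[OF sist] by (simp add: prob_space)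
  moreover have "(\<Sum>i\<in>?B. law M ist i) = (\<Sum>i\<in>?R. law M ist i)"
  proof (rule sum.mono_neutral_left[OF fin])
    show "\<forall>i\<in>?R - ?B. law M ist i = 0"
    proof
      fix i assume "i \<in> ?R - ?B"
      then have "fst (snd i) = True" by blast
      then have "i = (fst i, True, snd (snd i))" by (metis prod.collapse)
      then show "law M ist i = 0" using exc by metis
    qed
  qed auto
  ultimately have p1: "(\<Sum>i\<in>?B. law M ist i) = 1" by simp
  obtain q d t where i: "i = (q, d, t)" by (cases i)
  show ?thesis
  proof (cases d)
    case True
    then show ?thesis by (simp add: i igam_def exc)
  next
    case False
    have iwt: "iwt i' i = (if i' \<in> ?B then igam i else 0)" if R: "i' \<in> ?R" for i'
    proof -
      obtain q' d' t' where i': "i' = (q', d', t')" by (cases i')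
      show ?thesis using R False by (auto simp: i i' iwt_def isuccs_def igam_def)
    qed
    have "law M ist i = (\<Sum>i'\<in>?R. law M ist i' * iwt i' i)"
      using law_stationary(1)[OF sist, of i] by (simp add: law2)
    also have "\<dots> = (\<Sum>i'\<in>?R. law M ist i' * (if i' \<in> ?B then igam i else 0))"
      by (intro sum.cong refl) (simp only: iwt)
    also have "\<dots> = igam i * (\<Sum>i'\<in>?B. law M ist i')"
      by (rule sum_law_restrict) (use fin in auto)
    finally show ?thesis by (simp add: p1)
  qed
qed

end

lemma I_unique:
  assumes "M \<in> invariant_probs (switch_space \<beta>) I" "ereal (ln N0) \<le> ks_entropy M I"
    "M' \<in> invariant_probs (switch_space \<beta>) I" "ereal (ln N0) \<le> ks_entropy M' I"
  shows "M = M'"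
proof (rule mpt_eqI_markov[where T=I and s=ist and r=iwt and F="{}"])
  show "mpt M I" "mpt M' I" using assms mptI by auto
  show "sets M' = sets M" using assms setsI by simp
  show "simple_function M ist" using assms by (intro sist)
  show "law M ist i = law M' ist i" for i
    using assms by (simp add: law_igam)
  show "law M (word I ist (Suc (length w))) (w @ [j]) = law M (word I ist (length w)) w * iwt (last w) j" if "w \<noteq> []" for w j
    by (rule I_markov[OF assms(1,2) that])
  show "law M' (word I ist (Suc (length w))) (w @ [j]) = law M' (word I ist (length w)) w * iwt (last w) j" if "w \<noteq> []" for w j
    by (rule I_markov[OF assms(3,4) that])
  show "A - {} \<in> itin_sets M I ist" if "A \<in> sets M" for A
    unfolding Diff_empty using assms that by (intro generator_I mptI setsI)
qed simp_all

end

section \<open>Measures of full entropy\<close>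

definition iid :: "'a pmf \<Rightarrow> (nat \<Rightarrow> 'a) measure" where
  "iid p = PiM UNIV (\<lambda>_. measure_pmf p)"

definition shift :: "(nat \<Rightarrow> 'a) \<Rightarrow> nat \<Rightarrow> 'a" where
  "shift s = (\<lambda>i. s (Suc i))"

lemma space_iid[simp]: "space (iid p) = UNIV"
  by (simp add: iid_def space_PiM)

lemma prob_space_iid: "prob_space (iid p)"
  unfolding iid_def by (intro prob_space_PiM prob_space_measure_pmf)

lemma iid_coord[measurable]: "(\<lambda>s. s i) \<in> measurable (iid p) (count_space UNIV)"
proof -
  have "(\<lambda>s. s i) \<in> measurable (iid p) (measure_pmf p)"
    unfolding iid_def by (rule measurable_component_singleton) simp
  then show ?thesis by simp
qed

lemma shift_measurable[measurable]: "shift \<in> measurable (iid p) (iid p)"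
proof -
  have "(\<lambda>s. shift s i) \<in> measurable (iid p) (measure_pmf p)" for i
    using iid_coord[of "Suc i" p] by (simp add: shift_def)
  then have "shift \<in> measurable (iid p) (PiM UNIV (\<lambda>_. measure_pmf p))"
    by (intro measurable_PiM_single') auto
  then show ?thesis by (simp add: iid_def)
qed

text \<open>Prepending an independent letter to an i.i.d. sequence reproduces its law, so the first
  letter is independent of the shifted sequence.\<close>

lemma iid_split:
  assumes A: "A \<in> sets (iid p)"
  shows "measure (iid p) {s. s 0 \<in> C \<and> shift s \<in> A} = measure_pmf.prob p C * measure (iid p) A"
proof -
  interpret prob_space "iid p" by (rule prob_space_iid)
  interpret product_prob_space "\<lambda>_. measure_pmf p" "UNIV :: nat set" ..
  interpret seq: sequence_space "measure_pmf p" ..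
  have iter: "distr (measure_pmf p \<Otimes>\<^sub>M iid p) (iid p) (\<lambda>(x, s). case_nat x s) = iid p"
    using seq.PiM_iter by (simp add: iid_def)
  have m: "(\<lambda>(x, s). case_nat x s) \<in> measurable (measure_pmf p \<Otimes>\<^sub>M iid p) (iid p)"
    unfolding iid_def by measurable
  have E: "{s. s 0 \<in> C \<and> shift s \<in> A} \<in> sets (iid p)"
  proof -
    have "{s. s 0 \<in> C \<and> shift s \<in> A} = ((\<lambda>s. s 0) -` C \<inter> space (iid p)) \<inter> (shift -` A \<inter> space (iid p))" by auto
    also have "\<dots> \<in> sets (iid p)"
      using A by (intro sets.Int measurable_sets[OF iid_coord] measurable_sets[OF shift_measurable]) auto
    finally show ?thesis .
  qed
  have "emeasure (iid p) {s. s 0 \<in> C \<and> shift s \<in> A} =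
      emeasure (distr (measure_pmf p \<Otimes>\<^sub>M iid p) (iid p) (\<lambda>(x, s). case_nat x s)) {s. s 0 \<in> C \<and> shift s \<in> A}"
    by (simp only: iter)
  also have "\<dots> = emeasure (measure_pmf p \<Otimes>\<^sub>M iid p)
      ((\<lambda>(x, s). case_nat x s) -` {s. s 0 \<in> C \<and> shift s \<in> A} \<inter> space (measure_pmf p \<Otimes>\<^sub>M iid p))"
    by (rule emeasure_distr[OF m E])
  also have "(\<lambda>(x, s). case_nat x s) -` {s. s 0 \<in> C \<and> shift s \<in> A} \<inter> space (measure_pmf p \<Otimes>\<^sub>M iid p) = C \<times> A"
    by (auto simp: space_pair_measure shift_def)
  also have "emeasure (measure_pmf p \<Otimes>\<^sub>M iid p) (C \<times> A) = emeasure (measure_pmf p) C * emeasure (iid p) A"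
    by (rule sigma_finite_measure.emeasure_pair_measure_Times[OF prob_space_imp_sigma_finite[OF prob_space_iid] _ A]) simp
  finally show ?thesis by (simp add: measure_def enn2real_mult)
qed

lemma iid_shift: "distr (iid p) (iid p) shift = iid p"
proof (rule measure_eqI)
  interpret prob_space "iid p" by (rule prob_space_iid)
  fix A assume "A \<in> sets (distr (iid p) (iid p) shift)"
  then have A: "A \<in> sets (iid p)" by simp
  have "shift -` A \<inter> space (iid p) = {s. s 0 \<in> UNIV \<and> shift s \<in> A}" by auto
  then show "emeasure (distr (iid p) (iid p) shift) A = emeasure (iid p) A"
    using A iid_split[OF A, of UNIV] by (simp add: emeasure_distr[OF shift_measurable A] emeasure_eq_measure)
qed simp

section \<open>Points of the switch region coded by sequences of labels\<close>

context shrinking_beta begin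

text \<open>Labels with a time outside \<open>2..n\<close> are read as time \<open>2\<close>, so
  that every sequence codes a point; the laws used below do not charge them.\<close>

definition cl :: "bool \<times> nat \<Rightarrow> bool \<times> nat" where
  "cl = (\<lambda>(d, t). (d, if 2 \<le> t \<and> t \<le> n then t else 2))"

lemma cl_cases: obtains d t where "cl v = (d, t)" "2 \<le> t" "t \<le> n" "fst v = d"
  using that[of "fst v" "snd (cl v)"] n by (cases v) (auto simp: cl_def split: if_splits)

text \<open>For the digit \<open>1\<close>, the branch with time \<open>n\<close> fixes
  \<open>a\<close> and the branch with time \<open>2\<close> fixes \<open>b\<close>; monotonicity in
  \<open>x\<close> and in \<open>t\<close> gives the bounds and the cases of equality.\<close>

lemma br_left:
  assumes t: "2 \<le> t" "t \<le> n" and x: "a \<le> x" "x \<le> b"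
  shows "a \<le> 1 / \<beta> + x / \<beta> ^ t" "1 / \<beta> + x / \<beta> ^ t \<le> b"
    "1 / \<beta> + x / \<beta> ^ t = a \<Longrightarrow> x = a \<and> t = n"
    "1 / \<beta> + x / \<beta> ^ t = b \<Longrightarrow> x = b \<and> t = 2"
proof -
  have A: "1 / \<beta> + a / \<beta> ^ n = a"
  proof -
    have nn: "\<beta> ^ n = \<beta> * \<beta> ^ (n - 1)" using n by (cases n) auto
    have "\<beta> * (1 / \<beta> + a / \<beta> ^ n) = 1 + c" using \<beta>1 by (simp add: nn c_def algebra_simps)
    also have "\<dots> = \<beta> * a" by (simp add: c_eq)
    finally show ?thesis using \<beta>1 by simp
  qed
  have Bb: "1 / \<beta> + b / \<beta> ^ 2 = b"
  proof -
    have "\<beta> * (1 / \<beta> + b / \<beta> ^ 2) = 1 + a" using \<beta>1 by (simp add: b_eq power2_eq_square algebra_simps)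
    also have "\<dots> = \<beta> * b" using \<beta>b by simp
    finally show ?thesis using \<beta>1 by simp
  qed
  have xpos: "0 < x" using x a_pos by simp
  have 1: "a / \<beta> ^ n \<le> x / \<beta> ^ n" "x / \<beta> ^ 2 \<le> b / \<beta> ^ 2"
    using x \<beta>1 by (auto intro!: divide_right_mono)
  have 2: "x / \<beta> ^ n \<le> x / \<beta> ^ t" "x / \<beta> ^ t \<le> x / \<beta> ^ 2"
    using t \<beta>1 xpos by (auto intro!: divide_left_mono power_increasing)
  show "a \<le> 1 / \<beta> + x / \<beta> ^ t" "1 / \<beta> + x / \<beta> ^ t \<le> b" using 1 2 A Bb by linarith+
  {
    assume "1 / \<beta> + x / \<beta> ^ t = a"
    then have eq: "a / \<beta> ^ n = x / \<beta> ^ n" "x / \<beta> ^ n = x / \<beta> ^ t" using 1 2 A by linarith+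
    from eq(1) have "x = a" using \<beta>1 by simp
    moreover from eq(2) have "\<beta> ^ n = \<beta> ^ t" using xpos \<beta>1 by (simp add: field_simps)
    then have "t = n" using \<beta>1 power_inject_exp by metis
    ultimately show "x = a \<and> t = n" by simp
  }
  {
    assume "1 / \<beta> + x / \<beta> ^ t = b"
    then have eq: "x / \<beta> ^ 2 = b / \<beta> ^ 2" "x / \<beta> ^ t = x / \<beta> ^ 2" using 1 2 Bb by linarith+
    from eq(1) have "x = b" using \<beta>1 by simp
    moreover from eq(2) have "\<beta> ^ 2 = \<beta> ^ t" using xpos \<beta>1 by (simp add: field_simps)
    then have "t = 2" using \<beta>1 power_inject_exp by metis
    ultimately show "x = b \<and> t = 2" by simp
  }
qed

lemma br_cl:
  assumes x: "a \<le> x" "x \<le> b"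
  shows "a \<le> br (cl v) x" "br (cl v) x \<le> b"
    "br (cl v) x = a \<Longrightarrow> x = a \<and> cl v \<in> {(True, n), (False, 2)}"
    "br (cl v) x = b \<Longrightarrow> x = b \<and> cl v \<in> {(True, 2), (False, n)}"
proof -
  obtain d t where v: "cl v = (d, t)" "2 \<le> t" "t \<le> n" by (rule cl_cases)
  have x': "a \<le> e - x" "e - x \<le> b" using x e_a by auto
  have neg: "br (False, t) x = e - (1 / \<beta> + (e - x) / \<beta> ^ t)" by (simp add: br_def)
  note l = br_left[OF v(2,3) x] and r = br_left[OF v(2,3) x']
  show "a \<le> br (cl v) x" "br (cl v) x \<le> b"
    using l(1,2) r(1,2) e_a neg unfolding v(1) by (cases d; simp add: br_def; linarith)+
  show "x = a \<and> cl v \<in> {(True, n), (False, 2)}" if "br (cl v) x = a"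
  proof (cases d)
    case True
    then show ?thesis using that l(3) by (simp add: v br_def)
  next
    case False
    then have "1 / \<beta> + (e - x) / \<beta> ^ t = b" using that neg e_a by (simp add: v)
    then show ?thesis using r(4) False e_a by (auto simp: v)
  qed
  show "x = b \<and> cl v \<in> {(True, 2), (False, n)}" if "br (cl v) x = b"
  proof (cases d)
    case True
    then show ?thesis using that l(4) by (simp add: v br_def)
  next
    case False
    then have "1 / \<beta> + (e - x) / \<beta> ^ t = a" using that neg e_a by (simp add: v)
    then show ?thesis using r(3) False e_a by (auto simp: v)
  qed
qed

lemma br_contract: "\<bar>br (cl v) x - br (cl v) y\<bar> \<le> \<bar>x - y\<bar> / \<beta>"
proof -
  obtain d t where v: "cl v = (d, t)" "2 \<le> t" "t \<le> n" by (rule cl_cases)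
  have "br (cl v) x - br (cl v) y = (x - y) / \<beta> ^ t"
    by (simp add: v br_def diff_divide_distrib)
  moreover have "\<bar>x - y\<bar> / \<beta> ^ t \<le> \<bar>x - y\<bar> / \<beta> ^ 1"
    using v \<beta>1 by (intro divide_left_mono power_increasing) auto
  ultimately show ?thesis using \<beta>1 by (simp add: abs_divide)
qed

text \<open>Inverse branches along the sequence, applied to the base point \<open>a\<close>. They
  contract, and \<open>code\<close> is the limit.\<close>

primrec approx :: "nat \<Rightarrow> (nat \<Rightarrow> bool \<times> nat) \<Rightarrow> real" where
  "approx 0 s = a"
| "approx (Suc m) s = br (cl (s 0)) (approx m (shift s))"

definition code :: "(nat \<Rightarrow> bool \<times> nat) \<Rightarrow> real" where
  "code s = lim (\<lambda>m. approx m s)"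

lemma approx_range: "a \<le> approx m s \<and> approx m s \<le> b"
  using a_less_b by (induction m arbitrary: s) (auto intro: br_cl)

lemma approx_diff: "\<bar>approx (Suc m) s - approx m s\<bar> \<le> (b - a) * (1 / \<beta>) ^ m"
proof (induction m arbitrary: s)
  case 0
  show ?case using approx_range[of 1 s] by simp
next
  case (Suc m)
  have "\<bar>approx (Suc (Suc m)) s - approx (Suc m) s\<bar> \<le> \<bar>approx (Suc m) (shift s) - approx m (shift s)\<bar> / \<beta>"
    using br_contract by simp
  also have "\<dots> \<le> (b - a) * (1 / \<beta>) ^ m / \<beta>" using \<beta>1 by (intro divide_right_mono Suc) simp
  finally show ?case by simp
qed

lemma approx_tendsto: "(\<lambda>m. approx m s) \<longlonglongrightarrow> code s"
proof -
  have "summable (\<lambda>m. (b - a) * (1 / \<beta>) ^ m)"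
    using \<beta>1 by (intro summable_mult summable_geometric) simp
  then have "summable (\<lambda>m. approx (Suc m) s - approx m s)"
    by (rule summable_comparison_test[rotated]) (use approx_diff in \<open>auto simp del: approx.simps\<close>)
  then have "(\<lambda>m. \<Sum>i<m. approx (Suc i) s - approx i s) \<longlonglongrightarrow> (\<Sum>m. approx (Suc m) s - approx m s)"
    by (rule summable_LIMSEQ)
  then have "(\<lambda>m. approx m s - approx 0 s) \<longlonglongrightarrow> (\<Sum>m. approx (Suc m) s - approx m s)"
    by (simp only: sum_lessThan_telescope[of "\<lambda>i. approx i s"])
  from tendsto_add[OF this tendsto_const[of "approx 0 s"]]
  have "convergent (\<lambda>m. approx m s)" by (auto simp: convergent_def simp del: approx.simps)
  then show ?thesis by (simp add: code_def convergent_LIMSEQ_iff)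
qed

lemma code_range: "a \<le> code s" "code s \<le> b"
  using LIMSEQ_le_const[OF approx_tendsto] LIMSEQ_le_const2[OF approx_tendsto] approx_range by blast+

lemma code_eq: "code s = br (cl (s 0)) (code (shift s))"
proof (rule LIMSEQ_unique)
  show "(\<lambda>m. approx (Suc m) s) \<longlonglongrightarrow> code s" by (rule LIMSEQ_Suc[OF approx_tendsto])
  have "(\<lambda>m. br (cl (s 0)) (approx m (shift s)) - br (cl (s 0)) (code (shift s))) \<longlonglongrightarrow> 0"
  proof (rule Lim_null_comparison)
    show "\<forall>\<^sub>F m in sequentially. norm (br (cl (s 0)) (approx m (shift s)) - br (cl (s 0)) (code (shift s))) \<le>
        \<bar>approx m (shift s) - code (shift s)\<bar> / \<beta>"
      using br_contract by (simp add: always_eventually)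
    have "(\<lambda>m. \<bar>approx m (shift s) - code (shift s)\<bar> / \<beta>) \<longlonglongrightarrow> \<bar>code (shift s) - code (shift s)\<bar> / \<beta>"
      using \<beta>1 by (intro tendsto_intros approx_tendsto) simp
    then show "(\<lambda>m. \<bar>approx m (shift s) - code (shift s)\<bar> / \<beta>) \<longlonglongrightarrow> 0" by simp
  qed
  then show "(\<lambda>m. approx (Suc m) s) \<longlonglongrightarrow> br (cl (s 0)) (code (shift s))"
    by (simp add: LIM_zero_iff)
qed

lemma approx_measurable: "approx m \<in> borel_measurable (iid p)"
proof (induction m)
  case (Suc m)
  have "(\<lambda>s. br (cl (s 0)) (approx m (shift s))) \<in> borel_measurable (iid p)"
  proof (rule measurable_compose_countable[where f="\<lambda>v s. br (cl v) (approx m (shift s))", OF _ iid_coord])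
    have "continuous_on UNIV (br v)" for v
      using \<beta>1 by (cases v; cases "fst v") (auto simp: br_def intro!: continuous_intros)
    then have "br v \<in> borel_measurable borel" for v by (rule borel_measurable_continuous_onI)
    then show "(\<lambda>s. br (cl v) (approx m (shift s))) \<in> borel_measurable (iid p)" for v
      using measurable_compose[OF measurable_compose[OF shift_measurable Suc]] by blast
  qed
  then show ?case by (simp add: approx.simps(2)[abs_def])
qed (simp add: approx.simps(1)[abs_def])

lemma code_measurable[measurable]: "code \<in> borel_measurable (iid p)"
  using borel_measurable_LIMSEQ_metric[OF approx_measurable approx_tendsto] .

definition dec :: "(nat \<Rightarrow> bool \<times> nat) \<Rightarrow> (nat \<Rightarrow> bool) \<times> real" where
  "dec s = (\<lambda>i. fst (s i), code s)"

lemma dec_S: "dec s \<in> S"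
  using code_range by (simp add: dec_def mem_S)

lemma dec_measurable: "dec \<in> measurable (iid p) (switch_space \<beta>)"
  unfolding switch_space_def
proof (rule measurable_restrict_space2)
  show "dec \<in> space (iid p) \<rightarrow> S" using dec_S by simp
  show "dec \<in> measurable (iid p) (phase_space \<beta>)"
  proof (rule measurable_phaseI)
    show "(\<lambda>z. fst (dec z)) \<in> measurable (iid p) coin_space"
    proof (rule measurable_coinI)
      fix i
      have "(\<lambda>s. s i) -` {v. fst v} \<inter> space (iid p) \<in> sets (iid p)" by (rule measurable_sets[OF iid_coord]) simp
      then show "{z \<in> space (iid p). fst (dec z) i} \<in> sets (iid p)" by (simp add: dec_def vimage_def)
    qed
    show "(\<lambda>z. snd (dec z)) \<in> borel_measurable (iid p)" by (simp add: dec_def)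
    show "0 \<le> snd (dec z) \<and> snd (dec z) \<le> e" for z
      using code_range[of z] order_facts by (simp add: dec_def)
  qed
qed

text \<open>Away from the end points the labels are the true digits and return times, so decoding
  carries the shift to the induced map.\<close>

lemma dec_step:
  assumes "code (shift s) \<noteq> a" "code (shift s) \<noteq> b"
  shows "u (dec s) = snd (cl (s 0))" "I (dec s) = dec (shift s)"
proof -
  obtain d t where v: "cl (s 0) = (d, t)" "2 \<le> t" "t \<le> n" "fst (s 0) = d" by (rule cl_cases)
  have x: "a < code (shift s)" "code (shift s) < b" using code_range[of "shift s"] assms by (auto simp: less_le)
  have ds: "dec s = (\<lambda>i. fst (s i), br (d, t) (code (shift s)))"
    unfolding dec_def using code_eq[of s] by (simp add: v(1))
  note r = br_return[of "\<lambda>i. fst (s i)", OF v(4,2,3) x]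
  show u: "u (dec s) = snd (cl (s 0))" unfolding ds by (simp add: r(2) v(1))
  have "I (dec s) = (K ^^ t) (dec s)" by (simp add: I_eq u v(1))
  also have "\<dots> = dec (shift s)" unfolding ds r(3) by (simp add: dec_def left_shift_def shift_def)
  finally show "I (dec s) = dec (shift s)" .
qed

text \<open>The label is independent of the future and has weights \<open>w\<close>. With an
  arbitrary event \<open>A\<close> for the future, this can be iterated along words of the induced
  map and of \<open>K\<close> alike.\<close>

definition bernoulli :: "(bool \<times> nat \<Rightarrow> real) \<Rightarrow> ((nat \<Rightarrow> bool) \<times> real) measure \<Rightarrow> bool" where
  "bernoulli w \<nu> \<longleftrightarrow> \<nu> \<in> invariant_probs (switch_space \<beta>) I \<and> (AE z in \<nu>. snd z \<notin> D) \<and>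
     (\<forall>d t A. 2 \<le> t \<longrightarrow> t \<le> n \<longrightarrow> A \<in> sets (switch_space \<beta>) \<longrightarrow>
       measure \<nu> {z\<in>S. fst z 0 = d \<and> u z = t \<and> I z \<in> A} = w (d, t) * measure \<nu> A)"

text \<open>The image of the i.i.d. law under \<open>dec\<close>. The point is that sequences coding
  an end point, for which \<open>dec_step\<close> is silent, form a null set.\<close>

lemma bernoulli_measure:
  assumes p: "set_pmf p = UNIV \<times> {2..n}"
  shows "\<exists>\<nu>. bernoulli (pmf p) \<nu>"
proof -
  interpret prob_space "iid p" by (rule prob_space_iid)
  have pcl: "measure_pmf.prob p {v. cl v = (d, t)} = pmf p (d, t)" if "2 \<le> t" "t \<le> n" for d t
  proof -
    have "{v. cl v = (d, t)} \<inter> set_pmf p = {(d, t)} \<inter> set_pmf p"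
      using that unfolding p by (auto simp: cl_def)
    then have "measure_pmf.prob p {v. cl v = (d, t)} = measure_pmf.prob p {(d, t)}"
      by (metis measure_Int_set_pmf)
    then show ?thesis by (simp add: measure_pmf_single)
  qed
  have pos: "0 < pmf p (d, t)" if "2 \<le> t" "t \<le> n" for d t
    using that by (simp add: pmf_positive_iff p)
  \<comment> \<open>If the shift of a sequence coding \<open>x\<close> codes \<open>x\<close> again
    and the first label avoids \<open>(d, n)\<close>, then the probability \<open>P\<close> of
    coding \<open>x\<close> satisfies \<open>P \<le> (1 - pmf p (d, n)) * P\<close>, so it
    vanishes.\<close>
  have null: "prob {s. code s = x} = 0"
    if *: "\<And>s. code s = x \<Longrightarrow> code (shift s) = x \<and> cl (s 0) \<noteq> (d, n)" for x d
  proof -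
    have X: "{s. code s = x} \<in> sets (iid p)"
      using measurable_sets[OF code_measurable, of "{x}"] by (simp add: vimage_def)
    have "prob {s. code s = x} \<le> prob {s. s 0 \<in> - {v. cl v = (d, n)} \<and> shift s \<in> {s. code s = x}}"
    proof (rule finite_measure_mono)
      show "{s. code s = x} \<subseteq> {s. s 0 \<in> - {v. cl v = (d, n)} \<and> shift s \<in> {s. code s = x}}" using * by auto
      have "{s. s 0 \<in> - {v. cl v = (d, n)} \<and> shift s \<in> {s. code s = x}} =
          ((\<lambda>s. s 0) -` (- {v. cl v = (d, n)}) \<inter> space (iid p)) \<inter> (shift -` {s. code s = x} \<inter> space (iid p))" by auto
      also have "\<dots> \<in> sets (iid p)"
        using X by (intro sets.Int measurable_sets[OF iid_coord] measurable_sets[OF shift_measurable]) auto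
      finally show "{s. s 0 \<in> - {v. cl v = (d, n)} \<and> shift s \<in> {s. code s = x}} \<in> sets (iid p)" .
    qed
    also have "\<dots> = measure_pmf.prob p (- {v. cl v = (d, n)}) * prob {s. code s = x}"
      by (rule iid_split[OF X])
    also have "measure_pmf.prob p (- {v. cl v = (d, n)}) = 1 - pmf p (d, n)"
      using pcl[of n d] n measure_pmf.prob_compl[of "{v. cl v = (d, n)}" p] by (simp add: Compl_eq_Diff_UNIV)
    finally have "pmf p (d, n) * prob {s. code s = x} \<le> 0" by (simp add: algebra_simps)
    then show ?thesis using pos[of n d] n measure_nonneg[of "iid p" "{s. code s = x}"]
      by (simp add: mult_le_0_iff)
  qed
  \<comment> \<open>Only the labels \<open>(True, n)\<close> and \<open>(False, 2)\<close> lead to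
    \<open>a\<close>, so \<open>(False, n)\<close> is avoided, as \<open>n \<ge> 3\<close>. For
    \<open>b\<close>, the avoided label is \<open>(True, n)\<close>.\<close>
  have "prob {s. code s = a} = 0"
  proof (rule null[of a False])
    fix s assume "code s = a"
    then have "br (cl (s 0)) (code (shift s)) = a" by (simp add: code_eq[symmetric])
    from br_cl(3)[OF code_range this] show "code (shift s) = a \<and> cl (s 0) \<noteq> (False, n)" using n by auto
  qed
  moreover have "prob {s. code s = b} = 0"
  proof (rule null[of b True])
    fix s assume "code s = b"
    then have "br (cl (s 0)) (code (shift s)) = b" by (simp add: code_eq[symmetric])
    from br_cl(4)[OF code_range this] show "code (shift s) = b \<and> cl (s 0) \<noteq> (True, n)" using n by auto
  qed
  moreover have "{s. code s = x} \<in> sets (iid p)" for x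
    using measurable_sets[OF code_measurable, of "{x}"] by (simp add: vimage_def)
  ultimately have ab: "AE s in iid p. code s \<noteq> a \<and> code s \<noteq> b"
    using prob_eq_0[of "{s. code s = a}"] prob_eq_0[of "{s. code s = b}"] by auto
  have "AE s in distr (iid p) (iid p) shift. code s \<noteq> a \<and> code s \<noteq> b" using ab by (simp only: iid_shift)
  then have ab': "AE s in iid p. code (shift s) \<noteq> a \<and> code (shift s) \<noteq> b"
    by (subst (asm) AE_distr_iff[OF shift_measurable]) (use \<open>\<And>x. {s. code s = x} \<in> sets (iid p)\<close> in measurable)
  define \<nu> where "\<nu> = distr (iid p) (switch_space \<beta>) dec"
  have sets\<nu>: "sets \<nu> = sets (switch_space \<beta>)" by (simp add: \<nu>_def)
  have I\<nu>: "I \<in> measurable \<nu> \<nu>" using I_measurable by (simp add: \<nu>_def)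
  have "distr \<nu> \<nu> I = distr (iid p) (switch_space \<beta>) (\<lambda>s. I (dec s))"
    unfolding \<nu>_def using distr_distr[OF I_measurable dec_measurable] by (simp add: o_def cong: distr_cong)
  also have "\<dots> = distr (iid p) (switch_space \<beta>) (\<lambda>s. dec (shift s))"
  proof (rule distr_cong_AE)
    show "AE s in iid p. I (dec s) = dec (shift s)" using ab' by eventually_elim (simp add: dec_step)
    show "(\<lambda>s. I (dec s)) \<in> measurable (iid p) (switch_space \<beta>)"
      by (rule measurable_compose[OF dec_measurable I_measurable])
    show "(\<lambda>s. dec (shift s)) \<in> measurable (iid p) (switch_space \<beta>)"
      by (rule measurable_compose[OF shift_measurable dec_measurable])
  qed simp_all
  also have "\<dots> = distr (distr (iid p) (iid p) shift) (switch_space \<beta>) dec"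
    using distr_distr[OF dec_measurable shift_measurable] by (simp add: o_def)
  also have "\<dots> = \<nu>" by (simp add: iid_shift \<nu>_def)
  finally have 1: "\<nu> \<in> invariant_probs (switch_space \<beta>) I"
    using I\<nu> prob_space_distr[OF dec_measurable] sets\<nu> by (simp add: invariant_probs_def \<nu>_def)
  have 2: "AE z in \<nu>. snd z \<notin> D"
  proof -
    have "{z \<in> space (switch_space \<beta>). snd z \<notin> D} \<in> sets (switch_space \<beta>)"
    proof -
      have "{z \<in> space (switch_space \<beta>). snd z \<notin> D} = {z \<in> space (phase_space \<beta>). snd z \<notin> D} \<inter> S"
        using sets.sets_into_space[OF S_sets] by (auto simp: space_switch)
      moreover have "{z \<in> space (phase_space \<beta>). snd z \<notin> D} \<inter> S \<in> sets (phase_space \<beta>)" using S_sets by measurable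
      ultimately show ?thesis by (simp add: sets_switch)
    qed
    then show ?thesis
      unfolding \<nu>_def
    proof (subst AE_distr_iff[OF dec_measurable])
      show "AE s in iid p. snd (dec s) \<notin> D"
        using ab
      proof eventually_elim
        case (elim s)
        then show ?case using D_S[OF _ dec_S, of s] by (auto simp: dec_def)
      qed
    qed
  qed
  have 3: "measure \<nu> {z\<in>S. fst z 0 = d \<and> u z = t \<and> I z \<in> A} = pmf p (d, t) * measure \<nu> A"
    if t: "2 \<le> t" "t \<le> n" and A: "A \<in> sets (switch_space \<beta>)" for d t A
  proof -
    have preA: "dec -` A \<in> sets (iid p)" using measurable_sets[OF dec_measurable A] by simp
    have E: "{z\<in>S. fst z 0 = d \<and> u z = t \<and> I z \<in> A} \<in> sets (switch_space \<beta>)"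
    proof -
      have "{z\<in>space (phase_space \<beta>). fst z 0 = d \<and> u z = t} \<inter> S \<in> sets (phase_space \<beta>)" using S_sets by measurable
      then have "{z\<in>space (phase_space \<beta>). fst z 0 = d \<and> u z = t} \<inter> S \<in> sets (switch_space \<beta>)" by (simp add: sets_switch)
      from sets.Int[OF this measurable_sets[OF I_measurable A]]
      show ?thesis
        by (rule back_subst[where P="\<lambda>X. X \<in> sets (switch_space \<beta>)"])
          (use sets.sets_into_space[OF S_sets] in \<open>auto simp: space_switch\<close>)
    qed
    have "measure \<nu> {z\<in>S. fst z 0 = d \<and> u z = t \<and> I z \<in> A} =
        prob (dec -` {z\<in>S. fst z 0 = d \<and> u z = t \<and> I z \<in> A} \<inter> space (iid p))"
      unfolding \<nu>_def by (rule measure_distr[OF dec_measurable E])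
    also have "\<dots> = prob {s. s 0 \<in> {v. cl v = (d, t)} \<and> shift s \<in> dec -` A}"
    proof (rule finite_measure_eq_AE)
      show "AE s in iid p. (s \<in> dec -` {z\<in>S. fst z 0 = d \<and> u z = t \<and> I z \<in> A} \<inter> space (iid p)) =
          (s \<in> {s. s 0 \<in> {v. cl v = (d, t)} \<and> shift s \<in> dec -` A})"
        using ab'
      proof eventually_elim
        case (elim s)
        have "fst (cl (s 0)) = fst (s 0)" by (simp add: cl_def split: prod.split)
        moreover have "fst (dec s) 0 = fst (s 0)" by (simp add: dec_def)
        ultimately show ?case using dec_step[of s] elim dec_S[of s] by (cases "cl (s 0)") auto
      qed
      show "dec -` {z\<in>S. fst z 0 = d \<and> u z = t \<and> I z \<in> A} \<inter> space (iid p) \<in> sets (iid p)"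
        by (rule measurable_sets[OF dec_measurable E])
      have "{s. s 0 \<in> {v. cl v = (d, t)} \<and> shift s \<in> dec -` A} =
          ((\<lambda>s. s 0) -` {v. cl v = (d, t)} \<inter> space (iid p)) \<inter> (shift -` (dec -` A) \<inter> space (iid p))" by auto
      also have "\<dots> \<in> sets (iid p)"
        using preA by (intro sets.Int measurable_sets[OF iid_coord] measurable_sets[OF shift_measurable]) auto
      finally show "{s. s 0 \<in> {v. cl v = (d, t)} \<and> shift s \<in> dec -` A} \<in> sets (iid p)" .
    qed
    also have "\<dots> = measure_pmf.prob p {v. cl v = (d, t)} * prob (dec -` A)" by (rule iid_split[OF preA])
    also have "prob (dec -` A) = measure \<nu> A"
      unfolding \<nu>_def using measure_distr[OF dec_measurable A] by simp
    finally show ?thesis by (simp add: pcl t)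
  qed
  show ?thesis using 1 2 3 unfolding bernoulli_def by (intro exI[of _ \<nu>]) simp
qed

text \<open>By independence each letter contributes a factor \<open>1 / N0\<close>, so the cylinders
  are uniformly small.\<close>

lemma I_full_entropy: "\<exists>\<nu>\<in>invariant_probs (switch_space \<beta>) I. ereal (ln N0) \<le> ks_entropy \<nu> I"
proof -
  let ?A = "(UNIV :: bool set) \<times> {2..n}"
  define p where "p = pmf_of_set ?A"
  have A: "?A \<noteq> {}" "finite ?A" using n by auto
  have p: "set_pmf p = ?A" unfolding p_def by (rule set_pmf_of_set[OF A])
  have pp: "pmf p (d, t) = 1 / N0" if "2 \<le> t" "t \<le> n" for d t
    using that A n by (simp add: p_def N0_def of_nat_diff)
  obtain \<nu> where B: "bernoulli (pmf p) \<nu>" using bernoulli_measure[OF p] by blast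
  then have \<nu>: "\<nu> \<in> invariant_probs (switch_space \<beta>) I" and D: "AE z in \<nu>. snd z \<notin> D"
    by (simp_all add: bernoulli_def)
  have bern: "measure \<nu> {z\<in>S. fst z 0 = d \<and> u z = t \<and> I z \<in> A} = pmf p (d, t) * measure \<nu> A"
    if "2 \<le> t" "t \<le> n" "A \<in> sets (switch_space \<beta>)" for d t A
    using B that unfolding bernoulli_def by blast
  interpret mpt \<nu> I by (rule mptI[OF \<nu>])
  have s: "simple_function \<nu> ist" by (rule sist[OF \<nu>])
  have le: "law \<nu> (word I ist m) w \<le> (1 / N0) ^ m" for m w
  proof (induction m arbitrary: w)
    case 0
    show ?case using law_le_1 by simp
  next
    case (Suc m)
    show ?case
    proof (cases "law \<nu> (word I ist (Suc m)) w = 0")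
      case True
      then show ?thesis using N0 by simp
    next
      case False
      then have "0 < law \<nu> (word I ist (Suc m)) w" by (simp add: less_le)
      \<comment> \<open>A word of positive probability is realised outside \<open>D\<close>, so its
        first letter is a label with \<open>2 \<le> t \<le> n\<close>.\<close>
      then obtain z where z: "z \<in> space \<nu>" "word I ist (Suc m) z = w" "snd z \<notin> D"
        using D by (rule law_posE[OF simple_word[OF s]])
      have zS: "z \<in> S" using z by (simp add: spaceI[OF \<nu>])
      obtain d t where dt: "fst z 0 = d" "u z = t" by auto
      have t: "2 \<le> t" "t \<le> n" using u_main[OF zS z(3)] dt by auto
      have hd: "hd w = (d, False, t)" using z dt by (auto simp: word_Suc ist_def)
      let ?A = "word I ist m -` {tl w} \<inter> space \<nu>"
      have A: "?A \<in> sets \<nu>" by (rule law_sets[OF simple_word[OF s]])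
      have "law \<nu> (word I ist (Suc m)) w \<le> measure \<nu> {z\<in>S. fst z 0 = d \<and> u z = t \<and> I z \<in> ?A}"
        unfolding law_def
      proof (rule finite_measure_mono)
        show "word I ist (Suc m) -` {w} \<inter> space \<nu> \<subseteq> {z\<in>S. fst z 0 = d \<and> u z = t \<and> I z \<in> ?A}"
          using hd T_space by (auto simp: word_Suc ist_def spaceI[OF \<nu>])
        have "{z\<in>S. fst z 0 = d \<and> u z = t \<and> I z \<in> ?A} =
            (ist -` {v. fst v = d \<and> snd (snd v) = t} \<inter> space \<nu>) \<inter> (I -` ?A \<inter> space \<nu>)"
          by (auto simp: ist_def spaceI[OF \<nu>])
        also have "\<dots> \<in> sets \<nu>" using law_sets[OF s] measurable_sets[OF T A] by (rule sets.Int)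
        finally show "{z\<in>S. fst z 0 = d \<and> u z = t \<and> I z \<in> ?A} \<in> sets \<nu>" .
      qed
      also have "\<dots> = 1 / N0 * law \<nu> (word I ist m) (tl w)"
        using bern[OF t, of ?A d] A pp[OF t, of d] by (simp add: setsI[OF \<nu>] law_def)
      also have "\<dots> \<le> 1 / N0 * (1 / N0) ^ m" using N0 by (intro mult_left_mono Suc) auto
      finally show ?thesis by simp
    qed
  qed
  have "ln N0 \<le> entropy_rate \<nu> I ist"
    by (rule entropy_rate_ge[OF s, of 1]) (use N0 le in auto)
  then have "ereal (ln N0) \<le> ks_entropy \<nu> I" using ks_entropy_ge[OF s] by (metis ereal_less_eq(3) order_trans)
  then show ?thesis using \<nu> by blast
qed

section \<open>The tower over the Bernoulli measure with weights
  \<open>(1 / lam) ^ t\<close>\<close>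

lemma sum_lam: "(\<Sum>x\<in>(UNIV :: bool set) \<times> {2..n}. (1 / lam) ^ snd x) = 1"
proof -
  have "(\<Sum>x\<in>(UNIV :: bool set) \<times> {2..n}. (1 / lam) ^ snd x) = (\<Sum>d\<in>(UNIV :: bool set). \<Sum>t=2..n. (1 / lam) ^ t)"
    unfolding sum.cartesian_product by (intro sum.cong) auto
  then show ?thesis using lam(2) by simp
qed

lemma lam_pmf:
  obtains p :: "(bool \<times> nat) pmf" where "set_pmf p = UNIV \<times> {2..n}"
    "\<And>d t. 2 \<le> t \<Longrightarrow> t \<le> n \<Longrightarrow> pmf p (d, t) = (1 / lam) ^ t"
proof
  let ?A = "(UNIV :: bool set) \<times> {2..n}"
  define f where "f x = (if x \<in> ?A then (1 / lam) ^ snd x else 0)" for x :: "bool \<times> nat"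
  have f0: "0 \<le> f x" for x using lam(1) by (simp add: f_def)
  have "(\<integral>\<^sup>+x. ennreal (f x) \<partial>count_space UNIV) = (\<Sum>x\<in>?A. ennreal (f x))"
    by (rule nn_integral_count_space') (auto simp: f_def)
  also have "\<dots> = ennreal (\<Sum>x\<in>?A. f x)" by (simp add: f0)
  also have "(\<Sum>x\<in>?A. f x) = 1" using sum_lam by (simp add: f_def)
  finally have f1: "(\<integral>\<^sup>+x. ennreal (f x) \<partial>count_space UNIV) = 1" by simp
  show "set_pmf (embed_pmf f) = ?A"
  proof -
    have "set_pmf (embed_pmf f) = {x. f x \<noteq> 0}" by (rule set_embed_pmf[OF f0 f1])
    also have "\<dots> = ?A" using lam(1) by (auto simp: f_def)
    finally show ?thesis .
  qed
  show "pmf (embed_pmf f) (d, t) = (1 / lam) ^ t" if "2 \<le> t" "t \<le> n" for d t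
  proof -
    have "pmf (embed_pmf f) (d, t) = f (d, t)" by (rule pmf_embed_pmf[OF f0 f1])
    also have "\<dots> = (1 / lam) ^ t" using that by (simp add: f_def)
    finally show ?thesis .
  qed
qed

text \<open>Strong induction along returns. The first letter reveals the digit and the return time
  \<open>t\<close>, which have probability \<open>(1 / lam) ^ t\<close>, and the word left after
  \<open>t\<close> steps starts at the image under the induced map. Probabilities thus decay by
  \<open>1 / lam\<close> per unit of time rather than per return.\<close>

lemma bern_K_word:
  assumes B: "bernoulli w \<nu>" and w: "\<And>d t. 2 \<le> t \<Longrightarrow> t \<le> n \<Longrightarrow> w (d, t) = (1 / lam) ^ t"
    and W: "\<And>m w. {z\<in>S. word K s0 m z = w} \<in> sets (switch_space \<beta>)"
  shows "measure \<nu> {z\<in>S. word K s0 m z = v} \<le> (1 / lam) ^ m"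
proof (induction m arbitrary: v rule: less_induct)
  case (less m)
  have \<nu>: "\<nu> \<in> invariant_probs (switch_space \<beta>) I" and D: "AE z in \<nu>. snd z \<notin> D"
    using B by (simp_all add: bernoulli_def)
  have bern: "measure \<nu> {z\<in>S. fst z 0 = d \<and> u z = t \<and> I z \<in> A} = (1 / lam) ^ t * measure \<nu> A"
    if "2 \<le> t" "t \<le> n" "A \<in> sets (switch_space \<beta>)" for d t A
  proof -
    have "measure \<nu> {z\<in>S. fst z 0 = d \<and> u z = t \<and> I z \<in> A} = w (d, t) * measure \<nu> A"
      using B that by (simp add: bernoulli_def)
    then show ?thesis by (simp only: w[OF that(1,2)])
  qed
  interpret mpt \<nu> I by (rule mptI[OF \<nu>])
  let ?E = "{z\<in>S. word K s0 m z = v}"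
  have E: "?E \<in> sets \<nu>" using W by (simp add: setsI[OF \<nu>])
  show ?case
  proof (cases "m = 0 \<or> prob ?E = 0")
    case True
    then show ?thesis using lam(1) by auto
  next
    case False
    then have m: "0 < m" and pos: "prob ?E \<noteq> 0" by auto
    have "\<exists>z\<in>?E. snd z \<notin> D"
    proof (rule ccontr)
      assume *: "\<not> (\<exists>z\<in>?E. snd z \<notin> D)"
      have "AE z in \<nu>. z \<notin> ?E" using D by eventually_elim (use * in blast)
      then show False using pos E by (simp add: prob_eq_0)
    qed
    then obtain z where zS: "z \<in> S" and zw: "word K s0 m z = v" and zD: "snd z \<notin> D" by auto
    obtain d t where dt: "fst z 0 = d" "u z = t" by auto
    have t: "2 \<le> t" "t \<le> n" using u_main[OF zS zD] dt by auto
    have s0S: "s0 y = (Sw (fst y 0), snd y \<in> D, u y, None)" if "y \<in> S" for y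
      using that S_core[OF that] F_core[of y] a_less_b by (auto simp: st_def sd_def S_eq)
    have w0: "v ! 0 = (Sw d, False, t, None)"
      using zw[symmetric] m s0S[OF zS] dt zD by (simp add: nth_word)
    have Edt: "fst y 0 = d \<and> u y = t" if "y \<in> ?E" for y
    proof -
      have "s0 y = v ! 0" using that m by (auto simp: nth_word)
      then show ?thesis using s0S[of y] that w0 by simp
    qed
    \<comment> \<open>If the word ends before the first return, the future is left free, as
      \<open>(1 / lam) ^ t\<close> is then already small enough.\<close>
    let ?A = "if t \<le> m then {z\<in>S. word K s0 (m - t) z = drop t v} else S"
    have SS: "S \<in> sets (switch_space \<beta>)" using sets.top[of "switch_space \<beta>"] by (simp add: space_switch)
    have A: "?A \<in> sets (switch_space \<beta>)" using W SS by simp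
    have sub: "?E \<subseteq> {z\<in>S. fst z 0 = d \<and> u z = t \<and> I z \<in> ?A}"
    proof
      fix y assume y: "y \<in> ?E"
      then have yS: "y \<in> S" and yw: "word K s0 m y = v" by auto
      have "I y \<in> ?A"
      proof (cases "t \<le> m")
        case True
        have "drop t v = word K s0 (m - t) ((K ^^ t) y)"
          using yw word_add[of K s0 t "m - t" y] True by simp
        then show ?thesis using True I_S[OF yS] Edt[OF y] by (simp add: I_eq)
      qed (use I_S[OF yS] in simp)
      then show "y \<in> {z\<in>S. fst z 0 = d \<and> u z = t \<and> I z \<in> ?A}" using yS Edt[OF y] by simp
    qed
    have "prob ?E \<le> prob {z\<in>S. fst z 0 = d \<and> u z = t \<and> I z \<in> ?A}"
    proof (rule finite_measure_mono[OF sub])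
      have "{z\<in>S. fst z 0 = d \<and> u z = t \<and> I z \<in> ?A} =
          (ist -` {v. fst v = d \<and> snd (snd v) = t} \<inter> space \<nu>) \<inter> (I -` ?A \<inter> space \<nu>)"
        by (auto simp: ist_def spaceI[OF \<nu>])
      also have "\<dots> \<in> sets \<nu>"
        by (rule sets.Int[OF law_sets[OF sist[OF \<nu>]] measurable_sets[OF T A[folded setsI[OF \<nu>]]]])
      finally show "{z\<in>S. fst z 0 = d \<and> u z = t \<and> I z \<in> ?A} \<in> sets \<nu>" .
    qed
    also have "\<dots> = (1 / lam) ^ t * prob ?A" by (rule bern[OF t A])
    also have "\<dots> \<le> (1 / lam) ^ m"
    proof (cases "t \<le> m")
      case True
      have "prob ?A \<le> (1 / lam) ^ (m - t)"
        using less.IH[of "m - t" "drop t v"] True t by simp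
      then have "(1 / lam) ^ t * prob ?A \<le> (1 / lam) ^ t * (1 / lam) ^ (m - t)"
        using lam(1) by (intro mult_left_mono) auto
      then show ?thesis using True by (simp only: power_add[symmetric] le_add_diff_inverse)
    next
      case False
      have "(1 / lam) ^ t * prob ?A \<le> (1 / lam) ^ t * 1" using lam(1) by (intro mult_left_mono) auto
      also have "(1 / lam) ^ t \<le> (1 / lam) ^ m" using False lam(1) by (intro power_decreasing) auto
      finally show ?thesis by simp
    qed
    finally show ?thesis .
  qed
qed

text \<open>The tower over an \<open>I\<close>-invariant measure: a point of the switch region together with a level below
  its return time.\<close>

lemma tower_measure:
  assumes \<nu>: "\<nu> \<in> invariant_probs (switch_space \<beta>) I"
  obtains \<mu> Z where "\<mu> \<in> invariant_probs (phase_space \<beta>) K" "0 < Z"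
    "\<And>A. A \<in> sets (phase_space \<beta>) \<Longrightarrow>
      measure \<mu> A = (\<Sum>j<n. measure \<nu> {z\<in>S. j < u z \<and> (K ^^ j) z \<in> A}) / Z"
proof -
  interpret mpt \<nu> I by (rule mptI[OF \<nu>])
  have sp: "space \<nu> = S" by (rule spaceI[OF \<nu>])
  have phS: "f \<in> measurable \<nu> N" if "f \<in> measurable (phase_space \<beta>) N" for f and N :: "'z measure"
    using measurable_restrict_space1[OF that, of S] setsI[OF \<nu>]
    by (simp add: switch_space_def cong: measurable_cong_sets)
  \<comment> \<open>All \<open>n\<close> levels over every point; the tower \<open>Tw\<close> is cut
    out by conditioning on levels below the return time.\<close>
  define J where "J = \<nu> \<Otimes>\<^sub>M count_space {..<n}"
  interpret C: sigma_finite_measure "count_space {..<n}" by (rule sigma_finite_measure_count_space_finite) simp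
  interpret P: pair_sigma_finite \<nu> "count_space {..<n}" ..
  have emJ: "emeasure J B = ennreal (\<Sum>j<n. prob {z\<in>S. (z, j) \<in> B})" if B: "B \<in> sets J" for B
  proof -
    have BS: "B \<subseteq> S \<times> {..<n}" using sets.sets_into_space[OF B] by (simp add: J_def space_pair_measure sp)
    have "emeasure J B = (\<integral>\<^sup>+j. emeasure \<nu> ((\<lambda>z. (z, j)) -` B) \<partial>count_space {..<n})"
      using B unfolding J_def by (rule P.emeasure_pair_measure_alt2)
    also have "\<dots> = (\<Sum>j<n. emeasure \<nu> ((\<lambda>z. (z, j)) -` B))" by (rule nn_integral_count_space_finite) simp
    also have "\<dots> = (\<Sum>j<n. ennreal (prob {z\<in>S. (z, j) \<in> B}))"
    proof (intro sum.cong refl)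
      fix j
      have "(\<lambda>z. (z, j)) -` B = {z\<in>S. (z, j) \<in> B}" using BS by auto
      then show "emeasure \<nu> ((\<lambda>z. (z, j)) -` B) = ennreal (prob {z\<in>S. (z, j) \<in> B})" by (simp add: emeasure_eq_measure)
    qed
    finally show ?thesis by simp
  qed
  have pj: "(\<lambda>v. f (snd v) (fst v)) \<in> measurable J N" if "\<And>j. f j \<in> measurable (phase_space \<beta>) N" for f :: "nat \<Rightarrow> _" and N :: "'z measure"
  proof (rule measurable_compose_countable'[where f="\<lambda>j v. f j (fst v)" and I="{..<n}"])
    show "(\<lambda>v. f j (fst v)) \<in> measurable J N" for j
      unfolding J_def by (rule measurable_compose[OF measurable_fst phS[OF that]])
    show "snd \<in> measurable J (count_space {..<n})" unfolding J_def by (rule measurable_snd)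
  qed simp
  define Tw where "Tw = {v\<in>space J. snd v < u (fst v)}"
  have Tw: "Tw \<in> sets J"
  proof -
    have "(\<lambda>v. (\<lambda>j z. j < u z) (snd v) (fst v)) \<in> measurable J (count_space UNIV)"
      by (rule pj) measurable
    from measurable_sets[OF this, of "{True}"] show ?thesis
      by (simp add: Tw_def vimage_def Int_def conj_commute)
  qed
  define h where "h = (\<lambda>v. (K ^^ snd v) (fst v))"
  have h: "h \<in> measurable J (phase_space \<beta>)" unfolding h_def by (rule pj) (rule K_funpow_measurable)
  \<comment> \<open>The mean return time, as the sum of its tail probabilities.\<close>
  define Z where "Z = (\<Sum>j<n. prob {z\<in>S. j < u z})"
  have u1: "1 \<le> u z" "u z \<le> n" if "z \<in> S" for z using u_core(1,2)[OF S_core[OF that]] by auto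
  have emTw: "emeasure J Tw = ennreal Z"
  proof -
    have "{z\<in>S. (z, j) \<in> Tw} = {z\<in>S. j < u z}" if "j < n" for j
      using that by (auto simp: Tw_def J_def space_pair_measure sp)
    then show ?thesis unfolding emJ[OF Tw] Z_def by simp
  qed
  have Z: "0 < Z"
  proof -
    have "{z\<in>S. 0 < u z} = space \<nu>" using u1 by (force simp: sp)
    then have "prob {z\<in>S. 0 < u z} = 1" by (simp add: prob_space)
    moreover have "prob {z\<in>S. 0 < u z} \<le> Z" unfolding Z_def using n by (intro member_le_sum) auto
    ultimately show ?thesis by simp
  qed
  define \<mu> where "\<mu> = distr (uniform_measure J Tw) (phase_space \<beta>) h"
  have hU: "h \<in> measurable (uniform_measure J Tw) (phase_space \<beta>)" using h by simp
  have probU: "prob_space (uniform_measure J Tw)"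
    using emTw Z by (intro prob_space_uniform_measure) auto
  define tw where "tw j A = prob {z\<in>S. j < u z \<and> (K ^^ j) z \<in> A}" for j A
  have em\<mu>: "emeasure \<mu> A = ennreal ((\<Sum>j<n. tw j A) / Z)" if A: "A \<in> sets (phase_space \<beta>)" for A
  proof -
    have hA: "h -` A \<inter> space J \<in> sets J" by (rule measurable_sets[OF h A])
    have "emeasure \<mu> A = emeasure (uniform_measure J Tw) (h -` A \<inter> space J)"
      unfolding \<mu>_def using emeasure_distr[OF hU A] by simp
    also have "\<dots> = emeasure J (Tw \<inter> (h -` A \<inter> space J)) / emeasure J Tw"
      by (rule emeasure_uniform_measure[OF Tw hA])
    also have "emeasure J (Tw \<inter> (h -` A \<inter> space J)) = ennreal (\<Sum>j<n. tw j A)"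
    proof -
      have "{z\<in>S. (z, j) \<in> Tw \<inter> (h -` A \<inter> space J)} = {z\<in>S. j < u z \<and> (K ^^ j) z \<in> A}" if "j < n" for j
        using that by (auto simp: Tw_def J_def space_pair_measure sp h_def)
      then show ?thesis unfolding emJ[OF sets.Int[OF Tw hA]] tw_def by simp
    qed
    finally show ?thesis using Z by (simp add: emTw divide_ennreal sum_nonneg tw_def)
  qed
  have prob\<mu>: "prob_space \<mu>" unfolding \<mu>_def by (rule prob_space.prob_space_distr[OF probU hU])
  have m\<mu>: "measure \<mu> A = (\<Sum>j<n. tw j A) / Z" if "A \<in> sets (phase_space \<beta>)" for A
    using em\<mu>[OF that] Z by (simp add: measure_def sum_nonneg tw_def)
  \<comment> \<open>Pulling back by \<open>K\<close> raises each level by one, except at the top,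
    where points return to the base. The returning parts make up the preimage of
    \<open>A \<inter> S\<close> under the induced map, whose measure is that of level
    \<open>0\<close>.\<close>
  have inv: "(\<Sum>j<n. tw j (K -` A \<inter> space (phase_space \<beta>))) = (\<Sum>j<n. tw j A)" if A: "A \<in> sets (phase_space \<beta>)" for A
  proof -
    have KjA: "{z\<in>S. P (u z) \<and> (K ^^ j) z \<in> A} \<in> sets \<nu>" for j P
    proof -
      have "u -` {k. P k} \<inter> space \<nu> \<in> sets \<nu>" "(K ^^ j) -` A \<inter> space \<nu> \<in> sets \<nu>"
        by (rule measurable_sets[OF phS[OF u_measurable]], simp, rule measurable_sets[OF phS[OF K_funpow_measurable] A])
      from sets.Int[OF this] show ?thesis
        by (rule back_subst[where P="\<lambda>X. X \<in> sets \<nu>"]) (auto simp: sp)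
    qed
    define r where "r k = prob {z\<in>S. u z = k \<and> (K ^^ k) z \<in> A}" for k
    have step: "tw j (K -` A \<inter> space (phase_space \<beta>)) = tw (Suc j) A + r (Suc j)" for j
    proof -
      have "{z\<in>S. j < u z \<and> (K ^^ j) z \<in> K -` A \<inter> space (phase_space \<beta>)} =
          {z\<in>S. Suc j < u z \<and> (K ^^ Suc j) z \<in> A} \<union> {z\<in>S. u z = Suc j \<and> (K ^^ Suc j) z \<in> A}"
      proof -
        have "(K ^^ j) z \<in> space (phase_space \<beta>)" if "z \<in> S" for z
          using that measurable_space[OF K_funpow_measurable] sets.sets_into_space[OF S_sets] by blast
        then show ?thesis by auto
      qed
      then show ?thesis
        unfolding tw_def r_def
        using finite_measure_Union[OF KjA[of "\<lambda>k. Suc j < k" "Suc j"] KjA[of "\<lambda>k. k = Suc j" "Suc j"]]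
        by (simp del: funpow.simps) (subst finite_measure_Union[symmetric], auto simp del: funpow.simps intro: KjA)
    qed
    have tw0: "tw 0 A = prob (A \<inter> S)"
      unfolding tw_def by (rule arg_cong[where f=prob]) (use u1 in force)
    have "tw n A = 0"
    proof -
      have "{z\<in>S. n < u z \<and> (K ^^ n) z \<in> A} = {}" using u1 by force
      then show ?thesis unfolding tw_def by (simp only: measure_empty)
    qed
    moreover have "(\<Sum>j<n. r (Suc j)) = prob (A \<inter> S)"
    proof -
      have AS: "A \<inter> S \<in> sets \<nu>" using A S_sets by (simp add: setsI[OF \<nu>] sets_switch)
      have "prob (A \<inter> S) = prob (I -` (A \<inter> S) \<inter> space \<nu>)" by (rule prob_T[OF AS, symmetric])
      also have "I -` (A \<inter> S) \<inter> space \<nu> = (\<Union>j<n. {z\<in>S. u z = Suc j \<and> (K ^^ Suc j) z \<in> A})"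
      proof (intro set_eqI iffI)
        fix z assume z: "z \<in> I -` (A \<inter> S) \<inter> space \<nu>"
        then have zS: "z \<in> S" and "(K ^^ u z) z \<in> A" by (auto simp: sp I_eq)
        moreover obtain j where "u z = Suc j" "j < n" using u1[OF zS] by (cases "u z") auto
        ultimately show "z \<in> (\<Union>j<n. {z\<in>S. u z = Suc j \<and> (K ^^ Suc j) z \<in> A})" by (auto simp del: funpow.simps)
      next
        fix z assume "z \<in> (\<Union>j<n. {z\<in>S. u z = Suc j \<and> (K ^^ Suc j) z \<in> A})"
        then obtain j where j: "z \<in> S" "u z = Suc j" "(K ^^ Suc j) z \<in> A" by blast
        have "I z = (K ^^ Suc j) z" unfolding I_eq j(2) ..
        then show "z \<in> I -` (A \<inter> S) \<inter> space \<nu>" using j(1,3) I_S[OF j(1)] by (simp add: sp)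
      qed
      also have "prob \<dots> = (\<Sum>j<n. r (Suc j))"
        unfolding r_def using KjA by (intro finite_measure_finite_Union) (auto simp: disjoint_family_on_def simp del: funpow.simps)
      finally show ?thesis ..
    qed
    moreover have "(\<Sum>j<n. tw (Suc j) A) + tw 0 A = (\<Sum>j<n. tw j A) + tw n A"
      using sum.lessThan_Suc_shift[of "\<lambda>j. tw j A" n] by simp
    ultimately show ?thesis by (simp add: step sum.distrib tw0)
  qed
  have "distr \<mu> (phase_space \<beta>) K = \<mu>"
  proof (rule measure_eqI)
    show "sets (distr \<mu> (phase_space \<beta>) K) = sets \<mu>" by (simp add: \<mu>_def)
    fix A assume "A \<in> sets (distr \<mu> (phase_space \<beta>) K)"
    then have A: "A \<in> sets (phase_space \<beta>)" by simp
    have K\<mu>: "K \<in> measurable \<mu> (phase_space \<beta>)" using K_measurable by (simp add: \<mu>_def)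
    have "space \<mu> = space (phase_space \<beta>)" by (simp add: \<mu>_def)
    then have "emeasure (distr \<mu> (phase_space \<beta>) K) A = emeasure \<mu> (K -` A \<inter> space (phase_space \<beta>))"
      using emeasure_distr[OF K\<mu> A] by simp
    also have "\<dots> = emeasure \<mu> A"
      using em\<mu>[OF A] em\<mu>[OF measurable_sets[OF K_measurable A]] inv[OF A] by simp
    finally show "emeasure (distr \<mu> (phase_space \<beta>) K) A = emeasure \<mu> A" .
  qed
  moreover have "sets \<mu> = sets (phase_space \<beta>)" by (simp add: \<mu>_def)
  ultimately have "\<mu> \<in> invariant_probs (phase_space \<beta>) K"
    using K_measurable prob\<mu> unfolding invariant_probs_def
    by (auto cong: measurable_cong_sets distr_cong)
  then show thesis using that[OF _ Z] m\<mu> unfolding tw_def by blast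
qed

end

section \<open>Existence for \<open>K\<close>, and comparison of the two maximal measures\<close>

lemma ex1_max_entropy_measure:
  assumes le: "\<And>M. M \<in> invariant_probs N T \<Longrightarrow> ks_entropy M T \<le> c"
    and ex: "\<exists>M\<in>invariant_probs N T. c \<le> ks_entropy M T"
    and uniq: "\<And>M M'. M \<in> invariant_probs N T \<Longrightarrow> c \<le> ks_entropy M T \<Longrightarrow>
      M' \<in> invariant_probs N T \<Longrightarrow> c \<le> ks_entropy M' T \<Longrightarrow> M = M'"
  shows "\<exists>!M. max_entropy_measure N T M"
    and "max_entropy_measure N T M \<Longrightarrow> M \<in> invariant_probs N T \<and> c \<le> ks_entropy M T"
proof -
  have sup: "(SUP M\<in>invariant_probs N T. ks_entropy M T) = c"
    using ex by (intro antisym SUP_least le) (auto intro: SUP_upper2)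
  have iff: "max_entropy_measure N T M \<longleftrightarrow> M \<in> invariant_probs N T \<and> c \<le> ks_entropy M T" for M
    unfolding max_entropy_measure_def sup using le[of M] by (auto intro: antisym)
  show "\<exists>!M. max_entropy_measure N T M" unfolding iff using ex uniq by blast
  show "max_entropy_measure N T M \<Longrightarrow> M \<in> invariant_probs N T \<and> c \<le> ks_entropy M T" by (simp add: iff)
qed

context shrinking_beta begin

text \<open>A word seen from level \<open>j\<close> of the tower ends a word of length
  \<open>j + m\<close> seen from the base. The finitely many possible beginnings cost only the
  constant \<open>C\<close>, so cylinders have measure at most
  \<open>C / Z * (1 / lam) ^ m\<close>.\<close>

lemma K_full_entropy: "\<exists>\<mu>\<in>invariant_probs (phase_space \<beta>) K. ereal (ln lam) \<le> ks_entropy \<mu> K"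
proof -
  obtain p :: "(bool \<times> nat) pmf" where p: "set_pmf p = UNIV \<times> {2..n}"
    "\<And>d t. 2 \<le> t \<Longrightarrow> t \<le> n \<Longrightarrow> pmf p (d, t) = (1 / lam) ^ t" by (rule lam_pmf) blast
  obtain \<nu> where B: "bernoulli (pmf p) \<nu>" using bernoulli_measure[OF p(1)] by blast
  then have \<nu>: "\<nu> \<in> invariant_probs (switch_space \<beta>) I" by (simp add: bernoulli_def)
  obtain \<mu> Z where \<mu>: "\<mu> \<in> invariant_probs (phase_space \<beta>) K" and Z: "0 < Z"
    and m\<mu>: "\<And>A. A \<in> sets (phase_space \<beta>) \<Longrightarrow>
      measure \<mu> A = (\<Sum>j<n. measure \<nu> {z\<in>S. j < u z \<and> (K ^^ j) z \<in> A}) / Z"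
    by (rule tower_measure[OF \<nu>]) blast
  interpret K: mpt \<mu> K by (rule mptK[OF \<mu>])
  interpret I: mpt \<nu> I by (rule mptI[OF \<nu>])
  have s: "simple_function \<mu> s0" by (rule simple_st[OF setsK[OF \<mu>]]) simp
  have wset: "word K s0 m -` V \<inter> space \<mu> \<in> sets (phase_space \<beta>)" for m V
    using K.law_sets[OF K.simple_word[OF s]] by (simp add: setsK[OF \<mu>])
  have S_sub: "S \<subseteq> space \<mu>" using sets.sets_into_space[OF S_sets] sets_eq_imp_space_eq[OF setsK[OF \<mu>]] by simp
  have W: "{z\<in>S. word K s0 m z \<in> V} \<in> sets (switch_space \<beta>)" for m V
  proof -
    have "{z\<in>S. word K s0 m z \<in> V} = (word K s0 m -` V \<inter> space \<mu>) \<inter> S" using S_sub by auto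
    moreover have "(word K s0 m -` V \<inter> space \<mu>) \<inter> S \<in> sets (phase_space \<beta>)" by (rule sets.Int[OF wset S_sets])
    ultimately show ?thesis by (simp add: sets_switch)
  qed
  have W1: "{z\<in>S. word K s0 m z = v} \<in> sets (switch_space \<beta>)" for m v
    using W[of m "{v}"] by simp
  have bound: "measure \<nu> {z\<in>S. word K s0 m z = w} \<le> (1 / lam) ^ m" for m w
    by (rule bern_K_word[OF B p(2) W1])
  let ?V = "\<lambda>j. word K s0 j ` S"
  have finV: "finite (?V j)" for j
    by (rule finite_subset[OF image_mono[OF S_sub] simple_functionD(1)[OF K.simple_word[OF s]]])
  define C where "C = (\<Sum>j<n. real (card (?V j)))"
  have level: "measure \<nu> {z\<in>S. j < u z \<and> (K ^^ j) z \<in> word K s0 m -` {w} \<inter> space \<mu>} \<le> real (card (?V j)) * (1 / lam) ^ m" for j m w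
  proof -
    have "{z\<in>S. j < u z \<and> (K ^^ j) z \<in> word K s0 m -` {w} \<inter> space \<mu>} \<subseteq> (\<Union>v\<in>?V j. {z\<in>S. word K s0 (j + m) z = v @ w})"
      by (auto simp: word_add)
    then have "measure \<nu> {z\<in>S. j < u z \<and> (K ^^ j) z \<in> word K s0 m -` {w} \<inter> space \<mu>} \<le>
        measure \<nu> (\<Union>v\<in>?V j. {z\<in>S. word K s0 (j + m) z = v @ w})"
      using W1 finV by (intro I.finite_measure_mono sets.finite_UN) (auto simp: setsI[OF \<nu>])
    also have "\<dots> \<le> (\<Sum>v\<in>?V j. measure \<nu> {z\<in>S. word K s0 (j + m) z = v @ w})"
      using W1 finV by (intro I.finite_measure_subadditive_finite) (auto simp: setsI[OF \<nu>])
    also have "\<dots> \<le> (\<Sum>v\<in>?V j. (1 / lam) ^ m)"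
    proof (rule sum_mono)
      fix v
      have "measure \<nu> {z\<in>S. word K s0 (j + m) z = v @ w} \<le> (1 / lam) ^ (j + m)" by (rule bound)
      also have "\<dots> \<le> (1 / lam) ^ m" using lam(1) by (intro power_decreasing) auto
      finally show "measure \<nu> {z\<in>S. word K s0 (j + m) z = v @ w} \<le> (1 / lam) ^ m" .
    qed
    finally show ?thesis by simp
  qed
  have le: "law \<mu> (word K s0 m) w \<le> C / Z * (1 / lam) ^ m" for m w
  proof -
    have "law \<mu> (word K s0 m) w \<le> (\<Sum>j<n. real (card (?V j)) * (1 / lam) ^ m) / Z"
      unfolding law_def m\<mu>[OF wset] using Z by (intro divide_right_mono sum_mono level) simp
    then show ?thesis by (simp add: C_def sum_distrib_right)
  qed
  have "0 < C"
  proof -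
    have "S \<noteq> {}" using dec_S by blast
    then have "0 < real (card (?V 0))" using finV[of 0] by (simp add: card_gt_0_iff)
    moreover have "real (card (?V 0)) \<le> C" unfolding C_def using n by (intro member_le_sum) auto
    ultimately show ?thesis by simp
  qed
  then have "ln lam \<le> entropy_rate \<mu> K s0"
    using Z lam(1) by (intro K.entropy_rate_ge[OF s, of "C / Z"] le) auto
  then have "ereal (ln lam) \<le> ks_entropy \<mu> K" using K.ks_entropy_ge[OF s] by (metis ereal_less_eq(3) order_trans)
  then show ?thesis using \<mu> by blast
qed

text \<open>Labels with digit \<open>1\<close> and times \<open>2\<close> and \<open>3\<close>, both
  available as \<open>n \<ge> 3\<close>, have equal mass under the uniform law, while for the
  measure induced by \<open>\<mu>\<close> their masses differ by the factor
  \<open>lam\<close>.\<close>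

lemma induced_not_max:
  assumes \<mu>: "\<mu> \<in> invariant_probs (phase_space \<beta>) K" "ereal (ln lam) \<le> ks_entropy \<mu> K"
    and \<nu>: "\<nu> \<in> invariant_probs (switch_space \<beta>) I" "ereal (ln N0) \<le> ks_entropy \<nu> I"
  shows "measure \<mu> S > 0 \<and> induced_measure \<mu> S \<noteq> \<nu>"
proof -
  interpret K: mpt \<mu> K by (rule mptK[OF \<mu>(1)])
  note sets\<mu> = setsK[OF \<mu>(1)]
  let ?Q = "\<lambda>t. s0 -` {(Sw True, False, t, None)} \<inter> space \<mu>"
  have Q: "?Q t \<in> sets \<mu>" for t by (rule K.law_sets[OF s0[OF \<mu>]])
  have S: "S \<in> sets \<mu>" using S_sets by (simp add: sets\<mu>)
  have QS: "?Q t \<subseteq> S" for t by (auto simp: st_def dest: sd_SwD)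
  have mQ: "measure \<mu> (?Q t) = entry \<mu> * (1 / lam) ^ t" if "2 \<le> t" "t \<le> n" for t
    using law_Sw[OF \<mu>, of True t] that by (simp add: law_def)
  have pos: "0 < measure \<mu> S"
  proof -
    have "0 < measure \<mu> (?Q 2)" using mQ[of 2] n entry(2)[OF \<mu>] lam(1) by simp
    also have "\<dots> \<le> measure \<mu> S" by (rule K.finite_measure_mono[OF QS S])
    finally show ?thesis .
  qed
  moreover have "induced_measure \<mu> S \<noteq> \<nu>"
  proof
    assume eq: "induced_measure \<mu> S = \<nu>"
    have *: "entry \<mu> * (1 / lam) ^ t / measure \<mu> S = 1 / N0" if t: "2 \<le> t" "t \<le> n" for t
    proof -
      \<comment> \<open>On the switch region the states of \<open>K\<close> and of the induced map
        carry the same information.\<close>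
      have "ist -` {(True, False, t)} \<inter> S = ?Q t"
      proof (intro set_eqI iffI)
        fix z assume z: "z \<in> ist -` {(True, False, t)} \<inter> S"
        then have zS: "z \<in> S" by simp
        have "z \<in> space \<mu>" using sets.sets_into_space[OF S] zS by blast
        then show "z \<in> ?Q t"
          using z S_core[OF zS] F_core[of z] by (auto simp: ist_def st_def sd_def S_eq)
      next
        fix z assume z: "z \<in> ?Q t"
        then have zS: "z \<in> S" using QS by blast
        then show "z \<in> ist -` {(True, False, t)} \<inter> S"
          using z S_core[OF zS] by (auto simp: ist_def st_def sd_def S_eq split: if_splits)
      qed
      then have "law \<nu> ist (True, False, t) = measure (induced_measure \<mu> S) (?Q t)"
        by (simp add: law_def spaceI[OF \<nu>(1)] eq)
      also have "\<dots> = measure \<mu> (?Q t) / measure \<mu> S"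
        by (rule measure_induced_measure[OF K.prob_space_axioms S Q QS])
      finally show ?thesis using law_igam[OF \<nu>, of "(True, False, t)"] mQ[OF t] t by (simp add: igam_def)
    qed
    have "entry \<mu> * (1 / lam) ^ 2 / measure \<mu> S = entry \<mu> * (1 / lam) ^ 3 / measure \<mu> S"
      using *[of 2] *[of 3] n by simp
    then have "(1 / lam) ^ 2 = (1 / lam) ^ 3" using pos entry(2)[OF \<mu>] by simp
    then show False using lam(1) by (simp add: power2_eq_square power3_eq_cube)
  qed
  ultimately show ?thesis by simp
qed

end

theorem theorem1p3:
  fixes n :: nat and \<beta> :: real
  assumes "n \<ge> 3"
    and "1 < \<beta>" and "\<beta> < 2"
    and "\<beta> ^ n = (\<Sum>k\<le>n - 2. \<beta> ^ k)"
    and "\<And>x::real. 0 < x \<Longrightarrow> x ^ n = (\<Sum>k\<le>n - 2. x ^ k) \<Longrightarrow> x \<le> \<beta>"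
  shows "(\<exists>!\<mu>. max_entropy_measure (phase_space \<beta>) (shrinking_map \<beta>) \<mu>) \<and>
    (\<exists>!\<nu>. max_entropy_measure (switch_space \<beta>) (induced_shrinking_map \<beta>) \<nu>) \<and>
    (\<forall>\<mu> \<nu>. max_entropy_measure (phase_space \<beta>) (shrinking_map \<beta>) \<mu> \<and>
       max_entropy_measure (switch_space \<beta>) (induced_shrinking_map \<beta>) \<nu> \<longrightarrow>
       measure \<mu> (switch_region \<beta>) > 0 \<and> induced_measure \<mu> (switch_region \<beta>) \<noteq> \<nu>)"
proof -
  interpret shrinking_beta n \<beta> by unfold_locales (use assms in auto)
  note K = ex1_max_entropy_measure[OF K_ks_le K_full_entropy K_unique]
  note I = ex1_max_entropy_measure[OF I_ks_le I_full_entropy I_unique]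
  show ?thesis
    unfolding I_def[symmetric]
  proof (intro conjI allI impI)
    show "\<exists>!\<mu>. max_entropy_measure (phase_space \<beta>) K \<mu>" by (rule K(1))
    show "\<exists>!\<nu>. max_entropy_measure (switch_space \<beta>) I \<nu>" by (rule I(1))
    fix \<mu> \<nu>
    assume *: "max_entropy_measure (phase_space \<beta>) K \<mu> \<and> max_entropy_measure (switch_space \<beta>) I \<nu>"
    then show "0 < measure \<mu> S" "induced_measure \<mu> S \<noteq> \<nu>"
      using induced_not_max[of \<mu> \<nu>] K(2)[of \<mu>] I(2)[of \<nu>] by auto
  qed
qed

end
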